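(* Let $p$ be a prime, let $(\mathcal L,\Delta,S)$ be a locality, and suppose that $(\mathcal L,\Delta,S)$ is the internal central product of sublocalities $(\mathcal L_1,\Delta_1,S_1)$ and $(\mathcal L_2,\Delta_2,S_2)$. Then $(\mathcal L_i,\Delta_i,S_i)$ is of objective characteristic $p$ for $i=1,2$ if and only if $\mathcal L_1\cap\mathcal L_2\le S_1\cap S_2$ and $(\mathcal L,\Delta,S)$ is of objective characteristic $p$. Similarly, $(\mathcal L_i,\Delta_i,S_i)$ is a linking locality for $i=1,2$ if and only if $\mathcal L_1\cap\mathcal L_2\le S_1\cap S_2$ and $(\mathcal L,\Delta,S)$ is a linking locality.
   Context: Partial groups. For a set $X$, $\mathbf W(X)$ is the set of finite words in $X$ (including the empty word $\emptyset$), $\circ$ is concatenation, and $x\in X$ is identified with the word $(x)$. A partial group is a nonempty set $\mathcal L$ with an involutory bijection $f\mapsto f^{-1}$ (extended to words by $(f_1,\dots,f_n)^{-1}=(f_n^{-1},\dots,f_1^{-1})$), a domain $\mathbf D\subseteq\mathbf W(\mathcal L)$ and a product $\Pi:\mathbf D\to\mathcal L$ such that: (1) $\mathcal L\subseteq\mathbf D$, and $u\circ v\in\mathbf D$ implies $u,v\in\mathbf D$; (2) $\Pi$ restricts to the identity on $\mathcal L$; (3) if $u\circ v\circ w\in\mathbf D$ then $u\circ(\Pi(v))\circ w\in\mathbf D$ and $\Pi(u\circ v\circ w)=\Pi(u\circ(\Pi(v))\circ w)$; (4) if $w\in\mathbf D$ then $w^{-1}\circ w\in\mathbf D$ and $\Pi(w^{-1}\circ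 w)=\mathbf 1:=\Pi(\emptyset)$. A partial subgroup is a subset $\mathcal H$ closed under inversion and with $\Pi(w)\in\mathcal H$ for all $w\in\mathbf W(\mathcal H)\cap\mathbf D$; it is itself a partial group with the restricted product. It is a subgroup if moreover $\mathbf W(\mathcal H)\subseteq\mathbf D$ (then it is a group), and a $p$-subgroup if its order is a power of $p$. For $g\in\mathcal L$, $\mathbf D(g)=\{x\in\mathcal L:(g^{-1},x,g)\in\mathbf D\}$, $x^g=\Pi(g^{-1},x,g)$ for $x\in\mathbf D(g)$, and $X^g=\{x^g:x\in X\}$ for $X\subseteq\mathbf D(g)$. For $X\subseteq\mathcal L$, $N_{\mathcal L}(X)=\{g: X\subseteq\mathbf D(g),\ X^g=X\}$. For subsets $X,Y$, $XY=\{\Pi(x,y):x\in X,y\in Y,(x,y)\in\mathbf D\}$. Localities. For a set $\Delta$ of subgroups of $\mathcal L$, $\mathbf D_\Delta$ is the set of words $(f_1,\dots,f_n)\in\mathbf W(\mathcal L)$ for which there are $P_0,\dots,P_n\in\Delta$ with $P_{i-1}\subseteq\mathbf D(f_i)$ and $P_{i-1}^{f_i}=P_i$ for all $i$. $(\mathcal L,\Delta,S)$ is a locality if $\mathcal L$ is a partial group that is finite as a set, $S$ is a $p$-subgroup of $\mathcal L$, $\Delta$ is a nonempty set of subgroups of $S$, and (L1) $S$ is maximal under inclusion among the $p$-subgroups of $\mathcal L$; (L2) $\mathbf D=\mathbf D_\Delta$; (L3) every subgroup $Q\le S$ for which there are $P\in\Delta$ and $g\in\mathcal L$ with $P\subseteq\mathbf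 D(g)$ and $P^g\le Q$ lies in $\Delta$. Then $N_{\mathcal L}(P)$ is a finite group for $P\in\Delta$. $\mathcal F_S(\mathcal L)$ is the fusion system over $S$ generated by the conjugation maps $c_g:P\to P^g$, $x\mapsto x^g$, with $P\in\Delta$, $g\in\mathcal L$, $P\subseteq\mathbf D(g)$ and $P^g\subseteq S$. A sublocality $(\mathcal L_0,\Delta_0,S_0)$ of $(\mathcal L,\Delta,S)$ consists of a partial subgroup $\mathcal L_0$ of $\mathcal L$, $S_0=S\cap\mathcal L_0$, and a set $\Delta_0$ of subgroups of $S_0$ such that $(\mathcal L_0,\Delta_0,S_0)$ is a locality (with the restricted product $\Pi|_{\mathbf W(\mathcal L_0)\cap\mathbf D}$). Linking localities. A finite group $G$ is of characteristic $p$ if $C_G(O_p(G))\le O_p(G)$. A locality $(\mathcal L,\Delta,S)$ is of objective characteristic $p$ if $N_{\mathcal L}(P)$ is of characteristic $p$ for all $P\in\Delta$. For a fusion system $\mathcal F$ over $S$, $P\le S$ is centric if $C_S(Q)\le Q$ for all $\mathcal F$-conjugates $Q$ of $P$, and radical if $O_p(\mathrm{Aut}_{\mathcal F}(P))=\mathrm{Inn}(P)$; $\mathcal F^{cr}$ is the set of centric radical subgroups. $(\mathcal L,\Delta,S)$ is a linking locality if $\mathcal F_S(\mathcal L)^{cr}\subseteq\Delta$ and it is of objective characteristic $p$. Internal central products. A partial group $\mathcal L$ is the internal central product of partial subgroups $\mathcal L_1,\mathcal L_2$ if (C1) $\mathbf D=\{(\Pi(f_1,g_1),\dots,\Pi(f_n,g_n)):(f_1,\dots,f_n)\in\mathbf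 D\cap\mathbf W(\mathcal L_1),(g_1,\dots,g_n)\in\mathbf D\cap\mathbf W(\mathcal L_2),(f_j,g_j)\in\mathbf D\text{ for }j=1,\dots,n\}$; and (C2) for all such $f_j,g_j$, $\Pi(\Pi(f_1,g_1),\dots,\Pi(f_n,g_n))=\Pi(\Pi(f_1,\dots,f_n),\Pi(g_1,\dots,g_n))$. A locality $(\mathcal L,\Delta,S)$ is the internal central product of sublocalities $(\mathcal L_1,\Delta_1,S_1)$ and $(\mathcal L_2,\Delta_2,S_2)$ if $\mathcal L$ is the internal central product of $\mathcal L_1$ and $\mathcal L_2$ as a partial group, $S=S_1S_2$, and $\Delta$ is the set of subgroups of $S$ containing a subgroup of the form $P_1P_2$ with $P_i\in\Delta_i$ for $i=1,2$. *)

theory Defs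
  imports
    "HOL-Algebra.Bij"
    "HOL-Algebra.Generated_Groups"
    "HOL-Computational_Algebra.Primes"
begin

section \<open>Partial groups\<close>

text \<open>
  The set of words \<open>W(X)\<close> is \<open>lists X\<close>, concatenation is \<open>@\<close>, and an element \<open>x\<close> is identified
  with the word \<open>[x]\<close>. The values of \<open>pinv\<close> off \<open>pcarrier\<close> and of \<open>pprod\<close> off \<open>pdom\<close> are irrelevant.
\<close>

record 'a partial_structure =
  pcarrier :: "'a set"
  pinv :: "'a \<Rightarrow> 'a"
  pdom :: "'a list set"
  pprod :: "'a list \<Rightarrow> 'a"

definition word_inv :: "'a partial_structure \<Rightarrow> 'a list \<Rightarrow> 'a list" where
  "word_inv L w = rev (map (pinv L) w)"

definition pone :: "'a partial_structure \<Rightarrow> 'a" where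
  "pone L = pprod L []"

locale partial_group =
  fixes L :: "'a partial_structure"
  assumes nonempty: "pcarrier L \<noteq> {}"
    and pinv_closed: "f \<in> pcarrier L \<Longrightarrow> pinv L f \<in> pcarrier L"
    and pinv_pinv: "f \<in> pcarrier L \<Longrightarrow> pinv L (pinv L f) = f"
    and pdom_words: "pdom L \<subseteq> lists (pcarrier L)"
    and pprod_closed: "w \<in> pdom L \<Longrightarrow> pprod L w \<in> pcarrier L"
    and pdom_singleton: "f \<in> pcarrier L \<Longrightarrow> [f] \<in> pdom L"
    and pdom_appendD: "u @ v \<in> pdom L \<Longrightarrow> u \<in> pdom L \<and> v \<in> pdom L"
    and pprod_singleton: "f \<in> pcarrier L \<Longrightarrow> pprod L [f] = f"
    and pprod_assoc: "u @ v @ w \<in> pdom L \<Longrightarrow>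
          u @ [pprod L v] @ w \<in> pdom L \<and> pprod L (u @ v @ w) = pprod L (u @ [pprod L v] @ w)"
    and pprod_word_inv: "w \<in> pdom L \<Longrightarrow>
          word_inv L w @ w \<in> pdom L \<and> pprod L (word_inv L w @ w) = pone L"

definition partial_subgroup :: "'a partial_structure \<Rightarrow> 'a set \<Rightarrow> bool" where
  "partial_subgroup L H \<longleftrightarrow>
     H \<subseteq> pcarrier L \<and>
     (\<forall>h\<in>H. pinv L h \<in> H) \<and>
     (\<forall>w\<in>lists H \<inter> pdom L. pprod L w \<in> H)"

definition prestrict :: "'a partial_structure \<Rightarrow> 'a set \<Rightarrow> 'a partial_structure" where
  "prestrict L H = L\<lparr>pcarrier := H, pdom := lists H \<inter> pdom L\<rparr>"

definition psubgroup :: "'a partial_structure \<Rightarrow> 'a set \<Rightarrow> bool" where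
  "psubgroup L H \<longleftrightarrow> partial_subgroup L H \<and> lists H \<subseteq> pdom L"

text \<open>A subgroup of a partial group, as a group in the sense of \<open>HOL-Algebra\<close>.\<close>

definition group_on :: "'a partial_structure \<Rightarrow> 'a set \<Rightarrow> 'a monoid" where
  "group_on L H = \<lparr>carrier = H, monoid.mult = (\<lambda>x y. pprod L [x, y]), one = pone L\<rparr>"

definition p_psubgroup :: "nat \<Rightarrow> 'a partial_structure \<Rightarrow> 'a set \<Rightarrow> bool" where
  "p_psubgroup p L H \<longleftrightarrow> psubgroup L H \<and> (\<exists>n. card H = p ^ n)"

definition conj_dom :: "'a partial_structure \<Rightarrow> 'a \<Rightarrow> 'a set" where
  "conj_dom L g = {x \<in> pcarrier L. [pinv L g, x, g] \<in> pdom L}"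

definition pconj :: "'a partial_structure \<Rightarrow> 'a \<Rightarrow> 'a \<Rightarrow> 'a" where
  "pconj L g x = pprod L [pinv L g, x, g]"

definition pnormalizer :: "'a partial_structure \<Rightarrow> 'a set \<Rightarrow> 'a set" where
  "pnormalizer L X = {g \<in> pcarrier L. X \<subseteq> conj_dom L g \<and> pconj L g ` X = X}"

definition set_prod :: "'a partial_structure \<Rightarrow> 'a set \<Rightarrow> 'a set \<Rightarrow> 'a set" where
  "set_prod L X Y = {pprod L [x, y] |x y. x \<in> X \<and> y \<in> Y \<and> [x, y] \<in> pdom L}"

lemma (in partial_group) group_on_psubgroup:
  assumes "psubgroup L H"
  shows "group (group_on L H)"
proof -
  have HL: "H \<subseteq> pcarrier L" and inv: "\<And>h. h \<in> H \<Longrightarrow> pinv L h \<in> H"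
    and cl: "\<And>w. w \<in> lists H \<Longrightarrow> pprod L w \<in> H" and D: "\<And>w. w \<in> lists H \<Longrightarrow> w \<in> pdom L"
    using assms unfolding psubgroup_def partial_subgroup_def by auto
  have one: "pone L \<in> H"
    unfolding pone_def by (rule cl) simp
  have left: "pprod L [pprod L [x, y], z] = pprod L [x, y, z]"
    and right: "pprod L [x, pprod L [y, z]] = pprod L [x, y, z]"
    if "x \<in> H" "y \<in> H" "z \<in> H" for x y z
    using pprod_assoc[of "[]" "[x, y]" "[z]"] pprod_assoc[of "[x]" "[y, z]" "[]"]
      D[of "[x, y, z]"] that by auto
  show ?thesis
  proof (rule groupI)
    fix x assume "x \<in> carrier (group_on L H)"
    then have x: "x \<in> H" by (simp add: group_on_def)
    have "pprod L [pone L, x] = x"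
      using pprod_assoc[of "[]" "[]" "[x]"] D[of "[x]"] x pprod_singleton[of x] HL
      by (auto simp: pone_def)
    then show "\<one>\<^bsub>group_on L H\<^esub> \<otimes>\<^bsub>group_on L H\<^esub> x = x"
      by (simp add: group_on_def)
    have "pprod L [pinv L x, x] = pone L"
      using pprod_word_inv[of "[x]"] D[of "[x]"] x by (simp add: word_inv_def)
    then show "\<exists>y\<in>carrier (group_on L H). y \<otimes>\<^bsub>group_on L H\<^esub> x = \<one>\<^bsub>group_on L H\<^esub>"
      using inv[OF x] by (auto simp: group_on_def)
  qed (use one left right cl in \<open>auto simp: group_on_def\<close>)
qed

section \<open>Finite groups of characteristic p\<close>

definition normal_p_subgroup :: "nat \<Rightarrow> ('a, 'b) monoid_scheme \<Rightarrow> 'a set \<Rightarrow> bool" where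
  "normal_p_subgroup p G N \<longleftrightarrow> N \<lhd> G \<and> (\<exists>n. card N = p ^ n)"

text \<open>\<open>O\<^sub>p(G)\<close>, the product of all normal \<open>p\<close>-subgroups, is the largest one if \<open>G\<close> is finite.\<close>

definition p_core :: "nat \<Rightarrow> ('a, 'b) monoid_scheme \<Rightarrow> 'a set" where
  "p_core p G = generate G (\<Union>{N. normal_p_subgroup p G N})"

definition centralizer :: "('a, 'b) monoid_scheme \<Rightarrow> 'a set \<Rightarrow> 'a set" where
  "centralizer G X = {g \<in> carrier G. \<forall>x\<in>X. g \<otimes>\<^bsub>G\<^esub> x = x \<otimes>\<^bsub>G\<^esub> g}"

definition characteristic_p :: "nat \<Rightarrow> ('a, 'b) monoid_scheme \<Rightarrow> bool" where
  "characteristic_p p G \<longleftrightarrow>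
     group G \<and> finite (carrier G) \<and> centralizer G (p_core p G) \<subseteq> p_core p G"

section \<open>Fusion systems\<close>

text \<open>
  A fusion system over a finite group \<open>G\<close> is given by its morphism sets \<open>F P Q\<close>, for subgroups
  \<open>P\<close>, \<open>Q\<close> of \<open>G\<close>. A morphism is a function that is \<open>undefined\<close> off its source \<open>P\<close>, so it does
  not record its target. Inclusions are morphisms by \<open>inner\<close> (conjugation by \<open>\<one>\<close>), so by \<open>comp\<close>
  restrictions of morphisms are morphisms.
\<close>

definition conj_map :: "('a, 'b) monoid_scheme \<Rightarrow> 'a set \<Rightarrow> 'a \<Rightarrow> 'a \<Rightarrow> 'a" where
  "conj_map G P g = (\<lambda>x\<in>P. inv\<^bsub>G\<^esub> g \<otimes>\<^bsub>G\<^esub> x \<otimes>\<^bsub>G\<^esub> g)"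

type_synonym 'a morphism_sets = "'a set \<Rightarrow> 'a set \<Rightarrow> ('a \<Rightarrow> 'a) set"

locale fusion_system = group G for G (structure) +
  fixes F :: "'a morphism_sets"
  assumes finite_carrier: "finite (carrier G)"
    and objects: "\<phi> \<in> F P Q \<Longrightarrow> subgroup P G \<and> subgroup Q G"
    and injective_hom: "\<phi> \<in> F P Q \<Longrightarrow>
          \<phi> \<in> hom (G\<lparr>carrier := P\<rparr>) (G\<lparr>carrier := Q\<rparr>) \<and> \<phi> \<in> extensional P \<and> inj_on \<phi> P"
    and inner: "\<lbrakk>subgroup P G; subgroup Q G; g \<in> carrier G; conj_map G P g ` P \<subseteq> Q\<rbrakk> \<Longrightarrow>
          conj_map G P g \<in> F P Q"
    and comp: "\<lbrakk>\<phi> \<in> F P Q; \<psi> \<in> F Q R\<rbrakk> \<Longrightarrow> compose P \<psi> \<phi> \<in> F P R"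
    and iso_onto_image: "\<phi> \<in> F P Q \<Longrightarrow>
          \<phi> \<in> F P (\<phi> ` P) \<and> restrict (inv_into P \<phi>) (\<phi> ` P) \<in> F (\<phi> ` P) P"

text \<open>The smallest fusion system over \<open>G\<close> with \<open>X P Q \<subseteq> F P Q\<close> for all \<open>P\<close>, \<open>Q\<close>.\<close>

definition generated_fusion_system ::
  "('a, 'b) monoid_scheme \<Rightarrow> 'a morphism_sets \<Rightarrow> 'a morphism_sets" where
  "generated_fusion_system G X P Q =
     \<Inter>{F P Q |F. fusion_system G F \<and> (\<forall>P Q. X P Q \<subseteq> F P Q)}"

definition centric :: "('a, 'b) monoid_scheme \<Rightarrow> 'a morphism_sets \<Rightarrow> 'a set \<Rightarrow> bool" where
  "centric G F P \<longleftrightarrow>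
     (\<forall>Q. (\<exists>\<phi>\<in>F P Q. \<phi> ` P = Q) \<longrightarrow> centralizer G Q \<subseteq> Q)"

definition Aut_fus :: "'a morphism_sets \<Rightarrow> 'a set \<Rightarrow> ('a \<Rightarrow> 'a) monoid" where
  "Aut_fus F P = (BijGroup P)\<lparr>carrier := F P P\<rparr>"

definition radical :: "nat \<Rightarrow> ('a, 'b) monoid_scheme \<Rightarrow> 'a morphism_sets \<Rightarrow> 'a set \<Rightarrow> bool" where
  "radical p G F P \<longleftrightarrow> p_core p (Aut_fus F P) = conj_map G P ` P"

definition centric_radicals ::
  "nat \<Rightarrow> ('a, 'b) monoid_scheme \<Rightarrow> 'a morphism_sets \<Rightarrow> 'a set set" where
  "centric_radicals p G F = {P. subgroup P G \<and> centric G F P \<and> radical p G F P}"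

section \<open>Localities\<close>

text \<open>\<open>Ps\<close> is the sequence \<open>P\<^sub>0, \<dots>, P\<^sub>n\<close>, one longer than the word.\<close>

definition delta_words :: "'a partial_structure \<Rightarrow> 'a set set \<Rightarrow> 'a list set" where
  "delta_words L \<Delta> = {w \<in> lists (pcarrier L).
     \<exists>Ps. length Ps = Suc (length w) \<and> set Ps \<subseteq> \<Delta> \<and>
       (\<forall>i<length w. Ps ! i \<subseteq> conj_dom L (w ! i) \<and> pconj L (w ! i) ` (Ps ! i) = Ps ! Suc i)}"

locale locality = partial_group L
  for p :: nat and L :: "'a partial_structure" and \<Delta> :: "'a set set" and S :: "'a set" +
  assumes finite_pcarrier: "finite (pcarrier L)"
    and S_p_psubgroup: "p_psubgroup p L S"
    and objects_nonempty: "\<Delta> \<noteq> {}"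
    and object_subgroup: "P \<in> \<Delta> \<Longrightarrow> psubgroup L P \<and> P \<subseteq> S"
    and S_maximal: "\<lbrakk>p_psubgroup p L Q; S \<subseteq> Q\<rbrakk> \<Longrightarrow> Q = S"
    and pdom_eq: "pdom L = delta_words L \<Delta>"
    and objects_closed: "\<lbrakk>psubgroup L Q; Q \<subseteq> S; P \<in> \<Delta>; g \<in> pcarrier L;
          P \<subseteq> conj_dom L g; pconj L g ` P \<subseteq> Q\<rbrakk> \<Longrightarrow> Q \<in> \<Delta>"

definition locality_fusion ::
  "'a partial_structure \<Rightarrow> 'a set set \<Rightarrow> 'a set \<Rightarrow> 'a morphism_sets" where
  "locality_fusion L \<Delta> S = generated_fusion_system (group_on L S)
     (\<lambda>P Q. {restrict (pconj L g) P |g. P \<in> \<Delta> \<and> g \<in> pcarrier L \<and> P \<subseteq> conj_dom L g \<and>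
        pconj L g ` P \<subseteq> S \<and> Q = pconj L g ` P})"

definition sublocality ::
  "nat \<Rightarrow> 'a partial_structure \<Rightarrow> 'a set \<Rightarrow> 'a set \<Rightarrow> 'a set set \<Rightarrow> 'a set \<Rightarrow> bool" where
  "sublocality p L S L\<^sub>0 \<Delta>\<^sub>0 S\<^sub>0 \<longleftrightarrow>
     partial_subgroup L L\<^sub>0 \<and> S\<^sub>0 = S \<inter> L\<^sub>0 \<and> locality p (prestrict L L\<^sub>0) \<Delta>\<^sub>0 S\<^sub>0"

definition objective_characteristic_p ::
  "nat \<Rightarrow> 'a partial_structure \<Rightarrow> 'a set set \<Rightarrow> 'a set \<Rightarrow> bool" where
  "objective_characteristic_p p L \<Delta> S \<longleftrightarrow>
     locality p L \<Delta> S \<and> (\<forall>P\<in>\<Delta>. characteristic_p p (group_on L (pnormalizer L P)))"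

definition linking_locality ::
  "nat \<Rightarrow> 'a partial_structure \<Rightarrow> 'a set set \<Rightarrow> 'a set \<Rightarrow> bool" where
  "linking_locality p L \<Delta> S \<longleftrightarrow>
     objective_characteristic_p p L \<Delta> S \<and>
     centric_radicals p (group_on L S) (locality_fusion L \<Delta> S) \<subseteq> \<Delta>"

section \<open>Internal central products\<close>

text \<open>The pairs of words \<open>((f\<^sub>1, \<dots>, f\<^sub>n), (g\<^sub>1, \<dots>, g\<^sub>n))\<close> to which both conditions below refer.\<close>

definition central_pairs ::
  "'a partial_structure \<Rightarrow> 'a set \<Rightarrow> 'a set \<Rightarrow> ('a list \<times> 'a list) set" where
  "central_pairs L L\<^sub>1 L\<^sub>2 = {(fs, gs). fs \<in> pdom L \<inter> lists L\<^sub>1 \<and> gs \<in> pdom L \<inter> lists L\<^sub>2 \<and>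
     list_all2 (\<lambda>f g. [f, g] \<in> pdom L) fs gs}"

definition pointwise_prod :: "'a partial_structure \<Rightarrow> 'a list \<Rightarrow> 'a list \<Rightarrow> 'a list" where
  "pointwise_prod L fs gs = map2 (\<lambda>f g. pprod L [f, g]) fs gs"

definition internal_central_product ::
  "'a partial_structure \<Rightarrow> 'a set \<Rightarrow> 'a set \<Rightarrow> bool" where
  "internal_central_product L L\<^sub>1 L\<^sub>2 \<longleftrightarrow>
     partial_group L \<and> partial_subgroup L L\<^sub>1 \<and> partial_subgroup L L\<^sub>2 \<and>
     pdom L = {pointwise_prod L fs gs |fs gs. (fs, gs) \<in> central_pairs L L\<^sub>1 L\<^sub>2} \<and>
     (\<forall>(fs, gs)\<in>central_pairs L L\<^sub>1 L\<^sub>2.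
        pprod L (pointwise_prod L fs gs) = pprod L [pprod L fs, pprod L gs])"

definition locality_central_product ::
  "nat \<Rightarrow> 'a partial_structure \<Rightarrow> 'a set set \<Rightarrow> 'a set \<Rightarrow>
    'a set \<Rightarrow> 'a set set \<Rightarrow> 'a set \<Rightarrow> 'a set \<Rightarrow> 'a set set \<Rightarrow> 'a set \<Rightarrow> bool" where
  "locality_central_product p L \<Delta> S L\<^sub>1 \<Delta>\<^sub>1 S\<^sub>1 L\<^sub>2 \<Delta>\<^sub>2 S\<^sub>2 \<longleftrightarrow>
     locality p L \<Delta> S \<and>
     sublocality p L S L\<^sub>1 \<Delta>\<^sub>1 S\<^sub>1 \<and> sublocality p L S L\<^sub>2 \<Delta>\<^sub>2 S\<^sub>2 \<and>
     internal_central_product L L\<^sub>1 L\<^sub>2 \<and>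
     S = set_prod L S\<^sub>1 S\<^sub>2 \<and>
     \<Delta> = {P. psubgroup L P \<and> P \<subseteq> S \<and> (\<exists>P\<^sub>1\<in>\<Delta>\<^sub>1. \<exists>P\<^sub>2\<in>\<Delta>\<^sub>2. set_prod L P\<^sub>1 P\<^sub>2 \<subseteq> P)}"

end

theory Submission
  imports Defs "HOL-Algebra.Multiplicative_Group" "HOL-Algebra.Sylow" "HOL-Algebra.Zassenhaus"
    "HOL-Algebra.SndIsomorphismGrp"
begin

text \<open>
  Write \<open>Z = L\<^sub>1 \<inter> L\<^sub>2\<close>. The factors commute elementwise, and \<open>L\<close> is the quotient of \<open>L\<^sub>1 \<times> L\<^sub>2\<close> by a
  diagonal copy of the central subgroup \<open>Z\<close>; that two factorizations of an element differ only by an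
  element of \<open>Z\<close> uses the locality structure. If \<open>L\<^sub>1\<close> is of objective characteristic \<open>p\<close>, then \<open>Z\<close>
  is a \<open>p\<close>-group and lies in \<open>S\<close>, so \<open>Z \<le> S\<close> may be assumed in all directions.

  An object \<open>P\<close> of \<open>L\<close> has projections \<open>P\<^sub>1\<close>, \<open>P\<^sub>2\<close>, which are objects of the factors, with
  \<open>P \<le> P\<^sub>1P\<^sub>2\<close> and \<open>N(P) \<le> N(P\<^sub>1P\<^sub>2) = N\<^sub>1(P\<^sub>1)N\<^sub>2(P\<^sub>2)\<close>. Characteristic \<open>p\<close> means that a \<open>p'\<close>-element which
  centralizes all normal \<open>p\<close>-subgroups is trivial. It passes between these groups because a
  commutator of such an element with a normal \<open>p\<close>-subgroup centralizes \<open>P\<^sub>1\<close> (three subgroups), hence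
  lies in a normal \<open>p\<close>-subgroup that the element centralizes (coprime action).

  The fusion system of \<open>L\<close> consists of restrictions of chains of conjugations, and these split into
  chains over the factors. A centric radical \<open>P\<close> equals \<open>P\<^sub>1P\<^sub>2\<close>, since automorphisms of \<open>P\<close> extend to
  \<open>P\<^sub>1P\<^sub>2\<close>, and then \<open>Aut(P) = Aut(P\<^sub>1) \<times> Aut(P\<^sub>2)\<close>, so \<open>P\<close> is centric radical if and only if \<open>P\<^sub>1\<close> and
  \<open>P\<^sub>2\<close> are. For the converse direction \<open>P\<^sub>1\<close> is combined with \<open>P\<^sub>2 = S\<^sub>2\<close>, which is radical because
  \<open>N\<^sub>2(S\<^sub>2)\<close> is of characteristic \<open>p\<close>.
\<close>

section \<open>Finite groups\<close>

text \<open>Condition (C1) only provides some factorization of a word of the domain into words of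
  the factors, while conjugation, projections and normalizers require that every letterwise
  factorization has both its words in the domain; this is \<open>dom_factors\<close>. The obstacle
  behind it: from \<open>f g = f' g'\<close> one wants the central element \<open>f^-1 f'\<close>,
  but the conditions on a central product do not say that this product is defined. An object of
  \<open>L1\<close> on which \<open>f\<close> and \<open>f'\<close> act alike shows that it is. A
  second obstacle is that an object \<open>Q1\<close> of \<open>L1\<close> need not contain
  \<open>Z\<close>. Projecting \<open>Q1 Q2\<close> returns \<open>Q1 Z\<close>, so the normalizer
  formula speaks of \<open>Q1 Z\<close>, and the descent of characteristic p to \<open>L1\<close>
  has to carry \<open>Q1\<close> and \<open>Q1 Z\<close> side by side. A third is that a p'-element
  \<open>x = g h\<close> need not have p'-factors: \<open>x^n = 1\<close> only puts
  \<open>g^n\<close> and \<open>h^n\<close> into \<open>Z\<close>. The powers \<open>g^(p^i)\<close>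
  and \<open>h^(p^i)\<close>, with \<open>p^i\<close> the order of \<open>Z\<close>, are
  p'-elements, and \<open>x\<close> is trivial once they are.\<close>

lemma prime_power_if_unique_prime_divisor:
  fixes n p :: nat
  assumes "prime p" "n > 0" and unique: "\<And>q. prime q \<Longrightarrow> q dvd n \<Longrightarrow> q = p"
  shows "\<exists>k. n = p ^ k"
proof -
  obtain m where n: "n = p ^ multiplicity p n * m" and m: "\<not> p dvd m"
    using multiplicity_decompose'[of n p] assms by (metis not_prime_unit less_irrefl)
  have "m = 1"
  proof (rule ccontr)
    assume "m \<noteq> 1"
    then obtain q where "prime q" "q dvd m"
      using prime_factor_nat by blast
    then show False
      using unique[of q] n m by (metis dvd_mult)
  qed
  then show ?thesis
    using n by auto
qed

section \<open>Torsion and p-subgroups of finite groups\<close>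

context group
begin

lemma mult_inv_cancel [simp]:
  assumes "x \<in> carrier G" "y \<in> carrier G"
  shows "inv x \<otimes> (x \<otimes> y) = y" "x \<otimes> (inv x \<otimes> y) = y"
  using assms by (simp_all add: m_assoc[symmetric])

lemma mult_inv_cancel' [simp]:
  assumes "x \<in> carrier G" "y \<in> carrier G"
  shows "y \<otimes> inv x \<otimes> x = y" "y \<otimes> x \<otimes> inv x = y"
  using assms by (simp_all add: m_assoc)

lemma eq_one_if_coprime_pow:
  fixes m n :: nat
  assumes "x \<in> carrier G" "x [^] m = \<one>" "x [^] n = \<one>" "coprime m n"
  shows "x = \<one>"
proof -
  have "ord x dvd m" "ord x dvd n"
    using assms by (auto simp: pow_eq_id)
  then have "ord x = 1"
    using assms(4) by (metis coprime_common_divisor_nat)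
  then show ?thesis
    using assms(1) ord_eq_1 by blast
qed

lemma pow_card_subgroup:
  assumes "subgroup K G" "finite K" "x \<in> K"
  shows "x [^] card K = \<one>"
proof -
  interpret K: group "G\<lparr>carrier := K\<rparr>"
    using assms(1) by (rule subgroup_imp_group)
  show ?thesis
    using K.pow_order_eq_1[of x] assms by (simp add: order_def flip: nat_pow_consistent)
qed

text \<open>Cauchy's theorem: if another prime \<open>q\<close> divided the order, an element of
  order \<open>q\<close> would be torsion of the excluded kind. This is how the centralizer in
  \<open>characteristic_p_iff\<close> is recognized as a p-group.\<close>

lemma card_prime_power_if_no_coprime_torsion:
  assumes "prime p" "subgroup K G" "finite K"
    and torsion: "\<And>x n. x \<in> K \<Longrightarrow> coprime n p \<Longrightarrow> x [^] n = \<one> \<Longrightarrow> x = \<one>"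
  shows "\<exists>k. card K = p ^ k"
proof (rule prime_power_if_unique_prime_divisor[OF assms(1)])
  show "card K > 0"
    using assms by (metis card_gt_0_iff subgroup.one_closed empty_iff)
next
  fix q :: nat assume q: "prime q" "q dvd card K"
  interpret K: group "G\<lparr>carrier := K\<rparr>"
    using assms(2) by (rule subgroup_imp_group)
  \<comment> \<open>\<open>sylow_thm\<close> with exponent 1 yields a subgroup of order
    \<open>q\<close>; the cofactor \<open>m\<close> may still be divisible by
    \<open>q\<close>.\<close>
  obtain m where "card K = q ^ 1 * m"
    using q(2) by auto
  then obtain H where H: "subgroup H (G\<lparr>carrier := K\<rparr>)" "card H = q"
    using sylow_thm[OF q(1) K.is_group, of 1 m] assms(3) by (auto simp: order_def)
  have "H \<subseteq> K" "\<one> \<in> H"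
    using subgroup.subset[OF H(1)] subgroup.one_closed[OF H(1)] by auto
  have "\<not> H \<subseteq> {\<one>}"
  proof
    assume "H \<subseteq> {\<one>}"
    then have "card H \<le> card {\<one>}"
      by (intro card_mono) auto
    then show False
      using H(2) prime_gt_1_nat[OF q(1)] by simp
  qed
  then obtain x where x: "x \<in> H" "x \<noteq> \<one>"
    by blast
  have "x [^] q = \<one>"
    using K.pow_card_subgroup[OF H(1) _ x(1)] H(2) \<open>H \<subseteq> K\<close> assms(3)
    by (auto simp: nat_pow_consistent[symmetric] intro: finite_subset)
  then have "\<not> coprime q p"
    using torsion[of x q] x \<open>H \<subseteq> K\<close> by auto
  then show "q = p"
    using q(1) assms(1) primes_coprime by blast
qed

text \<open>A criterion on single elements, which passes to images, preimages and products without
  any counting of cosets.\<close>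

lemma card_prime_power_iff:
  assumes "prime p" "subgroup K G" "finite K"
  shows "(\<exists>n. card K = p ^ n) \<longleftrightarrow> (\<forall>x\<in>K. \<exists>k::nat. x [^] (p ^ k) = \<one>)"
proof
  assume "\<exists>n. card K = p ^ n"
  then show "\<forall>x\<in>K. \<exists>k::nat. x [^] (p ^ k) = \<one>"
    using pow_card_subgroup[OF assms(2,3)] by metis
next
  assume pow: "\<forall>x\<in>K. \<exists>k::nat. x [^] (p ^ k) = \<one>"
  show "\<exists>n. card K = p ^ n"
  proof (rule card_prime_power_if_no_coprime_torsion[OF assms])
    fix x and n :: nat assume x: "x \<in> K" "coprime n p" "x [^] n = \<one>"
    obtain k :: nat where "x [^] (p ^ k) = \<one>"
      using pow x(1) by blast
    then show "x = \<one>"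
      using x subgroup.mem_carrier[OF assms(2)]
      by (intro eq_one_if_coprime_pow[of x n "p ^ k"]) auto
  qed
qed

lemma coprime_torsion_p_subgroup:
  assumes "subgroup K G" "card K = p ^ k" "prime p" "x \<in> K" "coprime n p" "x [^] (n::nat) = \<one>"
  shows "x = \<one>"
proof -
  have "finite K"
    using assms(2,3) card_ge_0_finite prime_gt_0_nat by (metis zero_less_power)
  then show ?thesis
    using eq_one_if_coprime_pow[of x "n" "p ^ k"] pow_card_subgroup[OF assms(1) _ assms(4)] assms
      subgroup.mem_carrier[OF assms(1)] by auto
qed

text \<open>Since \<open>N\<close> is normal, \<open>(n m)^k\<close> has the form
  \<open>n' m^k\<close>. The exponent \<open>|M|\<close> removes the second factor, and the exponent
  \<open>|N|\<close> then removes the first.\<close>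

lemma normal_mult_p_subgroup:
  assumes "prime p" "finite (carrier G)" "N \<lhd> G" "card N = p ^ i" "subgroup M G" "card M = p ^ j"
  shows "subgroup (N <#> M) G \<and> (\<exists>k. card (N <#> M) = p ^ k)"
proof -
  interpret N: normal N G by fact
  interpret M: subgroup M G by fact
  have sub: "subgroup (N <#> M) G"
    using mult_norm_subgroup[OF assms(3,5)] .
  have fin: "finite (N <#> M)"
    using assms(2) sub by (meson finite_subset subgroup.subset)
  have "\<exists>k::nat. x [^] (p ^ k) = \<one>" if x: "x \<in> N <#> M" for x
  proof -
    obtain n m where nm: "n \<in> N" "m \<in> M" "x = n \<otimes> m"
      using x unfolding set_mult_def by blast
    have "\<exists>n'\<in>N. x [^] k = n' \<otimes> m [^] k" for k :: nat
    proof (induction k)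
      case 0
      then show ?case using N.one_closed by (auto intro!: bexI[of _ \<one>])
    next
      case (Suc k)
      then obtain n' where n': "n' \<in> N" "x [^] k = n' \<otimes> m [^] k" by blast
      define h where "h = m [^] k"
      have h: "h \<in> carrier G" using nm by (simp add: h_def)
      have "x [^] Suc k = (n' \<otimes> (h \<otimes> n \<otimes> inv h)) \<otimes> (h \<otimes> m)"
        using n' nm h by (simp add: h_def[symmetric] m_assoc)
      moreover have "n' \<otimes> (h \<otimes> n \<otimes> inv h) \<in> N"
        using n' nm h N.inv_op_closed2 by auto
      ultimately show ?case by (auto simp: h_def)
    qed
    then obtain n' where n': "n' \<in> N" "x [^] (p ^ j) = n' \<otimes> m [^] (p ^ j)"
      by blast
    have "finite M" "finite N"
      using assms(2) by (auto intro: finite_subset[OF M.subset] finite_subset[OF N.subset])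
    then have "m [^] (p ^ j) = \<one>" "n' [^] (p ^ i) = \<one>"
      using pow_card_subgroup[OF assms(5) _ nm(2)] pow_card_subgroup[OF N.subgroup_axioms _ n'(1)]
        assms(4,6) by auto
    then have "x [^] (p ^ j * p ^ i) = \<one>"
      using n' nm by (simp add: nat_pow_pow[symmetric])
    then show ?thesis
      by (auto simp: power_add[symmetric])
  qed
  then show ?thesis
    using card_prime_power_iff[OF assms(1) sub fin] sub by blast
qed

lemma normal_p_subgroup_mult:
  assumes "prime p" "finite (carrier G)" "normal_p_subgroup p G N" "normal_p_subgroup p G M"
  shows "normal_p_subgroup p G (N <#> M)"
proof -
  have "N <#> M \<lhd> G"
    using assms(3,4) by (intro normal_subgroup_set_mult_closed) (auto simp: normal_p_subgroup_def)
  then show ?thesis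
    using normal_mult_p_subgroup[OF assms(1,2)] assms(3,4)
    by (meson normal_p_subgroup_def normal_imp_subgroup)
qed

lemma normal_p_subgroup_one: "normal_p_subgroup p G {\<one>}"
  using one_is_normal by (auto simp: normal_p_subgroup_def intro: exI[of _ 0])

text \<open>A normal p-subgroup \<open>M\<close> of largest order absorbs every other one
  \<open>N\<close>, because \<open>N M\<close> is again a normal p-subgroup. So the subgroup
  generated in \<open>p_core\<close> is \<open>M\<close> itself.\<close>

lemma p_core_greatest:
  assumes "prime p" "finite (carrier G)"
  shows "normal_p_subgroup p G (p_core p G) \<and> (\<forall>N. normal_p_subgroup p G N \<longrightarrow> N \<subseteq> p_core p G)"
proof -
  let ?S = "{N. normal_p_subgroup p G N}"
  have sub: "subgroup N G" if "N \<in> ?S" for N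
    using that by (simp add: normal_p_subgroup_def normal_imp_subgroup)
  have "?S \<subseteq> Pow (carrier G)"
    using sub subgroup.subset by blast
  then have "finite ?S"
    using assms(2) by (simp add: finite_subset)
  moreover have "?S \<noteq> {}"
    using normal_p_subgroup_one by blast
  ultimately have "Max (card ` ?S) \<in> card ` ?S"
    by (intro Max_in) auto
  then obtain M where M: "M \<in> ?S" "card M = Max (card ` ?S)"
    by auto
  then have max: "card N \<le> card M" if "N \<in> ?S" for N
    using \<open>finite ?S\<close> that by simp
  have le: "N \<subseteq> M" if N: "N \<in> ?S" for N
  proof -
    interpret N: subgroup N G using sub[OF N] .
    interpret M: subgroup M G using sub[OF M(1)] .
    have S: "N <#> M \<in> ?S"
      using normal_p_subgroup_mult[OF assms] N M by simp
    have "\<one> \<otimes> m \<in> N <#> M" if "m \<in> M" for m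
      using that N.one_closed unfolding set_mult_def by blast
    then have M_sub: "M \<subseteq> N <#> M" by auto
    have "n \<otimes> \<one> \<in> N <#> M" if "n \<in> N" for n
      using that M.one_closed unfolding set_mult_def by blast
    then have N_sub: "N \<subseteq> N <#> M" by auto
    have "finite (N <#> M)"
      using sub[OF S] assms(2) by (meson finite_subset subgroup.subset)
    then show ?thesis
      using max[OF S] card_seteq M_sub N_sub by blast
  qed
  have "\<Union>?S = M"
    using le M by blast
  then have "p_core p G = M"
    using generate_subgroup_incl[OF _ sub[OF M(1)]] generate.incl[of _ M G] by (auto simp: p_core_def)
  then show ?thesis
    using M le by simp
qed

text \<open>Expresses normality in \<open>K\<close> through the operations of the surrounding group
  \<open>G\<close>, so that normal p-subgroups of different subgroups of one \<open>G\<close> can be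
  intersected and compared.\<close>

lemma normal_p_subgroup_relative_iff:
  assumes "subgroup K G"
  shows "normal_p_subgroup p (G\<lparr>carrier := K\<rparr>) N \<longleftrightarrow>
    subgroup N G \<and> N \<subseteq> K \<and> (\<forall>k\<in>K. \<forall>n\<in>N. k \<otimes> n \<otimes> inv k \<in> N) \<and> (\<exists>n. card N = p ^ n)"
proof -
  interpret K: group "G\<lparr>carrier := K\<rparr>"
    using assms by (rule subgroup_imp_group)
  have sub: "subgroup N (G\<lparr>carrier := K\<rparr>) \<longleftrightarrow> subgroup N G \<and> N \<subseteq> K"
    using incl_subgroup[OF assms, of N] subgroup_incl[OF _ assms, of N]
      subgroup.subset[of N "G\<lparr>carrier := K\<rparr>"] by auto
  have inv: "inv\<^bsub>G\<lparr>carrier := K\<rparr>\<^esub> k = inv k" if "k \<in> K" for k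
    using m_inv_consistent[OF assms that] .
  show ?thesis
    unfolding normal_p_subgroup_def K.normal_inv_iff sub by (simp add: inv cong: ball_cong)
qed

lemma p_subgroup_mono:
  assumes "prime p" "subgroup M G" "subgroup N G" "M \<subseteq> N" "card N = p ^ i"
  shows "\<exists>j. card M = p ^ j"
proof -
  have fin: "finite N"
    using assms(1,5) card_ge_0_finite prime_gt_0_nat by (metis zero_less_power)
  have "\<forall>x\<in>N. \<exists>k::nat. x [^] (p ^ k) = \<one>"
    using card_prime_power_iff[OF assms(1,3) fin] assms(5) by blast
  then show ?thesis
    using card_prime_power_iff[OF assms(1,2)] fin assms(4) by (meson finite_subset subsetD)
qed

section \<open>Centralizers, characteristic p and central products of groups\<close>

lemma conj_commute:
  assumes "g \<in> carrier G" "x \<in> carrier G" "y \<in> carrier G" "x \<otimes> y = y \<otimes> x"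
  shows "g \<otimes> x \<otimes> inv g \<otimes> (g \<otimes> y \<otimes> inv g) = g \<otimes> y \<otimes> inv g \<otimes> (g \<otimes> x \<otimes> inv g)"
proof -
  have "g \<otimes> x \<otimes> inv g \<otimes> (g \<otimes> y \<otimes> inv g) = g \<otimes> (x \<otimes> y) \<otimes> inv g"
    using assms(1-3) by (simp add: m_assoc)
  also have "\<dots> = g \<otimes> y \<otimes> inv g \<otimes> (g \<otimes> x \<otimes> inv g)"
    unfolding assms(4) using assms(1-3) by (simp add: m_assoc)
  finally show ?thesis .
qed

lemma commute_inv:
  assumes "x \<in> carrier G" "y \<in> carrier G" "x \<otimes> y = y \<otimes> x"
  shows "inv x \<otimes> y = y \<otimes> inv x"
proof -
  have "inv x \<otimes> y = inv x \<otimes> (y \<otimes> x) \<otimes> inv x"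
    using assms(1,2) by (simp add: m_assoc)
  also have "\<dots> = y \<otimes> inv x"
    using assms(1,2) by (simp add: assms(3)[symmetric] m_assoc[symmetric])
  finally show ?thesis .
qed

lemma commute_mult:
  assumes "x \<in> carrier G" "y \<in> carrier G" "z \<in> carrier G" "x \<otimes> z = z \<otimes> x" "y \<otimes> z = z \<otimes> y"
  shows "x \<otimes> y \<otimes> z = z \<otimes> (x \<otimes> y)"
  using assms by (metis m_assoc)

lemma centralizerD:
  "x \<in> centralizer G A \<Longrightarrow> x \<in> carrier G" "x \<in> centralizer G A \<Longrightarrow> a \<in> A \<Longrightarrow> x \<otimes> a = a \<otimes> x"
  by (auto simp: centralizer_def)

lemma subgroup_centralizer:
  assumes "A \<subseteq> carrier G"
  shows "subgroup (centralizer G A) G"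
proof (rule subgroupI)
  show "centralizer G A \<subseteq> carrier G"
    by (auto simp: centralizer_def)
  have "\<one> \<in> centralizer G A"
    using assms by (auto simp: centralizer_def)
  then show "centralizer G A \<noteq> {}" by blast
  fix x assume x: "x \<in> centralizer G A"
  have "inv x \<otimes> a = a \<otimes> inv x" if "a \<in> A" for a
    using commute_inv[OF centralizerD(1)[OF x] _ centralizerD(2)[OF x that]] assms that by blast
  then show "inv x \<in> centralizer G A"
    unfolding centralizer_def using centralizerD(1)[OF x] by blast
  fix y assume y: "y \<in> centralizer G A"
  have "x \<otimes> y \<otimes> a = a \<otimes> (x \<otimes> y)" if "a \<in> A" for a
    using commute_mult[OF centralizerD(1)[OF x] centralizerD(1)[OF y] _
        centralizerD(2)[OF x that] centralizerD(2)[OF y that]] assms that by blast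
  then show "x \<otimes> y \<in> centralizer G A"
    unfolding centralizer_def using centralizerD(1)[OF x] centralizerD(1)[OF y] by blast
qed

text \<open>Conjugation by \<open>g\<close> takes \<open>g^-1 a g\<close> back to \<open>a\<close>;
  hence it is the inverse conjugation under which \<open>A\<close> has to be invariant.\<close>

lemma centralizer_conj:
  assumes "A \<subseteq> carrier G" "g \<in> carrier G" "\<And>a. a \<in> A \<Longrightarrow> inv g \<otimes> a \<otimes> g \<in> A" "x \<in> centralizer G A"
  shows "g \<otimes> x \<otimes> inv g \<in> centralizer G A"
proof -
  have x: "x \<in> carrier G" using assms(4) by (rule centralizerD)
  have "g \<otimes> x \<otimes> inv g \<otimes> a = a \<otimes> (g \<otimes> x \<otimes> inv g)" if a: "a \<in> A" for a
  proof -
    define b where "b = inv g \<otimes> a \<otimes> g"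
    have b: "b \<in> A" "b \<in> carrier G" using assms(1,3) a by (auto simp: b_def)
    have "g \<otimes> b \<otimes> inv g = a"
      unfolding b_def using assms(1,2) a by (simp add: m_assoc subset_iff)
    then show ?thesis
      using conj_commute[OF assms(2) x b(2) centralizerD(2)[OF assms(4) b(1)]] by simp
  qed
  moreover have "g \<otimes> x \<otimes> inv g \<in> carrier G"
    using x assms(2) by blast
  ultimately show ?thesis
    unfolding centralizer_def by blast
qed

text \<open>A p'-element that centralizes \<open>O_p(G)\<close> lies in \<open>O_p(G)\<close> by
  characteristic p, and a p-group has no nontrivial p'-elements. Conversely, the condition leaves
  the centralizer of \<open>O_p(G)\<close> without nontrivial p'-elements, so it is a normal
  p-subgroup and lies in \<open>O_p(G)\<close>.\<close>

lemma characteristic_p_iff: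
  assumes "prime p" "finite (carrier G)"
  shows "characteristic_p p G \<longleftrightarrow>
    (\<forall>x\<in>carrier G. \<forall>n::nat. coprime n p \<longrightarrow> x [^] n = \<one> \<longrightarrow>
      (\<forall>N. normal_p_subgroup p G N \<longrightarrow> (\<forall>y\<in>N. x \<otimes> y = y \<otimes> x)) \<longrightarrow> x = \<one>)"
    (is "_ \<longleftrightarrow> ?R")
proof
  note core = p_core_greatest[OF assms]
  interpret core: normal "p_core p G" G
    using core by (simp add: normal_p_subgroup_def)
  obtain i where i: "card (p_core p G) = p ^ i"
    using core by (auto simp: normal_p_subgroup_def)
  show ?R if "characteristic_p p G"
  proof (intro ballI allI impI)
    fix x and n :: nat
    assume x: "x \<in> carrier G" "coprime n p" "x [^] n = \<one>"
      and comm: "\<forall>N. normal_p_subgroup p G N \<longrightarrow> (\<forall>y\<in>N. x \<otimes> y = y \<otimes> x)"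
    have "x \<in> p_core p G"
      using that comm core x(1) unfolding characteristic_p_def centralizer_def by blast
    then show "x = \<one>"
      using coprime_torsion_p_subgroup[OF core.subgroup_axioms i assms(1)] x by blast
  qed
  show "characteristic_p p G" if ?R
  proof -
    let ?C = "centralizer G (p_core p G)"
    have sub: "subgroup ?C G"
      using core.subset by (rule subgroup_centralizer)
    have conj: "g \<otimes> x \<otimes> inv g \<in> ?C" if "g \<in> carrier G" "x \<in> ?C" for g x
      using centralizer_conj[OF core.subset that(1) _ that(2)] core.inv_op_closed1 that(1) by blast
    have "\<exists>k. card ?C = p ^ k"
    proof (rule card_prime_power_if_no_coprime_torsion[OF assms(1) sub])
      show "finite ?C" using assms(2) sub by (meson finite_subset subgroup.subset)
      show "x = \<one>" if "x \<in> ?C" "coprime n p" "x [^] n = \<one>" for x and n :: nat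
        using \<open>?R\<close> that core centralizerD by (meson subsetD)
    qed
    then have "normal_p_subgroup p G ?C"
      using sub conj unfolding normal_p_subgroup_def normal_inv_iff by blast
    then show ?thesis
      using core assms(2) by (simp add: characteristic_p_def)
  qed
qed

lemma characteristic_p_relative_iff:
  assumes "prime p" "finite (carrier G)" "subgroup K G"
  shows "characteristic_p p (G\<lparr>carrier := K\<rparr>) \<longleftrightarrow>
    (\<forall>x\<in>K. \<forall>n::nat. coprime n p \<longrightarrow> x [^] n = \<one> \<longrightarrow>
      (\<forall>N. normal_p_subgroup p (G\<lparr>carrier := K\<rparr>) N \<longrightarrow> (\<forall>y\<in>N. x \<otimes> y = y \<otimes> x)) \<longrightarrow> x = \<one>)"
proof -
  interpret K: group "G\<lparr>carrier := K\<rparr>"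
    using assms(3) by (rule subgroup_imp_group)
  have "finite K"
    using assms by (meson finite_subset subgroup.subset)
  then show ?thesis
    using K.characteristic_p_iff[OF assms(1)] by (simp flip: nat_pow_consistent)
qed

text \<open>The elementary instance of coprime action that suffices here: \<open>z\<close> is the commutator of \<open>u\<close>
  and \<open>y\<close>, and it commutes with \<open>u\<close>.\<close>

lemma pow_commutator:
  assumes "u \<in> carrier G" "y \<in> carrier G" "z \<in> carrier G" "u \<otimes> y = z \<otimes> y \<otimes> u" "u \<otimes> z = z \<otimes> u"
  shows "u [^] (k::nat) \<otimes> y = z [^] k \<otimes> y \<otimes> u [^] k"
proof (induction k)
  case 0
  then show ?case using assms by simp
next
  case (Suc k)
  have comm: "u [^] k \<otimes> z = z \<otimes> u [^] k"
    using group_commutes_pow[OF assms(5,1,3)] by simp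
  have "u [^] Suc k \<otimes> y = u [^] k \<otimes> (z \<otimes> y \<otimes> u)"
    using assms by (simp add: m_assoc)
  also have "\<dots> = z \<otimes> (u [^] k \<otimes> y) \<otimes> u"
    using assms comm by (simp add: m_assoc[symmetric])
  also have "\<dots> = z [^] Suc k \<otimes> y \<otimes> u [^] Suc k"
    using assms nat_pow_Suc2[of z k] by (simp only: Suc) (simp add: m_assoc)
  finally show ?case .
qed

text \<open>For \<open>u^n = 1\<close> the identity of \<open>pow_commutator\<close> becomes
  \<open>z^n = 1\<close>, and \<open>z\<close> lies in a p-group while \<open>n\<close> is prime to
  \<open>p\<close>.\<close>

lemma coprime_commutator_trivial:
  fixes n :: nat
  assumes "subgroup N G" "card N = p ^ i" "prime p" "coprime n p"
    and "u \<in> carrier G" "u [^] n = \<one>" "y \<in> carrier G"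
    and z: "u \<otimes> y \<otimes> inv u \<otimes> inv y \<in> N"
    and comm: "u \<otimes> (u \<otimes> y \<otimes> inv u \<otimes> inv y) = u \<otimes> y \<otimes> inv u \<otimes> inv y \<otimes> u"
  shows "u \<otimes> y = y \<otimes> u"
proof -
  define z where "z = u \<otimes> y \<otimes> inv u \<otimes> inv y"
  have zc: "z \<in> carrier G" using assms(5,7) by (simp add: z_def)
  have uy: "u \<otimes> y = z \<otimes> y \<otimes> u"
    unfolding z_def using assms(5,7) by (simp add: m_assoc)
  have "u [^] n \<otimes> y = z [^] n \<otimes> y \<otimes> u [^] n"
    using pow_commutator[OF assms(5,7) zc uy] comm[folded z_def] .
  then have "z [^] n = \<one>"
    using assms(5,6,7) zc by simp
  then have "z = \<one>"
    using coprime_torsion_p_subgroup[OF assms(1,2,3) _ assms(4)] z by (simp add: z_def)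
  then show ?thesis
    using uy assms(5,7) by simp
qed

text \<open>The three subgroups argument: a commutator of \<open>u\<close> with an element normalizing \<open>A\<close>
  centralizes \<open>A\<close>, if \<open>u\<close> does.\<close>

lemma commutator_in_centralizer:
  assumes A: "A \<subseteq> carrier G" and u: "u \<in> centralizer G A" and y: "y \<in> carrier G"
    and norm: "\<And>a. a \<in> A \<Longrightarrow> inv y \<otimes> a \<otimes> y \<in> A"
  shows "u \<otimes> y \<otimes> inv u \<otimes> inv y \<in> centralizer G A"
proof -
  interpret C: subgroup "centralizer G A" G
    using A by (rule subgroup_centralizer)
  have "y \<otimes> inv u \<otimes> inv y \<in> centralizer G A"
    by (rule centralizer_conj[OF A y norm]) (use u in auto)
  then have "u \<otimes> (y \<otimes> inv u \<otimes> inv y) \<in> centralizer G A"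
    using u by blast
  then show ?thesis
    using C.mem_carrier[OF u] y by (simp add: m_assoc)
qed

text \<open>\<open>P\<close> is a subgroup of \<open>P\<^sub>1 P\<^sub>2\<close> whose projections are \<open>P\<^sub>1\<close> and \<open>P\<^sub>2\<close>; \<open>K\<close> is to be its normalizer.\<close>

lemma coprime_torsion_central_factor:
  fixes n :: nat
  assumes p: "prime p" and fin: "finite (carrier G)"
    and G1: "subgroup G1 G" and G2: "subgroup G2 G" and K: "subgroup K G"
    and G12: "\<And>g h. g \<in> G1 \<Longrightarrow> h \<in> G2 \<Longrightarrow> g \<otimes> h = h \<otimes> g"
    and KG: "\<And>k. k \<in> K \<Longrightarrow> \<exists>g\<in>G1. \<exists>h\<in>G2. k = g \<otimes> h"
    and Z: "card (G1 \<inter> G2) = p ^ i"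
    and P1: "P1 \<subseteq> G1" and P2: "P2 \<subseteq> G2"
    and P1_normal: "\<And>g a. g \<in> G1 \<Longrightarrow> a \<in> P1 \<Longrightarrow> g \<otimes> a \<otimes> inv g \<in> P1"
    and P1_proj: "\<And>a. a \<in> P1 \<Longrightarrow> \<exists>b\<in>P2. a \<otimes> b \<in> P"
    and P: "normal_p_subgroup p (G\<lparr>carrier := K\<rparr>) P" and PP: "\<And>x. x \<in> P \<Longrightarrow> \<exists>a\<in>P1. \<exists>b\<in>P2. x = a \<otimes> b"
    and CP: "\<And>g. g \<in> G1 \<Longrightarrow> (\<And>y. y \<in> P \<Longrightarrow> g \<otimes> y = y \<otimes> g) \<Longrightarrow> g \<in> K"
    and char: "characteristic_p p (G\<lparr>carrier := G1\<rparr>)"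
    and u: "u1 \<in> G1" "u2 \<in> G2" "u1 [^] n = \<one>" "coprime n p"
    and uN: "\<And>N y. normal_p_subgroup p (G\<lparr>carrier := K\<rparr>) N \<Longrightarrow> y \<in> N \<Longrightarrow> u1 \<otimes> u2 \<otimes> y = y \<otimes> (u1 \<otimes> u2)"
  shows "u1 = \<one>"
proof -
  interpret G1: subgroup G1 G by fact
  interpret G2: subgroup G2 G by fact
  have Zs: "subgroup (G1 \<inter> G2) G"
    using G1 G2 by (rule subgroups_Inter_pair)
  have P1c: "P1 \<subseteq> carrier G" and P2c: "P2 \<subseteq> carrier G"
    using P1 P2 G1.subset G2.subset by auto
  note uc = G1.mem_carrier[OF u(1)] G2.mem_carrier[OF u(2)]
  \<comment> \<open>Every \<open>a\<close> in \<open>P1\<close> has a partner \<open>b\<close> with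
    \<open>a b\<close> in \<open>P\<close>, and \<open>u1 u2\<close> commutes with
    \<open>a b\<close>. So the commutator of \<open>u1\<close> and \<open>a\<close> equals one
    formed by \<open>b\<close> and \<open>u2\<close>; it lies in both factors, hence in a p-group,
    and commutes with \<open>u1\<close>.\<close>
  have u1P1: "u1 \<otimes> a = a \<otimes> u1" if a: "a \<in> P1" for a
  proof -
    obtain b where b: "b \<in> P2" "a \<otimes> b \<in> P" using P1_proj[OF a] by blast
    have ac: "a \<in> carrier G" "b \<in> carrier G" and aG: "a \<in> G1" "b \<in> G2" 
      using a b P1 P2 P1c P2c by auto
    have eq: "u1 \<otimes> u2 \<otimes> (a \<otimes> b) = a \<otimes> b \<otimes> (u1 \<otimes> u2)"
      using uN[OF P b(2)] .
    have "(u1 \<otimes> a) \<otimes> (u2 \<otimes> b) = u1 \<otimes> u2 \<otimes> (a \<otimes> b)"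
      using G12[OF aG(1) u(2)] ac uc by (metis m_assoc m_closed)
    also have "\<dots> = (a \<otimes> u1) \<otimes> (b \<otimes> u2)"
      unfolding eq using G12[OF u(1) aG(2)] ac uc by (metis m_assoc m_closed)
    finally have eq2: "(u1 \<otimes> a) \<otimes> (u2 \<otimes> b) = (a \<otimes> u1) \<otimes> (b \<otimes> u2)" .
    define z where "z = u1 \<otimes> a \<otimes> inv u1 \<otimes> inv a"
    have "u1 \<otimes> a = z \<otimes> (a \<otimes> u1)"
      unfolding z_def using ac uc by (simp add: m_assoc)
    have z: "z \<in> carrier G" using ac uc by (simp add: z_def)
    have "z \<otimes> (a \<otimes> u1) = (a \<otimes> u1) \<otimes> (b \<otimes> u2 \<otimes> inv (u2 \<otimes> b))"
      using eq2[unfolded \<open>u1 \<otimes> a = z \<otimes> (a \<otimes> u1)\<close>] ac uc z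
      by (metis inv_closed m_assoc m_closed mult_inv_cancel'(2))
    also have "\<dots> = (b \<otimes> u2 \<otimes> inv (u2 \<otimes> b)) \<otimes> (a \<otimes> u1)"
      using G12[of "a \<otimes> u1" "b \<otimes> u2 \<otimes> inv (u2 \<otimes> b)"] u aG by simp
    finally have "z = b \<otimes> u2 \<otimes> inv (u2 \<otimes> b)"
      using ac uc z by (simp del: inv_mult_group)
    then have zG2: "z \<in> G2" using u aG by simp
    have zG1: "z \<in> G1" using u aG by (simp add: z_def)
    show ?thesis
    proof (rule coprime_commutator_trivial[OF Zs Z p u(4) uc(1) u(3) ac(1)])
      show "u1 \<otimes> a \<otimes> inv u1 \<otimes> inv a \<in> G1 \<inter> G2"
        using zG1 zG2 by (simp add: z_def)
      show "u1 \<otimes> (u1 \<otimes> a \<otimes> inv u1 \<otimes> inv a) = u1 \<otimes> a \<otimes> inv u1 \<otimes> inv a \<otimes> u1"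
        using G12[OF u(1) zG2] by (simp add: z_def)
    qed
  qed
  have u1C: "u1 \<in> centralizer G P1"
    unfolding centralizer_def using u1P1 uc by blast
  \<comment> \<open>The second factor of an element of \<open>K\<close> acts trivially on
    \<open>G1\<close>; so \<open>K\<close> acts on subgroups of \<open>G1\<close> through the first
    factors of its elements.\<close>
  have commute_K: "h \<otimes> (g \<otimes> x \<otimes> inv g) \<otimes> inv h = g \<otimes> x \<otimes> inv g" if "g \<in> G1" "x \<in> G1" "h \<in> G2" for g x h
  proof -
    have "h \<otimes> (g \<otimes> x \<otimes> inv g) = (g \<otimes> x \<otimes> inv g) \<otimes> h"
      using G12[of "g \<otimes> x \<otimes> inv g" h] that by simp
    then show ?thesis
      using that by simp
  qed
  have conj_K: "h \<otimes> g \<otimes> x \<otimes> inv (h \<otimes> g) = g \<otimes> x \<otimes> inv g" if "g \<in> G1" "x \<in> G1" "h \<in> G2" for g x h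
    using commute_K[OF that] that by (simp add: m_assoc inv_mult_group)
  show ?thesis
  proof -
    have "u1 \<otimes> y = y \<otimes> u1" if N: "normal_p_subgroup p (G\<lparr>carrier := G1\<rparr>) N" and y: "y \<in> N" for N y
    proof -
      have N': "subgroup N G" "N \<subseteq> G1" "\<And>k n. k \<in> G1 \<Longrightarrow> n \<in> N \<Longrightarrow> k \<otimes> n \<otimes> inv k \<in> N"
        using N[unfolded normal_p_subgroup_relative_iff[OF G1]] by auto
      obtain j where j: "card N = p ^ j"
        using N[unfolded normal_p_subgroup_relative_iff[OF G1]] by auto
      interpret N: subgroup N G using N'(1) .
      \<comment> \<open>\<open>?M\<close> is chosen so as to lie in \<open>K\<close>: its elements
        commute with \<open>P1\<close>, and as elements of \<open>G1\<close> also with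
        \<open>P2\<close>, hence with \<open>P\<close>. It is then a normal p-subgroup of
        \<open>K\<close>, so \<open>u1 u2\<close> and therefore \<open>u1\<close> commutes with
        it.\<close>
      let ?M = "N \<inter> centralizer G P1"
      have Ms: "subgroup ?M G"
        using N'(1) subgroup_centralizer[OF P1c] by (rule subgroups_Inter_pair)
      obtain l where l: "card ?M = p ^ l"
        using p_subgroup_mono[OF p Ms N'(1) _ j] by auto
      have "?M \<subseteq> K"
      proof
        fix m assume m: "m \<in> ?M"
        then have mG: "m \<in> G1" using N'(2) by auto
        show "m \<in> K"
        proof (rule CP[OF mG])
          fix y assume "y \<in> P"
          then obtain a b where ab: "a \<in> P1" "b \<in> P2" "y = a \<otimes> b" using PP by blast
          have "m \<otimes> a = a \<otimes> m" "m \<otimes> b = b \<otimes> m"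
            using ab m G12[OF mG] P2 centralizerD(2)[of m P1] by blast+
          then show "m \<otimes> y = y \<otimes> m"
            using ab P1c P2c G1.mem_carrier[OF mG] by (metis m_assoc subsetD)
        qed
      qed
      moreover have "k \<otimes> m \<otimes> inv k \<in> ?M" if "k \<in> K" "m \<in> ?M" for k m
      proof -
        obtain g h where gh: "g \<in> G1" "h \<in> G2" "k = g \<otimes> h" using KG[OF \<open>k \<in> K\<close>] by blast
        then have k: "k = h \<otimes> g" using G12 by simp
        have m: "m \<in> N" "m \<in> G1" using that N'(2) by auto
        have eq: "k \<otimes> m \<otimes> inv k = g \<otimes> m \<otimes> inv g"
          unfolding k using conj_K[OF gh(1) m(2) gh(2)] .
        have "g \<otimes> m \<otimes> inv g \<in> centralizer G P1"
          using centralizer_conj[OF P1c, of g m] P1_normal[of "inv g"] gh that by simp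
        then show ?thesis
          using N'(3)[OF gh(1) m(1)] by (simp add: eq)
      qed
      ultimately have M: "normal_p_subgroup p (G\<lparr>carrier := K\<rparr>) ?M"
        using Ms l normal_p_subgroup_relative_iff[OF K] by blast
      have u1M: "u1 \<otimes> m = m \<otimes> u1" if m: "m \<in> ?M" for m
      proof -
        have mc: "m \<in> carrier G" "m \<in> G1" using m N'(2) by auto
        have "u1 \<otimes> u2 \<otimes> m = m \<otimes> (u1 \<otimes> u2)" using uN[OF M m] .
        moreover have "u1 \<otimes> u2 \<otimes> m = u1 \<otimes> m \<otimes> u2"
          using G12[OF mc(2) u(2)] mc uc by (simp add: m_assoc)
        ultimately show ?thesis using mc uc by (metis m_assoc m_closed right_cancel)
      qed
      have yc: "y \<in> carrier G" "y \<in> G1" using y N'(2) by auto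
      \<comment> \<open>The commutator lies in the normal subgroup \<open>N\<close>, and it
        centralizes \<open>P1\<close> by the three subgroups argument; so it lies in
        \<open>?M\<close>.\<close>
      define z where "z = u1 \<otimes> y \<otimes> inv u1 \<otimes> inv y"
      have zN: "z \<in> N"
        using N'(3)[OF u(1) y] y by (simp add: z_def)
      moreover have "z \<in> centralizer G P1"
        unfolding z_def
        using commutator_in_centralizer[OF P1c u1C yc(1)] P1_normal[of "inv y"] yc by simp
      ultimately have zM: "z \<in> ?M" by simp
      show ?thesis
        using coprime_commutator_trivial[OF N'(1) j p u(4) uc(1) u(3) yc(1)] zN u1M[OF zM]
        by (simp add: z_def)
    qed
    then show ?thesis
      using char[unfolded characteristic_p_relative_iff[OF p fin G1]] u by blast
  qed
qed

text \<open>The criterion for \<open>K\<close> is tested on \<open>x = g h\<close> with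
  \<open>x^n = 1\<close>. Then \<open>g^n\<close> and \<open>h^n\<close> are inverse to each other,
  hence in \<open>G1 \<inter> G2\<close>, a group of order \<open>p^i\<close>. The preceding lemma
  applies to \<open>g^(p^i)\<close> and \<open>h^(p^i)\<close>, the second time with the factors
  exchanged.\<close>

lemma characteristic_p_in_central_product:
  assumes p: "prime p" and fin: "finite (carrier G)"
    and G1: "subgroup G1 G" and G2: "subgroup G2 G" and K: "subgroup K G"
    and G12: "\<And>g h. g \<in> G1 \<Longrightarrow> h \<in> G2 \<Longrightarrow> g \<otimes> h = h \<otimes> g"
    and KG: "\<And>k. k \<in> K \<Longrightarrow> \<exists>g\<in>G1. \<exists>h\<in>G2. k = g \<otimes> h"
    and Z: "card (G1 \<inter> G2) = p ^ i"
    and P1: "P1 \<subseteq> G1" and P2: "P2 \<subseteq> G2"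
    and P1_normal: "\<And>g a. g \<in> G1 \<Longrightarrow> a \<in> P1 \<Longrightarrow> g \<otimes> a \<otimes> inv g \<in> P1"
    and P2_normal: "\<And>g a. g \<in> G2 \<Longrightarrow> a \<in> P2 \<Longrightarrow> g \<otimes> a \<otimes> inv g \<in> P2"
    and P1_proj: "\<And>a. a \<in> P1 \<Longrightarrow> \<exists>b\<in>P2. a \<otimes> b \<in> P"
    and P2_proj: "\<And>b. b \<in> P2 \<Longrightarrow> \<exists>a\<in>P1. a \<otimes> b \<in> P"
    and P: "normal_p_subgroup p (G\<lparr>carrier := K\<rparr>) P" and PP: "\<And>x. x \<in> P \<Longrightarrow> \<exists>a\<in>P1. \<exists>b\<in>P2. x = a \<otimes> b"
    and CP: "centralizer G P \<subseteq> K"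
    and char: "characteristic_p p (G\<lparr>carrier := G1\<rparr>)" "characteristic_p p (G\<lparr>carrier := G2\<rparr>)"
  shows "characteristic_p p (G\<lparr>carrier := K\<rparr>)"
  unfolding characteristic_p_relative_iff[OF p fin K]
proof (intro ballI allI impI)
  fix x and n :: nat
  assume x: "x \<in> K" "coprime n p" "x [^] n = \<one>"
    and comm: "\<forall>N. normal_p_subgroup p (G\<lparr>carrier := K\<rparr>) N \<longrightarrow> (\<forall>y\<in>N. x \<otimes> y = y \<otimes> x)"
  interpret G1: subgroup G1 G by fact
  interpret G2: subgroup G2 G by fact
  interpret K: subgroup K G by fact
  have Zs: "subgroup (G1 \<inter> G2) G"
    using G1 G2 by (rule subgroups_Inter_pair)
  have Zf: "finite (G1 \<inter> G2)"
    using fin G1.subset by (meson finite_subset inf.coboundedI1)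
  have CP': "g \<in> K" if "g \<in> carrier G" "\<And>y. y \<in> P \<Longrightarrow> g \<otimes> y = y \<otimes> g" for g
    using CP that unfolding centralizer_def by blast
  obtain g h where gh: "g \<in> G1" "h \<in> G2" "x = g \<otimes> h"
    using KG[OF x(1)] by blast
  have ghc: "g \<in> carrier G" "h \<in> carrier G" using gh by auto
  have pow: "x [^] k = g [^] k \<otimes> h [^] k" for k :: nat
    using pow_mult_distrib[OF G12[OF gh(1,2)] ghc] gh(3) by simp
  have powG: "a [^] k \<in> G1" "b [^] k \<in> G2" if "a \<in> G1" "b \<in> G2" for a b and k :: nat
    using that by (induction k) auto
  have gn: "g [^] n \<otimes> h [^] n = \<one>"
    using pow[of n] x(3) by simp
  have "g [^] n = inv (h [^] n)" "h [^] n = inv (g [^] n)"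
    using gn ghc by (metis inv_equality nat_pow_closed, metis inv_equality inv_inv nat_pow_closed)
  then have "g [^] n \<in> G1 \<inter> G2" "h [^] n \<in> G1 \<inter> G2"
    using powG[OF gh(1,2)] by (metis G2.m_inv_closed IntI, metis G1.m_inv_closed powG(1,2) gh(1,2) IntI)
  then have "(g [^] n) [^] (p ^ i) = \<one>" "(h [^] n) [^] (p ^ i) = \<one>"
    using pow_card_subgroup[OF Zs Zf] Z by auto
  then have tor: "(g [^] (p ^ i)) [^] n = \<one>" "(h [^] (p ^ i)) [^] n = \<one>"
    using ghc by (simp_all add: nat_pow_pow mult.commute)
  have uN: "g [^] (p ^ i) \<otimes> h [^] (p ^ i) \<otimes> y = y \<otimes> (g [^] (p ^ i) \<otimes> h [^] (p ^ i))"
    if N: "normal_p_subgroup p (G\<lparr>carrier := K\<rparr>) N" and y: "y \<in> N" for N y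
  proof -
    have "y \<in> carrier G"
      using N y K.subset unfolding normal_p_subgroup_relative_iff[OF K] by blast
    then show ?thesis
      using group_commutes_pow[of x y "p ^ i"] comm N y x(1) by (simp add: pow[symmetric])
  qed
  have "g [^] (p ^ i) = \<one>"
    by (rule coprime_torsion_central_factor[OF p fin G1 G2 K G12 KG Z P1 P2 P1_normal P1_proj P PP _
          char(1) powG(1)[OF gh(1,2)] powG(2)[OF gh(1,2)] tor(1) x(2) uN])
      (use CP' in auto)
  moreover have "h [^] (p ^ i) = \<one>"
  proof (rule coprime_torsion_central_factor[OF p fin G2 G1 K _ _ _ P2 P1 P2_normal _ P _ _
          char(2) powG(2)[OF gh(1,2)] powG(1)[OF gh(1,2)] tor(2) x(2)])
    show "card (G2 \<inter> G1) = p ^ i" using Z by (simp add: Int_commute)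
    show "g \<otimes> h = h \<otimes> g" if "g \<in> G2" "h \<in> G1" for g h
      using G12[OF that(2,1)] by simp
    then show "\<exists>g\<in>G2. \<exists>h\<in>G1. k = g \<otimes> h" if "k \<in> K" for k
      using KG[OF that] G12 by metis
    show "\<exists>b\<in>P1. a \<otimes> b \<in> P" if "a \<in> P2" for a
      using P2_proj[OF that] G12 P1 P2 that by (metis subsetD)
    show "\<exists>a\<in>P2. \<exists>b\<in>P1. x = a \<otimes> b" if "x \<in> P" for x
      using PP[OF that] G12 P1 P2 by (metis subsetD)
    show "h [^] (p ^ i) \<otimes> g [^] (p ^ i) \<otimes> y = y \<otimes> (h [^] (p ^ i) \<otimes> g [^] (p ^ i))"
      if "normal_p_subgroup p (G\<lparr>carrier := K\<rparr>) N" "y \<in> N" for N y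
      using uN[OF that] G12[OF powG[OF gh(1,2)]] by simp
  qed (use CP' in auto)
  ultimately have "x [^] (p ^ i) = \<one>"
    using pow[of "p ^ i"] by simp
  then show "x = \<one>"
    using eq_one_if_coprime_pow[of x n "p ^ i"] x by auto
qed

text \<open>The reverse passage, for a subgroup \<open>K\<close> of the factor \<open>A\<close>.
  \<open>P\<close> is \<open>Q\<close> enlarged by central elements. It is normalized by all of
  \<open>A\<close>, whereas \<open>Q\<close> is only known to be normalized by \<open>K\<close>;
  this is why the commutator of a test element \<open>x\<close> with a normal p-subgroup of
  \<open>G\<close> is shown to centralize \<open>P\<close> and not just \<open>Q\<close>.\<close>

lemma characteristic_p_central_factor:
  assumes p: "prime p" and fin: "finite (carrier G)" and char: "characteristic_p p G"
    and A: "subgroup A G" and B: "subgroup B G" and K: "subgroup K G" and KA: "K \<subseteq> A"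
    and AB: "\<And>g h. g \<in> A \<Longrightarrow> h \<in> B \<Longrightarrow> g \<otimes> h = h \<otimes> g"
    and G: "\<And>x. x \<in> carrier G \<Longrightarrow> \<exists>g\<in>A. \<exists>h\<in>B. x = g \<otimes> h"
    and Q: "normal_p_subgroup p (G\<lparr>carrier := K\<rparr>) Q" and CQ: "A \<inter> centralizer G Q \<subseteq> K"
    and P: "P \<subseteq> A" and PQ: "\<And>x. x \<in> P \<Longrightarrow> \<exists>a\<in>Q. \<exists>b\<in>A \<inter> B. x = a \<otimes> b" and QP: "Q \<subseteq> P"
    and P_normal: "\<And>g x. g \<in> A \<Longrightarrow> x \<in> P \<Longrightarrow> g \<otimes> x \<otimes> inv g \<in> P"
  shows "characteristic_p p (G\<lparr>carrier := K\<rparr>)"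
  unfolding characteristic_p_relative_iff[OF p fin K]
proof (intro ballI allI impI)
  fix x and n :: nat
  assume x: "x \<in> K" "coprime n p" "x [^] n = \<one>"
    and comm: "\<forall>N. normal_p_subgroup p (G\<lparr>carrier := K\<rparr>) N \<longrightarrow> (\<forall>y\<in>N. x \<otimes> y = y \<otimes> x)"
  interpret A: subgroup A G by fact
  interpret B: subgroup B G by fact
  interpret K: subgroup K G by fact
  have Pc: "P \<subseteq> carrier G" using P A.subset by blast
  have Qc: "Q \<subseteq> carrier G" using QP Pc by blast
  have QK: "k \<otimes> a \<otimes> inv k \<in> Q" if "k \<in> K" "a \<in> Q" for k a
    using Q that unfolding normal_p_subgroup_relative_iff[OF K] by blast
  have xA: "x \<in> A" and xc: "x \<in> carrier G" using x KA by auto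
  have "x \<otimes> y = y \<otimes> x" if y: "y \<in> P" for y
  proof -
    obtain a b where ab: "a \<in> Q" "b \<in> B" "b \<in> A" "y = a \<otimes> b" using PQ[OF y] by blast
    have "x \<otimes> a = a \<otimes> x" "x \<otimes> b = b \<otimes> x" using comm Q ab(1) AB[OF xA ab(2)] by blast+
    then have "a \<otimes> b \<otimes> x = x \<otimes> (a \<otimes> b)"
      using commute_mult[of a b x] ab Qc xc by (auto simp: subset_iff)
    then show ?thesis using ab(4) by simp
  qed
  then have xP: "x \<in> centralizer G P"
    unfolding centralizer_def using xc by blast
  have "x \<otimes> y = y \<otimes> x" if N: "normal_p_subgroup p G N" and y: "y \<in> N" for N y
  proof -
    interpret N: normal N G using N by (simp add: normal_p_subgroup_def)
    obtain j where j: "card N = p ^ j" using N by (auto simp: normal_p_subgroup_def)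
    obtain a b where ab: "a \<in> A" "b \<in> B" "y = a \<otimes> b" using G[of y] y by auto
    have yba: "y = b \<otimes> a" using ab AB by simp
    have abc: "a \<in> carrier G" "b \<in> carrier G" "y \<in> carrier G" using ab y by auto
    have conj: "y \<otimes> c \<otimes> inv y = a \<otimes> c \<otimes> inv a" "inv y \<otimes> c \<otimes> y = inv a \<otimes> c \<otimes> a" if c: "c \<in> A" for c
    proof -
      have cc: "c \<in> carrier G" using c by simp
      have "y \<otimes> c \<otimes> inv y = a \<otimes> (b \<otimes> c) \<otimes> inv b \<otimes> inv a"
        unfolding ab(3) using abc cc by (simp add: m_assoc inv_mult_group)
      also have "\<dots> = a \<otimes> c \<otimes> inv a"
        unfolding AB[OF c ab(2), symmetric] using abc cc by (simp add: m_assoc)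
      finally show "y \<otimes> c \<otimes> inv y = a \<otimes> c \<otimes> inv a" .
      have "inv y \<otimes> c \<otimes> y = inv a \<otimes> inv b \<otimes> (c \<otimes> b) \<otimes> a"
        unfolding yba using abc cc by (simp add: m_assoc inv_mult_group)
      also have "\<dots> = inv a \<otimes> c \<otimes> a"
        unfolding AB[OF c ab(2)] using abc cc by (simp add: m_assoc)
      finally show "inv y \<otimes> c \<otimes> y = inv a \<otimes> c \<otimes> a" .
    qed
    \<comment> \<open>The commutator of \<open>x\<close> and \<open>y\<close> will land in
      \<open>?M\<close>, which lies in \<open>K\<close> because it is contained in \<open>A\<close>
      and centralizes \<open>Q\<close>.\<close>
    let ?M = "N \<inter> A \<inter> centralizer G Q"
    have Ms: "subgroup ?M G"
      using subgroups_Inter_pair[OF subgroups_Inter_pair[OF N.subgroup_axioms A] subgroup_centralizer[OF Qc]] .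
    obtain l where l: "card ?M = p ^ l"
      using p_subgroup_mono[OF p Ms N.subgroup_axioms _ j] by auto
    have "k \<otimes> m \<otimes> inv k \<in> ?M" if k: "k \<in> K" and m: "m \<in> ?M" for k m
    proof -
      have "k \<in> A" "inv k \<in> K" "k \<in> carrier G" using k KA by auto
      then have "inv k \<otimes> a \<otimes> k \<in> Q" if "a \<in> Q" for a
        using QK[of "inv k" a] that by simp
      then have "k \<otimes> m \<otimes> inv k \<in> centralizer G Q"
        using m centralizer_conj[OF Qc \<open>k \<in> carrier G\<close>] by blast
      then show ?thesis
        using N.inv_op_closed2[OF \<open>k \<in> carrier G\<close>] m \<open>k \<in> A\<close> by auto
    qed
    then have M: "normal_p_subgroup p (G\<lparr>carrier := K\<rparr>) ?M"
      using Ms l CQ unfolding normal_p_subgroup_relative_iff[OF K] by blast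
    define z where "z = x \<otimes> y \<otimes> inv x \<otimes> inv y"
    have zN: "z \<in> N"
      using N.inv_op_closed2[OF xc y] y by (simp add: z_def)
    have "y \<otimes> inv x \<otimes> inv y \<in> A"
      using conj(1)[of "inv x"] xA ab by simp
    then have "x \<otimes> (y \<otimes> inv x \<otimes> inv y) \<in> A" using xA by simp
    then have zA: "z \<in> A" unfolding z_def using xc abc by (simp add: m_assoc)
    have "inv y \<otimes> c \<otimes> y \<in> P" if "c \<in> P" for c
      using conj(2)[of c] P_normal[of "inv a" c] that ab P abc by auto
    then have "z \<in> centralizer G P"
      unfolding z_def by (rule commutator_in_centralizer[OF Pc xP abc(3)])
    then have "z \<in> centralizer G Q"
      using QP unfolding centralizer_def by blast
    then have "x \<otimes> z = z \<otimes> x"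
      using comm M zN zA by blast
    then show ?thesis
      using coprime_commutator_trivial[OF N.subgroup_axioms j p x(2) xc x(3) abc(3)] zN
      unfolding z_def by blast
  qed
  then show "x = \<one>"
    using char[unfolded characteristic_p_iff[OF p fin]] x xc by blast
qed

end

section \<open>Fixed points of p-groups, and normalizers in p-groups\<close>

lemma (in group_action) exists_other_fixed_point:
  assumes "prime p" "card (carrier G) = p ^ n" "finite E" "p dvd card E"
    and x0: "x0 \<in> E" "\<And>g. g \<in> carrier G \<Longrightarrow> \<phi> g x0 = x0"
  shows "\<exists>x\<in>E. x \<noteq> x0 \<and> (\<forall>g\<in>carrier G. \<phi> g x = x)"
proof (rule ccontr)
  assume no: "\<not> ?thesis"
  interpret G: group G using group_hom by (rule group_hom.axioms(1))
  have self: "x \<in> orbit G \<phi> x" if "x \<in> E" for x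
    using orbit_refl[OF that] .
  have orb0: "orbit G \<phi> x0 = {x0}"
    using x0(2) G.one_closed by (auto simp: orbit_def intro!: exI[of _ "\<one>"])
  have fin: "finite (orbits G E \<phi>)"
    using assms(3) by (auto simp: orbits_def)
  have "p dvd card b" if b: "b \<in> orbits G E \<phi> - {{x0}}" for b
  proof -
    obtain x where x: "x \<in> E" "b = orbit G \<phi> x" using b by (auto simp: orbits_def)
    have "x \<noteq> x0" using b x orb0 by auto
    then obtain g where g: "g \<in> carrier G" "\<phi> g x \<noteq> x" using no x(1) by blast
    have "finite (carrier G)" by (rule card_ge_0_finite) (simp only: assms(2) zero_less_power prime_gt_0_nat[OF assms(1)])
    then have "finite ((\<lambda>g. \<phi> g x) ` carrier G)" by simp
    moreover have orb: "orbit G \<phi> x = (\<lambda>g. \<phi> g x) ` carrier G" by (auto simp: orbit_def)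
    ultimately have "finite b" using x(2) by simp
    moreover have "\<phi> g x \<in> b" using g(1) x(2) orb by simp
    then have "{x, \<phi> g x} \<subseteq> b" using self[OF x(1)] x(2) by simp
    ultimately have "card {x, \<phi> g x} \<le> card b" by (rule card_mono)
    then have "card b \<noteq> 1" using g by auto
    have "card b dvd p ^ n"
      using orbit_stabilizer_theorem[OF x(1)] x(2) assms(2) by (metis dvd_triv_left order_def)
    then obtain i where i: "card b = p ^ i" using divides_primepow_nat[OF assms(1)] by blast
    then have "i \<noteq> 0" using \<open>card b \<noteq> 1\<close> by (cases i) auto
    then show ?thesis using i by (simp add: dvd_power)
  qed
  then have "p dvd (\<Sum>b\<in>orbits G E \<phi> - {{x0}}. card b)"
    by (rule dvd_sum)
  moreover have "card E = (\<Sum>b\<in>orbits G E \<phi>. card b)"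
    using disjoint_sum[OF assms(3), of "\<lambda>_. 1 :: nat"] by simp
  moreover have "{x0} \<in> orbits G E \<phi>" using x0(1) orb0 by (auto simp: orbits_def)
  then have "(\<Sum>b\<in>orbits G E \<phi>. card b) = 1 + (\<Sum>b\<in>orbits G E \<phi> - {{x0}}. card b)"
    using fin by (simp add: sum.remove)
  ultimately have "p dvd 1"
    using assms(4) by (metis dvd_add_left_iff)
  then show False using assms(1) by simp
qed

text \<open>\<open>P\<close> acts on its right cosets in \<open>Q\<close> by right multiplication
  and fixes the coset \<open>P\<close>. The number of cosets is divisible by \<open>p\<close>, so
  counting orbits modulo \<open>p\<close> gives a second fixed coset \<open>P x\<close>, which says
  that \<open>x a x^-1\<close> lies in \<open>P\<close> for all \<open>a\<close> in
  \<open>P\<close>.\<close>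

lemma (in group) normalizer_grows:
  assumes p: "prime p" and P: "subgroup P G" and Q: "subgroup Q G" and PQ: "P \<subset> Q"
    and card: "card Q = p ^ n"
  shows "\<exists>x\<in>Q - P. \<forall>a\<in>P. x \<otimes> a \<otimes> inv x \<in> P"
proof -
  interpret P: subgroup P G by fact
  interpret Q: subgroup Q G by fact
  have Qf: "finite Q"
    using p card card_ge_0_finite prime_gt_0_nat by (metis zero_less_power)
  interpret GQ: group "G\<lparr>carrier := Q\<rparr>"
    using Q by (rule subgroup_imp_group)
  interpret GP: group "G\<lparr>carrier := P\<rparr>"
    using P by (rule subgroup_imp_group)
  have PQs: "subgroup P (G\<lparr>carrier := Q\<rparr>)"
    using P Q PQ by (intro subgroup_incl) auto
  define E where "E = (\<lambda>x. P #> x) ` Q"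
  have "rcosets\<^bsub>G\<lparr>carrier := Q\<rparr>\<^esub> P = E"
    by (auto simp: RCOSETS_def E_def r_coset_def)
  then have cE: "card E * card P = p ^ n"
    using GQ.lagrange[OF PQs] card by (simp add: order_def)
  obtain m where m: "card P = p ^ m"
    using p_subgroup_mono[OF p P Q _ card] PQ by auto
  obtain e where e: "card E = p ^ e"
    using cE divides_primepow_nat[OF p] by (metis dvd_triv_left)
  have "e \<noteq> 0"
  proof
    assume "e = 0"
    then have "card P = card Q" using cE e card by simp
    then show False using PQ Qf psubset_card_mono by (metis less_irrefl)
  qed
  then have pE: "p dvd card E" using e by (simp add: dvd_power)
  \<comment> \<open>The inverse turns right multiplication into a left action, as a homomorphism
    into \<open>BijGroup E\<close> requires.\<close>
  define \<phi> where "\<phi> g = (\<lambda>C\<in>E. C #> inv g)" for g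
  have act: "P #> x #> inv g = P #> (x \<otimes> inv g)" if "x \<in> Q" "g \<in> P" for x g
    using coset_mult_assoc[of P x "inv g"] that P.subset by simp
  have closed: "C #> inv g \<in> E" if "C \<in> E" "g \<in> P" for C g
    using that act PQ unfolding E_def by auto
  have cancel: "C #> inv g #> g = C" "C #> g #> inv g = C" if "C \<in> E" "g \<in> P" for C g
  proof -
    have "C \<subseteq> carrier G"
      using that(1) r_coset_subset_G[OF P.subset] Q.subset unfolding E_def by blast
    then show "C #> inv g #> g = C" "C #> g #> inv g = C"
      using that(2) by (auto simp: coset_mult_assoc)
  qed
  have "group_action (G\<lparr>carrier := P\<rparr>) E \<phi>"
    unfolding group_action_def group_hom_def group_hom_axioms_def
  proof (intro conjI)
    show "group (G\<lparr>carrier := P\<rparr>)" ..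
    show "group (BijGroup E)" by (rule group_BijGroup)
    show "\<phi> \<in> hom (G\<lparr>carrier := P\<rparr>) (BijGroup E)"
    proof (rule homI)
      fix g assume "g \<in> carrier (G\<lparr>carrier := P\<rparr>)"
      then have g: "g \<in> P" by simp
      have "bij_betw (\<phi> g) E E"
        by (rule bij_betw_byWitness[where f' = "\<phi> (inv g)"])
          (use g closed closed[of _ "inv g"] cancel in \<open>auto simp: \<phi>_def\<close>)
      then show "\<phi> g \<in> carrier (BijGroup E)"
        by (simp add: BijGroup_def Bij_def \<phi>_def)
      then have gB: "\<phi> g \<in> Bij E" by (simp add: BijGroup_def)
      fix h assume "h \<in> carrier (G\<lparr>carrier := P\<rparr>)"
      then have h: "h \<in> P" by simp
      have "bij_betw (\<phi> h) E E"
        by (rule bij_betw_byWitness[where f' = "\<phi> (inv h)"])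
          (use h closed closed[of _ "inv h"] cancel in \<open>auto simp: \<phi>_def\<close>)
      then have hB: "\<phi> h \<in> Bij E"
        by (simp add: Bij_def \<phi>_def)
      have "C #> inv (g \<otimes> h) = C #> inv h #> inv g" if "C \<in> E" for C
      proof -
        have "C \<subseteq> carrier G"
          using that(1) r_coset_subset_G[OF P.subset] Q.subset unfolding E_def by blast
        then show ?thesis
          using g h by (simp add: coset_mult_assoc inv_mult_group)
      qed
      then have "\<phi> (g \<otimes> h) = compose E (\<phi> g) (\<phi> h)"
        using closed[OF _ h] by (auto simp: \<phi>_def compose_def restrict_def fun_eq_iff)
      then show "\<phi> (g \<otimes>\<^bsub>G\<lparr>carrier := P\<rparr>\<^esub> h) = \<phi> g \<otimes>\<^bsub>BijGroup E\<^esub> \<phi> h"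
        using gB hB by (simp add: BijGroup_def)
    qed
  qed
  then interpret action: group_action "G\<lparr>carrier := P\<rparr>" E \<phi> .
  have "P = P #> \<one>" using coset_mult_one[OF P.subset] by simp
  then have P1: "P \<in> E" unfolding E_def using Q.one_closed by blast
  have "\<exists>C\<in>E. C \<noteq> P \<and> (\<forall>g\<in>carrier (G\<lparr>carrier := P\<rparr>). \<phi> g C = C)"
  proof (rule action.exists_other_fixed_point[OF p _ _ pE P1])
    show "card (carrier (G\<lparr>carrier := P\<rparr>)) = p ^ m" using m by simp
    show "finite E" using Qf by (simp add: E_def)
    show "\<phi> g P = P" if "g \<in> carrier (G\<lparr>carrier := P\<rparr>)" for g
      using that P1 P coset_join2[of "inv g" P] by (simp add: \<phi>_def)
  qed
  then obtain x where x: "x \<in> Q" "P #> x \<noteq> P" and fixed: "\<And>g. g \<in> P \<Longrightarrow> P #> x #> inv g = P #> x"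
    by (auto simp: E_def \<phi>_def)
  have "x \<notin> P" using x(2) coset_join2[of x P] P x(1) by auto
  moreover have "x \<otimes> a \<otimes> inv x \<in> P" if a: "a \<in> P" for a
  proof -
    have "P #> (x \<otimes> a) = P #> x"
      using fixed[of "inv a"] act[of x "inv a"] a x(1) by simp
    moreover have "x \<otimes> a \<in> P #> (x \<otimes> a)"
      using rcos_self[of "x \<otimes> a" P] P a x(1) by simp
    ultimately obtain b where b: "b \<in> P" "x \<otimes> a = b \<otimes> x" by (auto simp: r_coset_def)
    then show ?thesis using x(1) by simp
  qed
  ultimately show ?thesis using x(1) by blast
qed

text \<open>The conditions on \<open>r\<^sub>1\<close> and \<open>r\<^sub>2\<close> say that \<open>A\<close> is the direct product of \<open>B\<^sub>1\<close> and \<open>B\<^sub>2\<close>.\<close>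

locale direct_factors = A: group A + B1: group B1 + B2: group B2
  for A :: "('a, 'e) monoid_scheme" and B1 :: "('b, 'f) monoid_scheme" and B2 :: "('c, 'g) monoid_scheme" +
  fixes r1 r2
  assumes finite: "finite (carrier A)"
    and hom: "r1 \<in> hom A B1" "r2 \<in> hom A B2"
    and jointly_injective: "\<lbrakk>x \<in> carrier A; r1 x = \<one>\<^bsub>B1\<^esub>; r2 x = \<one>\<^bsub>B2\<^esub>\<rbrakk> \<Longrightarrow> x = \<one>\<^bsub>A\<^esub>"
    and lift1: "b \<in> carrier B1 \<Longrightarrow> \<exists>x\<in>carrier A. r1 x = b \<and> r2 x = \<one>\<^bsub>B2\<^esub>"
    and lift2: "c \<in> carrier B2 \<Longrightarrow> \<exists>x\<in>carrier A. r2 x = c \<and> r1 x = \<one>\<^bsub>B1\<^esub>"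
begin

sublocale r1: group_hom A B1 r1
  using hom by unfold_locales
sublocale r2: group_hom A B2 r2
  using hom by unfold_locales

text \<open>The copy of \<open>N\<close> inside the kernel of \<open>r2\<close>. A p-power of each
  of its elements is killed by \<open>r1\<close> and by \<open>r2\<close>, hence is trivial.\<close>

lemma normal_p_subgroup_lift1:
  assumes p: "prime p" and N: "normal_p_subgroup p B1 N"
  shows "normal_p_subgroup p A {x \<in> carrier A. r1 x \<in> N \<and> r2 x = \<one>\<^bsub>B2\<^esub>}" (is "normal_p_subgroup p A ?M")
proof -
  interpret N: normal N B1 using N by (simp add: normal_p_subgroup_def)
  obtain n where n: "card N = p ^ n" using N by (auto simp: normal_p_subgroup_def)
  have sub: "subgroup ?M A"
    by (rule A.subgroupI) (use A.one_closed in \<open>auto intro!: exI[of _ "\<one>\<^bsub>A\<^esub>"]\<close>)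
  have "\<exists>k::nat. x [^]\<^bsub>A\<^esub> (p ^ k) = \<one>\<^bsub>A\<^esub>" if "x \<in> ?M" for x
  proof -
    have x: "x \<in> carrier A" "r1 x \<in> N" "r2 x = \<one>\<^bsub>B2\<^esub>" using that by auto
    have "r1 x [^]\<^bsub>B1\<^esub> (p ^ n) = \<one>\<^bsub>B1\<^esub>"
      using B1.pow_card_subgroup[OF N.subgroup_axioms _ x(2)] n p
      by (metis card_ge_0_finite prime_gt_0_nat zero_less_power)
    then have "x [^]\<^bsub>A\<^esub> (p ^ n) = \<one>\<^bsub>A\<^esub>"
      using x by (intro jointly_injective) (auto simp: r1.hom_nat_pow r2.hom_nat_pow)
    then show ?thesis by blast
  qed
  then have "\<exists>k. card ?M = p ^ k"
    using A.card_prime_power_iff[OF p sub] finite by simp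
  moreover have "x \<otimes>\<^bsub>A\<^esub> m \<otimes>\<^bsub>A\<^esub> inv\<^bsub>A\<^esub> x \<in> ?M" if "x \<in> carrier A" "m \<in> ?M" for x m
    using that N.inv_op_closed2[of "r1 x" "r1 m"] by auto
  ultimately show ?thesis
    using sub unfolding normal_p_subgroup_def A.normal_inv_iff by blast
qed

text \<open>\<open>r1\<close> is onto by \<open>lift1\<close>, so it takes normal subgroups to
  normal subgroups.\<close>

lemma normal_p_subgroup_image1:
  assumes p: "prime p" and N: "normal_p_subgroup p A N"
  shows "normal_p_subgroup p B1 (r1 ` N)"
proof -
  interpret N: normal N A using N by (simp add: normal_p_subgroup_def)
  have Nf: "finite N" using N.subset finite by (rule finite_subset)
  have sub: "subgroup (r1 ` N) B1"
    using N.subgroup_axioms by (rule r1.subgroup_img_is_subgroup)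
  have pow: "\<forall>x\<in>N. \<exists>k::nat. x [^]\<^bsub>A\<^esub> (p ^ k) = \<one>\<^bsub>A\<^esub>"
    using A.card_prime_power_iff[OF p N.subgroup_axioms Nf] N by (auto simp: normal_p_subgroup_def)
  have "\<exists>k::nat. r1 x [^]\<^bsub>B1\<^esub> (p ^ k) = \<one>\<^bsub>B1\<^esub>" if x: "x \<in> N" for x
    using pow x by (metis N.mem_carrier r1.hom_nat_pow r1.hom_one)
  then have "\<exists>k. card (r1 ` N) = p ^ k"
    using B1.card_prime_power_iff[OF p sub] Nf by simp
  moreover have "b \<otimes>\<^bsub>B1\<^esub> m \<otimes>\<^bsub>B1\<^esub> inv\<^bsub>B1\<^esub> b \<in> r1 ` N" if b: "b \<in> carrier B1" and m: "m \<in> r1 ` N" for b m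
  proof -
    obtain x where x: "x \<in> carrier A" "r1 x = b" using lift1[OF b] by blast
    obtain y where y: "y \<in> N" "r1 y = m" using m by blast
    have "r1 (x \<otimes>\<^bsub>A\<^esub> y \<otimes>\<^bsub>A\<^esub> inv\<^bsub>A\<^esub> x) = b \<otimes>\<^bsub>B1\<^esub> m \<otimes>\<^bsub>B1\<^esub> inv\<^bsub>B1\<^esub> b"
      using x y by simp
    then show ?thesis
      using N.inv_op_closed2[OF x(1) y(1)] by (metis image_eqI)
  qed
  ultimately show ?thesis
    using sub unfolding normal_p_subgroup_def B1.normal_inv_iff by blast
qed

end

section \<open>Partial groups and localities\<close>

text \<open>The letters act successively, first letter first. This is kept apart from conjugation by
  \<open>pprod L w\<close>, since it also makes sense for words outside the domain, which may occur
  in fusion chains.\<close>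

fun conj_word :: "'a partial_structure \<Rightarrow> 'a list \<Rightarrow> 'a \<Rightarrow> 'a" where
  "conj_word L [] x = x"
| "conj_word L (g # w) x = conj_word L w (pconj L g x)"

text \<open>\<open>object_path L \<Delta> P w\<close>: conjugation along \<open>w\<close> is defined on \<open>P\<close> and passes through objects only,
  so that \<open>delta_words\<close> consists of the words that have an object path.\<close>

fun object_path :: "'a partial_structure \<Rightarrow> 'a set set \<Rightarrow> 'a set \<Rightarrow> 'a list \<Rightarrow> bool" where
  "object_path L \<Delta> P [] \<longleftrightarrow> P \<in> \<Delta>"
| "object_path L \<Delta> P (g # w) \<longleftrightarrow>
     P \<in> \<Delta> \<and> g \<in> pcarrier L \<and> P \<subseteq> conj_dom L g \<and> object_path L \<Delta> (pconj L g ` P) w"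

lemma conj_word_append: "conj_word L (u @ v) x = conj_word L v (conj_word L u x)"
  by (induction u arbitrary: x) auto

lemma object_path_start: "object_path L \<Delta> P w \<Longrightarrow> P \<in> \<Delta>"
  by (cases w) auto

lemma object_path_append:
  "object_path L \<Delta> P (u @ v) \<longleftrightarrow> object_path L \<Delta> P u \<and> object_path L \<Delta> (conj_word L u ` P) v"
  by (induction u arbitrary: P) (auto simp: image_image dest: object_path_start)

lemma object_path_words: "object_path L \<Delta> P w \<Longrightarrow> w \<in> lists (pcarrier L)"
  by (induction w arbitrary: P) auto

lemma delta_words_iff: "w \<in> delta_words L \<Delta> \<longleftrightarrow> (\<exists>P. object_path L \<Delta> P w)"
proof
  have path: "object_path L \<Delta> (hd Ps) w"
    if "w \<in> lists (pcarrier L)" "length Ps = Suc (length w)" "set Ps \<subseteq> \<Delta>"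
      "\<forall>i<length w. Ps ! i \<subseteq> conj_dom L (w ! i) \<and> pconj L (w ! i) ` (Ps ! i) = Ps ! Suc i" for Ps
    using that
  proof (induction w arbitrary: Ps rule: list.induct)
    case Nil
    then show ?case by (cases Ps) auto
  next
    case (Cons g w)
    then obtain P Qs where Ps: "Ps = P # Qs" "length Qs = Suc (length w)" by (cases Ps) auto
    then obtain Q Rs where Qs: "Qs = Q # Rs" by (cases Qs) auto
    have "object_path L \<Delta> (hd Qs) w"
      using Cons.prems Ps by (intro Cons.IH) (auto simp: All_less_Suc2)
    moreover have "P \<subseteq> conj_dom L g \<and> pconj L g ` P = Q"
      using Cons.prems(4) Ps Qs by (simp add: All_less_Suc2)
    ultimately show ?case
      using Cons.prems(1,3) Ps Qs by auto
  qed
  assume "w \<in> delta_words L \<Delta>"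
  then show "\<exists>P. object_path L \<Delta> P w"
    unfolding delta_words_def using path by blast
next
  have "\<exists>Ps. length Ps = Suc (length w) \<and> hd Ps = P \<and> set Ps \<subseteq> \<Delta> \<and>
       (\<forall>i<length w. Ps ! i \<subseteq> conj_dom L (w ! i) \<and> pconj L (w ! i) ` (Ps ! i) = Ps ! Suc i)"
    if "object_path L \<Delta> P w" for P
    using that
  proof (induction w arbitrary: P)
    case Nil
    then show ?case by (intro exI[of _ "[P]"]) auto
  next
    case (Cons g w)
    then obtain Ps where Ps: "length Ps = Suc (length w)" "hd Ps = pconj L g ` P" "set Ps \<subseteq> \<Delta>"
      "\<forall>i<length w. Ps ! i \<subseteq> conj_dom L (w ! i) \<and> pconj L (w ! i) ` (Ps ! i) = Ps ! Suc i"
      by fastforce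
    have "Ps ! 0 = pconj L g ` P"
      using Ps(1,2) by (cases Ps) auto
    then show ?case
      using Ps Cons.prems by (intro exI[of _ "P # Ps"]) (auto simp: nth_Cons split: nat.split)
  qed
  note path = this
  assume "\<exists>P. object_path L \<Delta> P w"
  then obtain P where P: "object_path L \<Delta> P w" ..
  obtain Ps where "length Ps = Suc (length w) \<and> set Ps \<subseteq> \<Delta> \<and>
       (\<forall>i<length w. Ps ! i \<subseteq> conj_dom L (w ! i) \<and> pconj L (w ! i) ` (Ps ! i) = Ps ! Suc i)"
    using path[OF P] by (elim exE conjE) (rule that, intro conjI, assumption+)
  then show "w \<in> delta_words L \<Delta>"
    unfolding delta_words_def using object_path_words[OF P] by (intro CollectI conjI exI[of _ Ps]) simp_all
qed

section \<open>Products, inverses and conjugation in a partial group\<close>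

context partial_group
begin

abbreviation pmult (infixl "\<cdot>" 70) where "x \<cdot> y \<equiv> pprod L [x, y]"

lemma pdom_closed: "w \<in> pdom L \<Longrightarrow> x \<in> set w \<Longrightarrow> x \<in> pcarrier L"
  using pdom_words by blast

lemma pdom_Nil: "[] \<in> pdom L"
  using nonempty pdom_singleton pdom_appendD[of "[]"] by fastforce

lemma pone_closed: "pone L \<in> pcarrier L"
  unfolding pone_def using pdom_Nil by (rule pprod_closed)

lemma pprod_Nil: "pprod L [] = pone L"
  by (simp add: pone_def)

lemma insert_one: "u @ v \<in> pdom L \<Longrightarrow> u @ [pone L] @ v \<in> pdom L \<and> pprod L (u @ [pone L] @ v) = pprod L (u @ v)"
  using pprod_assoc[of u "[]" v] by (simp add: pone_def)

lemma pprod_append: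
  assumes "u @ v \<in> pdom L"
  shows "[pprod L u, pprod L v] \<in> pdom L" "pprod L (u @ v) = pprod L u \<cdot> pprod L v"
  using pprod_assoc[of "[]" u v] pprod_assoc[of "[pprod L u]" v "[]"] assms by auto

lemma one_mult:
  assumes "f \<in> pcarrier L"
  shows "[pone L, f] \<in> pdom L" "pone L \<cdot> f = f" "[f, pone L] \<in> pdom L" "f \<cdot> pone L = f"
  using insert_one[of "[]" "[f]"] insert_one[of "[f]" "[]"] pdom_singleton[OF assms] pprod_singleton[OF assms]
  by auto

lemma word_inv_word_inv: "w \<in> lists (pcarrier L) \<Longrightarrow> word_inv L (word_inv L w) = w"
  by (induction w) (auto simp: word_inv_def pinv_pinv rev_map)

lemma word_inv_simps [simp]:
  "word_inv L [] = []" "word_inv L (g # w) = word_inv L w @ [pinv L g]"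
  "word_inv L (u @ v) = word_inv L v @ word_inv L u"
  by (auto simp: word_inv_def)

lemma word_inv_dom: "w \<in> pdom L \<Longrightarrow> word_inv L w \<in> pdom L"
  using pprod_word_inv pdom_appendD by blast

lemma pprod_word_inv_right:
  assumes "w \<in> pdom L"
  shows "w @ word_inv L w \<in> pdom L" "pprod L (w @ word_inv L w) = pone L"
  using pprod_word_inv[OF word_inv_dom[OF assms]] word_inv_word_inv[OF subsetD[OF pdom_words assms]]
  by simp_all

lemma inv_mult:
  assumes "f \<in> pcarrier L"
  shows "[pinv L f, f] \<in> pdom L" "pinv L f \<cdot> f = pone L"
    "[f, pinv L f] \<in> pdom L" "f \<cdot> pinv L f = pone L"
  using pprod_word_inv[of "[f]"] pprod_word_inv_right[of "[f]"] pdom_singleton[OF assms] by auto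

lemma pinv_pone: "pinv L (pone L) = pone L"
  using inv_mult(2)[OF pone_closed] one_mult(4)[of "pinv L (pone L)"] pinv_closed[OF pone_closed] by simp

text \<open>Axiom (4) for the word \<open>(x, y)\<close> puts \<open>(y^-1, x^-1, x, y)\<close> into
  the domain; dropping the first letter leaves a word that can be multiplied in two ways.\<close>

lemma cancel_left:
  assumes "[x, y] \<in> pdom L"
  shows "[pinv L x, x, y] \<in> pdom L" "[pinv L x, x \<cdot> y] \<in> pdom L" "pinv L x \<cdot> (x \<cdot> y) = y"
proof -
  have xy: "x \<in> pcarrier L" "y \<in> pcarrier L" using assms pdom_closed by auto
  have "[pinv L y] @ [pinv L x, x, y] \<in> pdom L" using pprod_word_inv[OF assms] by simp
  then show D: "[pinv L x, x, y] \<in> pdom L" by (rule pdom_appendD[THEN conjunct2])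
  show "[pinv L x, x \<cdot> y] \<in> pdom L" "pinv L x \<cdot> (x \<cdot> y) = y"
    using pprod_assoc[of "[pinv L x]" "[x, y]" "[]"] pprod_assoc[of "[]" "[pinv L x, x]" "[y]"] D
      inv_mult(2)[OF xy(1)] one_mult(2)[OF xy(2)] by auto
qed

lemma pinv_unique:
  assumes "[x, y] \<in> pdom L" "x \<cdot> y = pone L"
  shows "y = pinv L x"
  using cancel_left(3)[OF assms(1)] assms pinv_closed pdom_closed one_mult(4) by force

lemma pinv_pprod:
  assumes "w \<in> pdom L"
  shows "pinv L (pprod L w) = pprod L (word_inv L w)"
  using pinv_unique[of "pprod L w" "pprod L (word_inv L w)"] pprod_word_inv_right[OF assms]
    pprod_append[of w "word_inv L w"] by simp

lemma pinv_pmult: "[x, y] \<in> pdom L \<Longrightarrow> pinv L (x \<cdot> y) = pinv L y \<cdot> pinv L x"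
  using pinv_pprod[of "[x, y]"] by simp

lemma conj_domD:
  assumes "x \<in> conj_dom L g"
  shows "x \<in> pcarrier L" "[pinv L g, x, g] \<in> pdom L" "pconj L g x \<in> pcarrier L"
  using assms pprod_closed by (auto simp: conj_dom_def pconj_def)

lemma conj_one:
  assumes "x \<in> pcarrier L"
  shows "x \<in> conj_dom L (pone L)" "pconj L (pone L) x = x"
  using insert_one[of "[]" "[x, pone L]"] one_mult[OF assms] assms
  by (auto simp: conj_dom_def pconj_def pinv_pone)

text \<open>The domain memberships come from cutting subwords out of longer words:
  \<open>w^-1 w\<close> for \<open>w = (g^-1, x, g)\<close> ends in \<open>(g, g^-1, x, g)\<close>,
  and this word followed by its inverse begins with \<open>(g, g^-1, x, g, g^-1)\<close>.\<close>

lemma conj_inv: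
  assumes g: "g \<in> pcarrier L" and x: "x \<in> conj_dom L g"
  shows "[g, pinv L g, x, g] \<in> pdom L" "g \<cdot> pconj L g x = x \<cdot> g" "[x, g] \<in> pdom L"
    "pconj L g x \<in> conj_dom L (pinv L g)" "pconj L (pinv L g) (pconj L g x) = x"
proof -
  note D = conj_domD[OF x]
  have gg: "pinv L (pinv L g) = g" using g by (rule pinv_pinv)
  have "[pinv L g, pinv L x] @ [g, pinv L g, x, g] \<in> pdom L"
    using pprod_word_inv[OF D(2)] by (simp add: gg)
  then show D1: "[g, pinv L g, x, g] \<in> pdom L"
    by (rule pdom_appendD[THEN conjunct2])
  have "[g, pinv L g, x, g, pinv L g] @ [pinv L x, g, pinv L g] \<in> pdom L"
    using pprod_word_inv_right(1)[OF D1] by (simp add: gg)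
  then have D2: "[g, pinv L g, x, g, pinv L g] \<in> pdom L"
    by (rule pdom_appendD[THEN conjunct1])
  show D3: "[x, g] \<in> pdom L" using D(2) pdom_appendD[of "[pinv L g]"] by simp
  then have xg: "x \<cdot> g \<in> pcarrier L" by (rule pprod_closed)
  have "pprod L [g, pinv L g, x, g] = g \<cdot> pconj L g x"
    using pprod_assoc[of "[g]" "[pinv L g, x, g]" "[]"] D1 by (simp add: pconj_def)
  moreover have "pprod L [g, pinv L g, x, g] = x \<cdot> g"
    using pprod_append[of "[g, pinv L g]" "[x, g]"] D1 inv_mult(4)[OF g] one_mult(2)[OF xg] by simp
  ultimately show "g \<cdot> pconj L g x = x \<cdot> g" by simp
  have E: "[g, pconj L g x, pinv L g] \<in> pdom L"
    "pprod L [g, pconj L g x, pinv L g] = pprod L [g, pinv L g, x, g, pinv L g]"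
    using pprod_assoc[of "[g]" "[pinv L g, x, g]" "[pinv L g]"] D2 by (simp_all add: pconj_def)
  then show "pconj L g x \<in> conj_dom L (pinv L g)"
    using D(3) by (simp add: conj_dom_def gg)
  have F: "[pone L, x, g, pinv L g] \<in> pdom L"
    "pprod L [g, pinv L g, x, g, pinv L g] = pprod L [pone L, x, g, pinv L g]"
    using pprod_assoc[of "[]" "[g, pinv L g]" "[x, g, pinv L g]"] D2 inv_mult(4)[OF g] by simp_all
  have "pprod L [pone L, x, g, pinv L g] = pone L \<cdot> x \<cdot> pone L"
    using pprod_append[of "[pone L, x]" "[g, pinv L g]"] F(1) inv_mult(4)[OF g] by simp
  also have "\<dots> = x" using one_mult[OF D(1)] by simp
  finally show "pconj L (pinv L g) (pconj L g x) = x"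
    using E(2) F(2) by (simp add: pconj_def gg)
qed

lemma conj_inj:
  assumes "g \<in> pcarrier L" "x \<in> conj_dom L g" "y \<in> conj_dom L g" "pconj L g x = pconj L g y"
  shows "x = y"
  using conj_inv(5)[OF assms(1,2)] conj_inv(5)[OF assms(1,3)] assms(4) by metis

lemma conj_image_inv:
  assumes "g \<in> pcarrier L" "P \<subseteq> conj_dom L g"
  shows "pconj L g ` P \<subseteq> conj_dom L (pinv L g)" "pconj L (pinv L g) ` pconj L g ` P = P"
  using conj_inv(4,5)[OF assms(1)] assms(2) by (auto simp: image_image subset_iff)

lemma conj_pinv:
  assumes "g \<in> pcarrier L" "x \<in> conj_dom L g"
  shows "pinv L x \<in> conj_dom L g" "pconj L g (pinv L x) = pinv L (pconj L g x)"
  using word_inv_dom[OF conj_domD(2)[OF assms(2)]] pinv_pprod[OF conj_domD(2)[OF assms(2)]]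
    pinv_closed[OF conj_domD(1)[OF assms(2)]] pinv_pinv[OF assms(1)]
  by (auto simp: conj_dom_def pconj_def)

text \<open>The middle pair \<open>g, g^-1\<close> of the six-letter word is contracted. In a
  partial group its membership in the domain has to be assumed; localities provide it in
  \<open>object_conj_dom2\<close>.\<close>

lemma conj_mult:
  assumes g: "g \<in> pcarrier L" and D: "[pinv L g, x, g, pinv L g, y, g] \<in> pdom L"
  shows "[pconj L g x, pconj L g y] \<in> pdom L" "x \<cdot> y \<in> conj_dom L g" "[x, y] \<in> pdom L"
    "pconj L g (x \<cdot> y) = pconj L g x \<cdot> pconj L g y"
proof -
  show "[pconj L g x, pconj L g y] \<in> pdom L"
    using pprod_append(1)[of "[pinv L g, x, g]" "[pinv L g, y, g]"] D by (simp add: pconj_def)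
  have 1: "[pinv L g, x, pone L, y, g] \<in> pdom L"
     "pprod L [pinv L g, x, pone L, y, g] = pprod L [pinv L g, x, g, pinv L g, y, g]"
    using pprod_assoc[of "[pinv L g, x]" "[g, pinv L g]" "[y, g]"] D inv_mult(4)[OF g] by simp_all
  have x: "x \<in> pcarrier L" using pdom_closed[OF D] by simp
  have 2: "[pinv L g, x, y, g] \<in> pdom L"
     "pprod L [pinv L g, x, pone L, y, g] = pprod L [pinv L g, x, y, g]"
    using pprod_assoc[of "[pinv L g]" "[x, pone L]" "[y, g]"] 1 one_mult(4)[OF x] by simp_all
  show xy: "[x, y] \<in> pdom L"
    using pdom_appendD[of "[pinv L g]" "[x, y, g]"] pdom_appendD[of "[x, y]" "[g]"] 2(1) by simp
  have 3: "[pinv L g, x \<cdot> y, g] \<in> pdom L"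
     "pprod L [pinv L g, x, y, g] = pprod L [pinv L g, x \<cdot> y, g]"
    using pprod_assoc[of "[pinv L g]" "[x, y]" "[g]"] 2(1) by simp_all
  then show "x \<cdot> y \<in> conj_dom L g"
    using pprod_closed[OF xy] by (simp add: conj_dom_def)
  show "pconj L g (x \<cdot> y) = pconj L g x \<cdot> pconj L g y"
    using 1 2 3 pprod_append(2)[of "[pinv L g, x, g]" "[pinv L g, y, g]"] D by (simp add: pconj_def)
qed

lemma pprod_conj_word:
  "word_inv L w @ [x] @ w \<in> pdom L \<Longrightarrow> pprod L (word_inv L w @ [x] @ w) = conj_word L w x"
proof (induction w arbitrary: x)
  case Nil
  then show ?case using pdom_closed pprod_singleton by auto
next
  case (Cons g w)
  then show ?case
    using pprod_assoc[of "word_inv L w" "[pinv L g, x, g]" w] Cons.IH[of "pconj L g x"]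
    by (simp add: pconj_def)
qed

text \<open>The word \<open>w^-1 x w\<close> is evaluated once by contracting the blocks
  \<open>w^-1\<close> and \<open>w\<close>, and once from the inside, letter by letter.\<close>

lemma conj_pprod:
  assumes "word_inv L w @ [x] @ w \<in> pdom L"
  shows "x \<in> conj_dom L (pprod L w)" "pconj L (pprod L w) x = conj_word L w x"
proof -
  have w: "w \<in> pdom L" "x \<in> pcarrier L"
    using assms pdom_appendD[of "word_inv L w @ [x]" w] pdom_closed by auto
  have D: "pinv L (pprod L w) # x # w \<in> pdom L"
    "pprod L (word_inv L w @ [x] @ w) = pprod L (pinv L (pprod L w) # x # w)"
    using pprod_assoc[of "[]" "word_inv L w" "x # w"] assms pinv_pprod[OF w(1)] by simp_all
  moreover have "[pinv L (pprod L w), x, pprod L w] \<in> pdom L"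
    "pprod L (pinv L (pprod L w) # x # w) = pprod L [pinv L (pprod L w), x, pprod L w]"
    using pprod_assoc[of "[pinv L (pprod L w), x]" w "[]"] D(1) by simp_all
  ultimately show "x \<in> conj_dom L (pprod L w)" "pconj L (pprod L w) x = conj_word L w x"
    using w pprod_conj_word[OF assms] by (simp_all add: conj_dom_def pconj_def)
qed

lemma psubgroupD:
  assumes "psubgroup L H"
  shows "H \<subseteq> pcarrier L" "h \<in> H \<Longrightarrow> pinv L h \<in> H" "w \<in> lists H \<Longrightarrow> w \<in> pdom L"
    "w \<in> lists H \<Longrightarrow> pprod L w \<in> H" "pone L \<in> H"
  using assms unfolding psubgroup_def partial_subgroup_def pone_def by auto

lemma psubgroup_mult: "psubgroup L H \<Longrightarrow> x \<in> H \<Longrightarrow> y \<in> H \<Longrightarrow> x \<cdot> y \<in> H"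
  using psubgroupD(4)[of H "[x, y]"] by simp

lemma psubgroup_conj:
  assumes "psubgroup L H" "g \<in> H" "x \<in> H"
  shows "x \<in> conj_dom L g" "pconj L g x \<in> H"
  using assms psubgroupD[OF assms(1)] unfolding conj_dom_def pconj_def by auto

lemma psubgroup_conj_image:
  assumes "psubgroup L H" "g \<in> H"
  shows "pconj L g ` H = H"
proof
  show "pconj L g ` H \<subseteq> H"
    using psubgroup_conj[OF assms] by blast
  have g: "g \<in> pcarrier L" "pinv L g \<in> H" "pinv L (pinv L g) = g"
    using psubgroupD[OF assms(1)] assms(2) pinv_pinv by auto
  have "x = pconj L g (pconj L (pinv L g) x)" if "x \<in> H" for x
    using conj_inv(5)[of "pinv L g" x] psubgroup_conj[OF assms(1) g(2) that] g pinv_closed by simp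
  then show "H \<subseteq> pconj L g ` H"
    using psubgroup_conj(2)[OF assms(1) g(2)] by blast
qed

lemma psubgroup_subset:
  assumes "psubgroup L K" "H \<subseteq> K" "pone L \<in> H" "\<And>x. x \<in> H \<Longrightarrow> pinv L x \<in> H"
    and mult: "\<And>x y. x \<in> H \<Longrightarrow> y \<in> H \<Longrightarrow> x \<cdot> y \<in> H"
  shows "psubgroup L H"
proof -
  have D: "lists H \<subseteq> pdom L"
    using psubgroupD(3)[OF assms(1)] assms(2) by (meson lists_mono subset_iff)
  have "pprod L w \<in> H" if "w \<in> lists H" for w
    using that
  proof (induction w rule: list.induct)
    case Nil
    then show ?case using assms(3) by (simp add: pprod_Nil)
  next
    case (Cons x w)
    then have "x # w \<in> lists H" "x \<in> pcarrier L"
      using psubgroupD(1)[OF assms(1)] assms(2) by auto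
    then have "x # w \<in> pdom L" "x \<in> pcarrier L"
      using D by blast+
    then have "pprod L (x # w) = x \<cdot> pprod L w"
      using pprod_append(2)[of "[x]" w] by (simp add: pprod_singleton)
    then show ?case using Cons mult by simp
  qed
  then show ?thesis
    using assms D psubgroupD(1)[OF assms(1)] unfolding psubgroup_def partial_subgroup_def by blast
qed

lemma inv_group_on:
  assumes "psubgroup L H" "x \<in> H"
  shows "inv\<^bsub>group_on L H\<^esub> x = pinv L x"
proof -
  interpret group "group_on L H" using assms(1) by (rule group_on_psubgroup)
  show ?thesis
    by (rule inv_equality)
      (use assms psubgroupD[OF assms(1)] inv_mult(2) in \<open>auto simp: group_on_def\<close>)
qed

lemma group_on_simps [simp]:
  "carrier (group_on L H) = H" "x \<otimes>\<^bsub>group_on L H\<^esub> y = x \<cdot> y" "\<one>\<^bsub>group_on L H\<^esub> = pone L"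
  "(group_on L H)\<lparr>carrier := K\<rparr> = group_on L K"
  by (auto simp: group_on_def)

lemma subgroup_group_on_iff:
  assumes "psubgroup L H"
  shows "subgroup K (group_on L H) \<longleftrightarrow> psubgroup L K \<and> K \<subseteq> H"
proof
  interpret group "group_on L H" using assms by (rule group_on_psubgroup)
  show "psubgroup L K \<and> K \<subseteq> H" if "subgroup K (group_on L H)"
  proof -
    interpret K: subgroup K "group_on L H" by fact
    have "K \<subseteq> H" using K.subset by simp
    then show ?thesis
      using psubgroup_subset[OF assms, of K] K.one_closed K.m_closed K.m_inv_closed
      by (auto simp: inv_group_on[OF assms] subset_iff)
  qed
  show "subgroup K (group_on L H)" if K: "psubgroup L K \<and> K \<subseteq> H"
    by (rule subgroupI)
      (use K psubgroupD[of K] psubgroup_mult[of K] inv_group_on[OF assms] in \<open>auto simp: subset_iff\<close>)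
qed

lemma pconj_group_on:
  assumes "psubgroup L H" "g \<in> H" "x \<in> H"
  shows "pconj L g x = inv\<^bsub>group_on L H\<^esub> g \<otimes>\<^bsub>group_on L H\<^esub> x \<otimes>\<^bsub>group_on L H\<^esub> g"
  using pprod_append(2)[of "[pinv L g, x]" "[g]"] psubgroupD[OF assms(1)] assms pprod_singleton
  by (auto simp: pconj_def inv_group_on)

lemma psubgroup_conj_mult:
  assumes "psubgroup L H" "g \<in> H" "h \<in> H" "x \<in> H"
  shows "pconj L (g \<cdot> h) x = pconj L h (pconj L g x)"
proof -
  interpret group "group_on L H" using assms(1) by (rule group_on_psubgroup)
  have gh: "g \<cdot> h \<in> H" using psubgroup_mult assms by blast
  have "inv\<^bsub>group_on L H\<^esub> (g \<cdot> h) = inv\<^bsub>group_on L H\<^esub> h \<cdot> inv\<^bsub>group_on L H\<^esub> g"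
    using inv_mult_group[of g h] assms by simp
  then show ?thesis
    using m_assoc inv_closed m_closed assms psubgroup_conj(2)[OF assms(1)] gh
    by (simp add: pconj_group_on[OF assms(1)])
qed

end

section \<open>Conjugation of objects in a locality\<close>

context locality
begin

lemma prime_power_S: "\<exists>n. card S = p ^ n" and psubgroup_S: "psubgroup L S"
  using S_p_psubgroup by (auto simp: p_psubgroup_def)

lemma objectD: "P \<in> \<Delta> \<Longrightarrow> psubgroup L P" "P \<in> \<Delta> \<Longrightarrow> P \<subseteq> S" "P \<in> \<Delta> \<Longrightarrow> P \<subseteq> pcarrier L"
  using object_subgroup psubgroupD(1) by blast+

lemma pdom_iff: "w \<in> pdom L \<longleftrightarrow> (\<exists>P. object_path L \<Delta> P w)"
  by (simp add: pdom_eq delta_words_iff)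

lemma S_subset: "S \<subseteq> pcarrier L"
  using psubgroup_S by (rule psubgroupD)

lemma finite_S: "finite S"
  using S_subset finite_pcarrier by (rule finite_subset)

lemma object_overgroup:
  assumes "psubgroup L Q" "Q \<subseteq> S" "P \<in> \<Delta>" "P \<subseteq> Q"
  shows "Q \<in> \<Delta>"
proof -
  have "x \<in> conj_dom L (pone L)" "pconj L (pone L) x = x" if "x \<in> P" for x
    using conj_one objectD(3)[OF assms(3)] that by auto
  then show ?thesis
    using objects_closed[OF assms(1,2,3) pone_closed] assms(4) by auto
qed

lemma S_object: "S \<in> \<Delta>"
  using objects_nonempty object_overgroup[OF psubgroup_S] objectD(2) by blast

lemma object_self_conj:
  assumes "P \<in> \<Delta>" "x \<in> P"
  shows "P \<subseteq> conj_dom L x" "pconj L x ` P = P"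
  using psubgroup_conj(1)[OF objectD(1)[OF assms(1)] assms(2)]
    psubgroup_conj_image[OF objectD(1)[OF assms(1)] assms(2)] by auto

lemma conj_psubgroup:
  assumes g: "g \<in> pcarrier L" and P: "psubgroup L P" and PS: "pconj L g ` P \<subseteq> S"
    and D: "\<And>x y. x \<in> P \<Longrightarrow> y \<in> P \<Longrightarrow> [pinv L g, x, g, pinv L g, y, g] \<in> pdom L"
  shows "psubgroup L (pconj L g ` P)"
proof (rule psubgroup_subset[OF psubgroup_S PS])
  have dom: "x \<in> conj_dom L g" if "x \<in> P" for x
    using pdom_appendD[of "[pinv L g, x, g]"] D[OF that that] psubgroupD(1)[OF P] that
    by (auto simp: conj_dom_def)
  have "pconj L g (pone L) = pone L"
    using insert_one[of "[pinv L g]" "[g]"] inv_mult[OF g] by (simp add: pconj_def)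
  then show "pone L \<in> pconj L g ` P"
    using psubgroupD(5)[OF P] by (metis image_eqI)
  show "pinv L y \<in> pconj L g ` P" if "y \<in> pconj L g ` P" for y
    using that conj_pinv(2)[OF g dom] psubgroupD(2)[OF P] by (metis (no_types, lifting) image_iff)
  show "x \<cdot> y \<in> pconj L g ` P" if "x \<in> pconj L g ` P" "y \<in> pconj L g ` P" for x y
    using that conj_mult(4)[OF g D] psubgroup_mult[OF P] by (auto simp flip: conj_mult(4)[OF g D])
qed

lemma object_conj_S:
  assumes P: "P \<in> \<Delta>" and s: "s \<in> S"
  shows "P \<subseteq> conj_dom L s" "pconj L s ` P \<in> \<Delta>"
proof -
  show dom: "P \<subseteq> conj_dom L s"
    using psubgroup_conj(1)[OF psubgroup_S s] objectD(2)[OF P] by blast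
  have PS: "pconj L s ` P \<subseteq> S"
    using psubgroup_conj(2)[OF psubgroup_S s] objectD(2)[OF P] by blast
  have "psubgroup L (pconj L s ` P)"
    using s objectD[OF P] S_subset psubgroupD(2,3)[OF psubgroup_S]
    by (intro conj_psubgroup PS) (auto simp: subset_iff)
  then show "pconj L s ` P \<in> \<Delta>"
    using objects_closed[OF _ PS P _ dom] s S_subset by blast
qed

lemma object_path_reverse:
  assumes "object_path L \<Delta> P w"
  shows "object_path L \<Delta> (conj_word L w ` P) (word_inv L w)"
    and "x \<in> P \<Longrightarrow> conj_word L (word_inv L w) (conj_word L w x) = x"
proof -
  have "object_path L \<Delta> (conj_word L w ` P) (word_inv L w) \<and>
      (\<forall>x\<in>P. conj_word L (word_inv L w) (conj_word L w x) = x)"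
    using assms
  proof (induction w arbitrary: P)
    case Nil
    then show ?case by simp
  next
    case (Cons g w)
    let ?Q = "pconj L g ` P"
    have g: "g \<in> pcarrier L" "P \<subseteq> conj_dom L g" "P \<in> \<Delta>" "?Q \<in> \<Delta>"
      using Cons.prems object_path_start by auto
    have IH: "object_path L \<Delta> (conj_word L w ` ?Q) (word_inv L w)"
      "conj_word L (word_inv L w) (conj_word L w y) = y" if "y \<in> ?Q" for y
      using Cons.IH[of ?Q] Cons.prems that by auto
    have "conj_word L (word_inv L w) ` conj_word L w ` ?Q = ?Q"
      using IH(2) by (auto simp: image_image)
    moreover have "object_path L \<Delta> ?Q [pinv L g]"
      using conj_image_inv[OF g(1,2)] g pinv_closed by simp
    ultimately show ?case
      using IH Cons.IH[of ?Q] Cons.prems conj_inv(5)[OF g(1)] g(2)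
      by (auto simp: object_path_append image_image conj_word_append)
  qed
  then show "object_path L \<Delta> (conj_word L w ` P) (word_inv L w)"
    "x \<in> P \<Longrightarrow> conj_word L (word_inv L w) (conj_word L w x) = x" by auto
qed

text \<open>An element \<open>x\<close> of \<open>P\<close> conjugates \<open>P\<close> to itself,
  so the path can be run backwards, then through \<open>x\<close>, then forwards again. Hence
  \<open>w^-1 x w\<close> lies in the domain and \<open>conj_pprod\<close> applies.\<close>

lemma object_path_pprod:
  assumes "object_path L \<Delta> P w"
  shows "P \<subseteq> conj_dom L (pprod L w)" "x \<in> P \<Longrightarrow> pconj L (pprod L w) x = conj_word L w x"
proof -
  note P = object_path_start[OF assms]
  have "word_inv L w @ [x] @ w \<in> pdom L" if x: "x \<in> P" for x
  proof -
    have restore: "conj_word L (word_inv L w) ` conj_word L w ` P = P"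
      using object_path_reverse(2)[OF assms] by (auto simp: image_image)
    have "object_path L \<Delta> (conj_word L w ` P) (word_inv L w @ [x] @ w)"
      unfolding object_path_append restore
      using object_path_reverse(1)[OF assms] assms object_self_conj[OF P x] P x objectD(3)[OF P] by auto
    then show ?thesis using pdom_iff by blast
  qed
  then show "P \<subseteq> conj_dom L (pprod L w)" "x \<in> P \<Longrightarrow> pconj L (pprod L w) x = conj_word L w x"
    using conj_pprod by blast+
qed

text \<open>The word \<open>(a\<^sup>-\<^sup>1, g, a\<^sup>g)\<close> has an object path through \<open>P\<close>, and its product is \<open>g\<close>.\<close>

lemma object_conj_transfer:
  assumes g: "g \<in> pcarrier L" and a: "a \<in> S" "a \<in> conj_dom L g" "pconj L g a \<in> S"
    and P: "P \<in> \<Delta>" "P \<subseteq> conj_dom L g" "pconj L g ` P \<in> \<Delta>"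
  shows "pconj L a ` P \<subseteq> conj_dom L g"
    "x \<in> P \<Longrightarrow> pconj L g (pconj L a x) = pconj L (pconj L g a) (pconj L g x)"
    "pconj L g ` pconj L a ` P \<in> \<Delta>"
proof -
  define b where "b = pconj L g a"
  have aC: "a \<in> pcarrier L" using a(1) S_subset by blast
  have bC: "b \<in> pcarrier L" using a(3) S_subset by (auto simp: b_def)
  note aP = object_conj_S[OF P(1) a(1)]
  have path: "object_path L \<Delta> (pconj L a ` P) [pinv L a, g, b]"
    using conj_image_inv[OF aC aP(1)] aP P g pinv_closed[OF aC] bC object_conj_S[OF P(3) a(3)]
    by (simp add: b_def)
  then have D: "[pinv L a, g, b] \<in> pdom L" using pdom_iff by blast
  note inv = conj_inv[OF g a(2)]
  have "pprod L [pinv L a, g, b] = pinv L a \<cdot> (g \<cdot> b)"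
    using pprod_assoc[of "[pinv L a]" "[g, b]" "[]"] D by simp
  also have "\<dots> = pinv L a \<cdot> (a \<cdot> g)" using inv(2) by (simp add: b_def)
  also have "\<dots> = g" by (rule cancel_left(3)[OF inv(3)])
  finally have w: "pprod L [pinv L a, g, b] = g" .
  show "pconj L a ` P \<subseteq> conj_dom L g"
    using object_path_pprod(1)[OF path] by (simp add: w)
  show conj: "pconj L g (pconj L a x) = pconj L (pconj L g a) (pconj L g x)" if "x \<in> P" for x
    using object_path_pprod(2)[OF path, of "pconj L a x"] that conj_inv(5)[OF aC] aP(1)
    by (auto simp: w[unfolded b_def] b_def)
  have "pconj L g ` pconj L a ` P = pconj L b ` pconj L g ` P"
    using conj by (auto simp: image_image b_def)
  then show "pconj L g ` pconj L a ` P \<in> \<Delta>"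
    using object_conj_S(2)[OF P(3) a(3)] by (simp add: b_def)
qed

text \<open>The elements \<open>x\<close> and \<open>y\<close> need not lie in an object on which
  \<open>g\<close> acts. By \<open>object_conj_transfer\<close> an object \<open>P\<close> on which
  \<open>g\<close> acts may be moved by \<open>x\<close>, and then by \<open>y\<close>, without
  leaving the region where conjugation by \<open>g\<close> is defined; this gives the object path.
  It makes conjugation by \<open>g\<close> multiplicative on the elements of \<open>S\<close> that
  \<open>g\<close> takes into \<open>S\<close>.\<close>

lemma object_conj_dom2:
  assumes g: "g \<in> pcarrier L"
    and x: "x \<in> S" "x \<in> conj_dom L g" "pconj L g x \<in> S"
    and y: "y \<in> S" "y \<in> conj_dom L g" "pconj L g y \<in> S"
  shows "[pinv L g, x, g, pinv L g, y, g] \<in> pdom L"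
proof -
  have "[g] \<in> pdom L" using g by (rule pdom_singleton)
  then obtain P where P: "P \<in> \<Delta>" "P \<subseteq> conj_dom L g" "pconj L g ` P \<in> \<Delta>"
    unfolding pdom_iff by auto
  note Px = object_conj_S[OF P(1) x(1)] and Pgx = object_conj_transfer[OF g x P]
  note Pxy = object_conj_S[OF Px(2) y(1)] and Pgxy = object_conj_transfer[OF g y Px(2) Pgx(1,3)]
  have "object_path L \<Delta> (pconj L g ` P) [pinv L g, x, g, pinv L g, y, g]"
    using P g pinv_closed[OF g] x(1) y(1) S_subset Px Pxy Pgx(1,3) Pgxy(1,3)
      conj_image_inv[OF g P(2)] conj_image_inv[OF g Pgx(1)] by auto
  then show ?thesis using pdom_iff by blast
qed

text \<open>Condition (L3) concerns subgroups of \<open>S\<close> only; that the image of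
  \<open>P\<close> is one follows from the multiplicativity that \<open>object_conj_dom2\<close>
  supplies.\<close>

lemma object_conj:
  assumes g: "g \<in> pcarrier L" and P: "P \<in> \<Delta>" "P \<subseteq> conj_dom L g" "pconj L g ` P \<subseteq> S"
  shows "pconj L g ` P \<in> \<Delta>"
    "\<lbrakk>x \<in> P; y \<in> P\<rbrakk> \<Longrightarrow> pconj L g (x \<cdot> y) = pconj L g x \<cdot> pconj L g y"
proof -
  have D: "[pinv L g, x, g, pinv L g, y, g] \<in> pdom L" if "x \<in> P" "y \<in> P" for x y
    using that P objectD(2)[OF P(1)] by (intro object_conj_dom2[OF g]) auto
  show "pconj L g ` P \<in> \<Delta>"
    using objects_closed[OF conj_psubgroup[OF g objectD(1)[OF P(1)] P(3) D] P(3,1) g P(2)] by simp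
  show "pconj L g (x \<cdot> y) = pconj L g x \<cdot> pconj L g y" if "x \<in> P" "y \<in> P"
    using conj_mult(4)[OF g D[OF that]] .
qed

lemma normalizer_path:
  assumes "P \<in> \<Delta>" "w \<in> lists (pnormalizer L P)"
  shows "object_path L \<Delta> P w" "conj_word L w ` P = P"
proof -
  have "object_path L \<Delta> P w \<and> conj_word L w ` P = P"
    using assms(2)
  proof (induction w rule: list.induct)
    case (Cons g w)
    then have "g \<in> pcarrier L" "P \<subseteq> conj_dom L g" "pconj L g ` P = P"
      by (auto simp: pnormalizer_def)
    moreover have "conj_word L (g # w) ` P = conj_word L w ` pconj L g ` P"
      by (simp add: image_image)
    ultimately show ?case
      using Cons assms(1) by (auto simp: in_lists_conv_set)
  qed (use assms(1) in simp)
  then show "object_path L \<Delta> P w" "conj_word L w ` P = P" by auto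
qed

text \<open>For words over the normalizer the constant sequence \<open>P, ..., P\<close> is an
  object path.\<close>

lemma psubgroup_normalizer:
  assumes P: "P \<in> \<Delta>"
  shows "psubgroup L (pnormalizer L P)"
proof -
  have "w \<in> pdom L" "pprod L w \<in> pnormalizer L P" if w: "w \<in> lists (pnormalizer L P)" for w
  proof -
    note path = normalizer_path[OF P w]
    show D: "w \<in> pdom L" using path(1) pdom_iff by blast
    have "pconj L (pprod L w) ` P = P"
      using object_path_pprod(2)[OF path(1)] path(2) by simp
    then show "pprod L w \<in> pnormalizer L P"
      using object_path_pprod(1)[OF path(1)] pprod_closed[OF D] by (simp add: pnormalizer_def)
  qed
  moreover have "pinv L g \<in> pnormalizer L P" if "g \<in> pnormalizer L P" for g
    using that conj_image_inv[of g P] pinv_closed by (auto simp: pnormalizer_def)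
  moreover have "pnormalizer L P \<subseteq> pcarrier L" by (auto simp: pnormalizer_def)
  ultimately show ?thesis
    unfolding psubgroup_def partial_subgroup_def by blast
qed

lemma object_normalizes_self: "P \<in> \<Delta> \<Longrightarrow> P \<subseteq> pnormalizer L P"
  using object_self_conj[of P] objectD(3)[of P] unfolding pnormalizer_def by blast

end

section \<open>Central products\<close>

lemma prestrict_simps [simp]:
  "pcarrier (prestrict L H) = H" "pinv (prestrict L H) = pinv L"
  "pdom (prestrict L H) = lists H \<inter> pdom L" "pprod (prestrict L H) = pprod L"
  "pone (prestrict L H) = pone L" "word_inv (prestrict L H) = word_inv L"
  "pconj (prestrict L H) = pconj L" "group_on (prestrict L H) X = group_on L X"
  by (auto simp: prestrict_def pone_def word_inv_def pconj_def group_on_def fun_eq_iff)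

lemma conj_word_prestrict [simp]: "conj_word (prestrict L H) = conj_word L"
proof (intro ext)
  show "conj_word (prestrict L H) w x = conj_word L w x" for w x
    by (induction w arbitrary: x) auto
qed

lemma conj_dom_prestrict:
  assumes "partial_subgroup L H" "g \<in> H"
  shows "conj_dom (prestrict L H) g = H \<inter> conj_dom L g"
  using assms by (auto simp: conj_dom_def partial_subgroup_def)

lemma psubgroup_prestrict:
  assumes "partial_subgroup L H"
  shows "psubgroup (prestrict L H) X \<longleftrightarrow> X \<subseteq> H \<and> psubgroup L X"
proof -
  have "lists X \<inter> (lists H \<inter> pdom L) = lists X \<inter> pdom L" if "X \<subseteq> H"
    using that lists_mono[of X H] by blast
  then show ?thesis
    using assms lists_mono[of X H] unfolding psubgroup_def partial_subgroup_def by auto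
qed

lemma pnormalizer_prestrict:
  assumes "partial_subgroup L H" "X \<subseteq> H"
  shows "pnormalizer (prestrict L H) X = H \<inter> pnormalizer L X"
  using assms conj_dom_prestrict[OF assms(1)] by (auto simp: pnormalizer_def partial_subgroup_def)

text \<open>Collects the \<open>A\<close>-parts of all factorizations of elements of
  \<open>P\<close>, not of chosen ones; so the projection of a subgroup contains the intersection of
  the two factors. Both factors are arguments, so that the second projection is the same notion with
  \<open>L1\<close> and \<open>L2\<close> exchanged.\<close>

definition cproj :: "'a partial_structure \<Rightarrow> 'a set \<Rightarrow> 'a set \<Rightarrow> 'a set \<Rightarrow> 'a set" where
  "cproj L A B P = {f \<in> A. \<exists>g\<in>B. pprod L [f, g] \<in> P}"

locale locality_product = locality p L \<Delta> S
  for p :: nat and L :: "'a partial_structure" and \<Delta> :: "'a set set" and S :: "'a set" +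
  fixes L1 :: "'a set" and \<Delta>1 :: "'a set set" and S1 :: "'a set"
    and L2 :: "'a set" and \<Delta>2 :: "'a set set" and S2 :: "'a set"
  assumes prime: "prime p"
    and product: "locality_central_product p L \<Delta> S L1 \<Delta>1 S1 L2 \<Delta>2 S2"
begin

abbreviation smult (infixl "\<star>" 70) where "P \<star> Q \<equiv> set_prod L P Q"

lemmas product_unfolded = product[unfolded locality_central_product_def sublocality_def]

lemma sub1: "partial_subgroup L L1" "S1 = S \<inter> L1" "locality p (prestrict L L1) \<Delta>1 S1"
  by (rule product_unfolded[THEN conjunct2, THEN conjunct1, THEN conjunct1],
      rule product_unfolded[THEN conjunct2, THEN conjunct1, THEN conjunct2, THEN conjunct1],
      rule product_unfolded[THEN conjunct2, THEN conjunct1, THEN conjunct2, THEN conjunct2])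

lemma sub2: "partial_subgroup L L2" "S2 = S \<inter> L2" "locality p (prestrict L L2) \<Delta>2 S2"
  by (rule product_unfolded[THEN conjunct2, THEN conjunct2, THEN conjunct1, THEN conjunct1],
      rule product_unfolded[THEN conjunct2, THEN conjunct2, THEN conjunct1, THEN conjunct2, THEN conjunct1],
      rule product_unfolded[THEN conjunct2, THEN conjunct2, THEN conjunct1, THEN conjunct2, THEN conjunct2])

lemma internal: "internal_central_product L L1 L2"
  and S_eq: "S = S1 \<star> S2"
  and \<Delta>_eq: "\<Delta> = {P. psubgroup L P \<and> P \<subseteq> S \<and> (\<exists>P1\<in>\<Delta>1. \<exists>P2\<in>\<Delta>2. P1 \<star> P2 \<subseteq> P)}"
  by (rule product_unfolded[THEN conjunct2, THEN conjunct2, THEN conjunct2, THEN conjunct1],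
      rule product_unfolded[THEN conjunct2, THEN conjunct2, THEN conjunct2, THEN conjunct2, THEN conjunct1],
      rule product_unfolded[THEN conjunct2, THEN conjunct2, THEN conjunct2, THEN conjunct2, THEN conjunct2])

interpretation F1: locality p "prestrict L L1" \<Delta>1 S1 by (rule sub1)
interpretation F2: locality p "prestrict L L2" \<Delta>2 S2 by (rule sub2)

lemma L1D: "L1 \<subseteq> pcarrier L" "f \<in> L1 \<Longrightarrow> pinv L f \<in> L1" "w \<in> lists L1 \<Longrightarrow> w \<in> pdom L \<Longrightarrow> pprod L w \<in> L1"
  and L2D: "L2 \<subseteq> pcarrier L" "f \<in> L2 \<Longrightarrow> pinv L f \<in> L2" "w \<in> lists L2 \<Longrightarrow> w \<in> pdom L \<Longrightarrow> pprod L w \<in> L2"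
  using sub1(1) sub2(1) by (auto simp: partial_subgroup_def)

lemma one_L1: "pone L \<in> L1" and one_L2: "pone L \<in> L2"
  using L1D(3)[of "[]"] L2D(3)[of "[]"] pdom_Nil by (auto simp: pone_def)

text \<open>Padding with \<open>pone L\<close>: (C1) for the words \<open>(f, 1)\<close> and
  \<open>(1, g)\<close> gives the domain membership of \<open>(f, g)\<close>. The words
  \<open>(1, f)\<close> and \<open>(g, 1)\<close> give that of \<open>(g, f)\<close>, and (C2) for
  them is the commutation.\<close>

lemma mult_dom:
  assumes "f \<in> L1" "g \<in> L2"
  shows "[f, g] \<in> pdom L" "[g, f] \<in> pdom L" "f \<cdot> g = g \<cdot> f"
proof -
  note fc = subsetD[OF L1D(1) assms(1)] and gc = subsetD[OF L2D(1) assms(2)]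
  note one = one_mult[OF fc] one_mult[OF gc]
  have D: "pdom L = {pointwise_prod L fs gs |fs gs. (fs, gs) \<in> central_pairs L L1 L2}"
    and Pi: "\<And>fs gs. (fs, gs) \<in> central_pairs L L1 L2 \<Longrightarrow>
        pprod L (pointwise_prod L fs gs) = pprod L fs \<cdot> pprod L gs"
    using internal unfolding internal_central_product_def by auto
  have p1: "([f, pone L], [pone L, g]) \<in> central_pairs L L1 L2"
    and p2: "([pone L, f], [g, pone L]) \<in> central_pairs L L1 L2"
    using assms one_L1 one_L2 one by (auto simp: central_pairs_def)
  show "[f, g] \<in> pdom L"
    using p1 unfolding D by (force simp: pointwise_prod_def one)
  show "[g, f] \<in> pdom L"
    using p2 unfolding D by (force simp: pointwise_prod_def one)
  show "f \<cdot> g = g \<cdot> f"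
    using Pi[OF p2] by (simp add: pointwise_prod_def one)
qed

lemma central_pairs_eq:
  "(fs, gs) \<in> central_pairs L L1 L2 \<longleftrightarrow>
    fs \<in> pdom L \<and> fs \<in> lists L1 \<and> gs \<in> pdom L \<and> gs \<in> lists L2 \<and> length fs = length gs"
  unfolding central_pairs_def list_all2_conv_all_nth using mult_dom(1) by (auto simp: in_lists_conv_set)

lemma product_word:
  assumes "fs \<in> pdom L" "fs \<in> lists L1" "gs \<in> pdom L" "gs \<in> lists L2" "length fs = length gs"
  shows "map2 (\<cdot>) fs gs \<in> pdom L" "pprod L (map2 (\<cdot>) fs gs) = pprod L fs \<cdot> pprod L gs"
proof -
  have "(fs, gs) \<in> central_pairs L L1 L2"
    using assms by (simp add: central_pairs_eq)
  then show "map2 (\<cdot>) fs gs \<in> pdom L"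
    "pprod L (map2 (\<cdot>) fs gs) = pprod L fs \<cdot> pprod L gs"
    using internal unfolding internal_central_product_def pointwise_prod_def by blast+
qed

lemma word_decomposition:
  assumes "w \<in> pdom L"
  obtains fs gs where "fs \<in> pdom L" "fs \<in> lists L1" "gs \<in> pdom L" "gs \<in> lists L2"
    "length fs = length gs" "w = map2 (\<cdot>) fs gs"
proof -
  have "w \<in> {pointwise_prod L fs gs |fs gs. (fs, gs) \<in> central_pairs L L1 L2}"
    using assms internal unfolding internal_central_product_def by blast
  then show ?thesis
    using that unfolding pointwise_prod_def by (auto simp: central_pairs_eq)
qed

lemma decomposition:
  assumes "x \<in> pcarrier L"
  obtains f g where "f \<in> L1" "g \<in> L2" "x = f \<cdot> g"
proof -
  obtain fs gs where "fs \<in> lists L1" "gs \<in> lists L2" "length fs = length gs" "[x] = map2 (\<cdot>) fs gs"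
    using word_decomposition[OF pdom_singleton[OF assms]] by metis
  then show ?thesis
    using that by (cases fs; cases gs) auto
qed

lemma set_prod_iff:
  assumes "P \<subseteq> L1" "Q \<subseteq> L2"
  shows "z \<in> P \<star> Q \<longleftrightarrow> (\<exists>x\<in>P. \<exists>y\<in>Q. z = x \<cdot> y)"
proof -
  have "[x, y] \<in> pdom L" if "x \<in> P" "y \<in> Q" for x y
    using mult_dom(1) assms that by blast
  then show ?thesis unfolding set_prod_def by blast
qed

lemma set_prod_commute:
  assumes "P \<subseteq> L1" "Q \<subseteq> L2"
  shows "P \<star> Q = Q \<star> P"
proof -
  have "[y, x] \<in> pdom L" "x \<cdot> y = y \<cdot> x" if "x \<in> P" "y \<in> Q" for x y
    using mult_dom assms that by blast+
  then have "z \<in> Q \<star> P \<longleftrightarrow> (\<exists>x\<in>P. \<exists>y\<in>Q. z = x \<cdot> y)" for z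
    unfolding set_prod_def by (auto; metis)
  then show ?thesis using set_prod_iff[OF assms] by blast
qed

lemma S12_subset: "S1 \<subseteq> L1" "S2 \<subseteq> L2" "S1 \<subseteq> S" "S2 \<subseteq> S"
  using sub1(2) sub2(2) by auto

lemma object1D:
  assumes "P \<in> \<Delta>1"
  shows "psubgroup L P" "P \<subseteq> S1" "P \<subseteq> L1"
  using F1.objectD(1,2)[OF assms] psubgroup_prestrict[OF sub1(1), of P] by simp_all

lemma object2D:
  assumes "P \<in> \<Delta>2"
  shows "psubgroup L P" "P \<subseteq> S2" "P \<subseteq> L2"
  using F2.objectD(1,2)[OF assms] psubgroup_prestrict[OF sub2(1), of P] by simp_all

text \<open>The setting is symmetric in the two factors because these commute; each statement about
  \<open>L1\<close> thereby has its counterpart for \<open>L2\<close>.\<close>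

lemma swap: "locality_product p L \<Delta> S L2 \<Delta>2 S2 L1 \<Delta>1 S1"
proof
  have zip_swap: "map2 (\<cdot>) gs fs = map2 (\<cdot>) fs gs" if "fs \<in> lists L1" "gs \<in> lists L2" for fs gs
    using that
  proof (induction fs arbitrary: gs rule: list.induct)
    case (Cons f fs)
    then show ?case by (cases gs) (auto simp: mult_dom(3))
  qed simp
  have pairs: "(gs, fs) \<in> central_pairs L L2 L1 \<longleftrightarrow> (fs, gs) \<in> central_pairs L L1 L2" for fs gs
    unfolding central_pairs_eq unfolding central_pairs_def list_all2_conv_all_nth
    using mult_dom(2) by (auto simp: in_lists_conv_set)
  have lists: "fs \<in> lists L1" "gs \<in> lists L2" if "(fs, gs) \<in> central_pairs L L1 L2" for fs gs
    using that by (auto simp: central_pairs_def)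
  have "internal_central_product L L2 L1"
    unfolding internal_central_product_def
  proof (intro conjI)
    show "pdom L = {pointwise_prod L fs gs |fs gs. (fs, gs) \<in> central_pairs L L2 L1}"
    proof -
      have "{pointwise_prod L fs gs |fs gs. (fs, gs) \<in> central_pairs L L2 L1} =
          {pointwise_prod L fs gs |fs gs. (fs, gs) \<in> central_pairs L L1 L2}"
        unfolding pairs pointwise_prod_def using zip_swap lists by (metis (mono_tags, lifting))
      then show ?thesis
        using internal unfolding internal_central_product_def by simp
    qed
    show "\<forall>(fs, gs)\<in>central_pairs L L2 L1. pprod L (pointwise_prod L fs gs) = pprod L fs \<cdot> pprod L gs"
    proof safe
      fix gs fs assume "(gs, fs) \<in> central_pairs L L2 L1"
      then have *: "(fs, gs) \<in> central_pairs L L1 L2" by (simp add: pairs)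
      then have "fs \<in> pdom L" "fs \<in> lists L1" "gs \<in> pdom L" "gs \<in> lists L2" "length fs = length gs"
        by (auto simp: central_pairs_eq)
      then show "pprod L (pointwise_prod L gs fs) = pprod L gs \<cdot> pprod L fs"
        using product_word(2) zip_swap mult_dom(3)[OF L1D(3) L2D(3)] unfolding pointwise_prod_def by simp
    qed
  qed (use sub1 sub2 partial_group_axioms in auto)
  moreover have "S = S2 \<star> S1"
    using S_eq set_prod_commute[OF S12_subset(1,2)] by simp
  moreover have "\<Delta> = {P. psubgroup L P \<and> P \<subseteq> S \<and> (\<exists>P2\<in>\<Delta>2. \<exists>P1\<in>\<Delta>1. P2 \<star> P1 \<subseteq> P)}"
  proof -
    have "P2 \<star> P1 = P1 \<star> P2" if "P1 \<in> \<Delta>1" "P2 \<in> \<Delta>2" for P1 P2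
      by (rule set_prod_commute[OF object1D(3)[OF that(1)] object2D(3)[OF that(2)], symmetric])
    then show ?thesis
      unfolding \<Delta>_eq by (auto; metis)
  qed
  ultimately show "locality_central_product p L \<Delta> S L2 \<Delta>2 S2 L1 \<Delta>1 S1"
    unfolding locality_central_product_def sublocality_def
    by (intro conjI sub1 sub2 locality_axioms)
qed (rule prime)

end

context partial_group
begin

lemma one_in_conj_dom:
  assumes "g \<in> pcarrier L"
  shows "pone L \<in> conj_dom L g" "pconj L g (pone L) = pone L"
  using insert_one[of "[pinv L g]" "[g]"] inv_mult[OF assms] pone_closed
  by (auto simp: conj_dom_def pconj_def)

end

section \<open>Products of subgroups, and the uniqueness of factorizations\<close>

context locality_product
begin

interpretation F1: locality p "prestrict L L1" \<Delta>1 S1 by (rule sub1)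
interpretation F2: locality p "prestrict L L2" \<Delta>2 S2 by (rule sub2)

lemma pinv_factors:
  assumes "f \<in> L1" "g \<in> L2"
  shows "pinv L (f \<cdot> g) = pinv L f \<cdot> pinv L g"
  using pinv_pmult[OF mult_dom(1)[OF assms]] mult_dom(3)[OF L1D(2)[OF assms(1)] L2D(2)[OF assms(2)]]
  by (rule trans[OF _ sym])

lemma set_prod_subset_S:
  assumes "P \<subseteq> S1" "Q \<subseteq> S2"
  shows "P \<star> Q \<subseteq> S"
  using assms psubgroup_mult[OF psubgroup_S] S12_subset unfolding set_prod_def by blast

lemma set_prod_words:
  assumes "P \<subseteq> L1" "Q \<subseteq> L2" "w \<in> lists (P \<star> Q)"
  shows "\<exists>fs gs. fs \<in> lists P \<and> gs \<in> lists Q \<and> length fs = length gs \<and> w = map2 (\<cdot>) fs gs"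
  using assms(3)
proof (induction w rule: list.induct)
  case Nil
  show ?case by (intro exI[of _ "[]"]) simp
next
  case (Cons x w)
  then obtain fs gs where fg: "fs \<in> lists P" "gs \<in> lists Q" "length fs = length gs" "w = map2 (\<cdot>) fs gs"
    by auto
  obtain f g where "f \<in> P" "g \<in> Q" "x = f \<cdot> g"
    using Cons.prems set_prod_iff[OF assms(1,2)] by auto
  then show ?case
    using fg by (intro exI[of _ "f # fs"] exI[of _ "g # gs"]) simp
qed

lemma psubgroup_set_prod:
  assumes P: "psubgroup L P" "P \<subseteq> L1" and Q: "psubgroup L Q" "Q \<subseteq> L2"
  shows "psubgroup L (P \<star> Q)"
proof -
  note iff = set_prod_iff[OF P(2) Q(2)]
  have "w \<in> pdom L \<and> pprod L w \<in> P \<star> Q" if w: "w \<in> lists (P \<star> Q)" for w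
  proof -
    obtain fs gs where fg: "fs \<in> lists P" "gs \<in> lists Q" "length fs = length gs" "w = map2 (\<cdot>) fs gs"
      using set_prod_words[OF P(2) Q(2) w] by blast
    have D: "fs \<in> pdom L" "gs \<in> pdom L" "fs \<in> lists L1" "gs \<in> lists L2"
      using psubgroupD(3)[OF P(1) fg(1)] psubgroupD(3)[OF Q(1) fg(2)] fg lists_mono[OF P(2)] lists_mono[OF Q(2)]
      by blast+
    have "pprod L w = pprod L fs \<cdot> pprod L gs"
      unfolding fg(4) by (rule product_word(2)[OF D(1,3,2,4) fg(3)])
    then show ?thesis
      using product_word(1)[OF D(1,3,2,4) fg(3)] psubgroupD(4)[OF P(1) fg(1)] psubgroupD(4)[OF Q(1) fg(2)]
      unfolding iff fg(4) by blast
  qed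
  moreover have "pinv L x \<in> P \<star> Q" if x: "x \<in> P \<star> Q" for x
  proof -
    obtain f g where fg: "f \<in> P" "g \<in> Q" "x = f \<cdot> g" using x iff by blast
    have "f \<in> L1" "g \<in> L2" using fg P(2) Q(2) by auto
    then have "pinv L x = pinv L f \<cdot> pinv L g"
      unfolding fg(3) by (rule pinv_factors)
    then show ?thesis
      using psubgroupD(2)[OF P(1) fg(1)] psubgroupD(2)[OF Q(1) fg(2)] iff by blast
  qed
  moreover have "P \<star> Q \<subseteq> pcarrier L"
    using iff mult_dom(1) pprod_closed P(2) Q(2) by (metis subsetD subsetI)
  ultimately show ?thesis
    unfolding psubgroup_def partial_subgroup_def by blast
qed

lemma set_prod_object:
  assumes "P \<in> \<Delta>1" "Q \<in> \<Delta>2"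
  shows "P \<star> Q \<in> \<Delta>"
proof -
  have "psubgroup L (P \<star> Q)" "P \<star> Q \<subseteq> S"
    using psubgroup_set_prod object1D[OF assms(1)] object2D[OF assms(2)] set_prod_subset_S by auto
  then show ?thesis
    using assms unfolding \<Delta>_eq by blast
qed

text \<open>This is (C1) and (C2) for the pair of words \<open>(f^-1, x, f)\<close> and
  \<open>(g^-1, y, g)\<close>. Conjugation of one factor alone is the instance in which the other
  word consists of trivial letters or fixes its middle letter.\<close>

lemma conj_mult_factors:
  assumes f: "f \<in> L1" "x \<in> L1" "x \<in> conj_dom L f" and g: "g \<in> L2" "y \<in> L2" "y \<in> conj_dom L g"
  shows "x \<cdot> y \<in> conj_dom L (f \<cdot> g)" "pconj L (f \<cdot> g) (x \<cdot> y) = pconj L f x \<cdot> pconj L g y"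
proof -
  have "pinv L (f \<cdot> g) = pinv L f \<cdot> pinv L g"
    using f(1) g(1) by (rule pinv_factors)
  then have word: "map2 (\<cdot>) [pinv L f, x, f] [pinv L g, y, g] = [pinv L (f \<cdot> g), x \<cdot> y, f \<cdot> g]"
    by simp
  have "[pinv L (f \<cdot> g), x \<cdot> y, f \<cdot> g] \<in> pdom L"
    "pprod L [pinv L (f \<cdot> g), x \<cdot> y, f \<cdot> g] = pconj L f x \<cdot> pconj L g y"
    unfolding word[symmetric] pconj_def
    by (rule product_word; use conj_domD(2)[OF f(3)] conj_domD(2)[OF g(3)] f g L1D(2) L2D(2) in simp)+
  then show "x \<cdot> y \<in> conj_dom L (f \<cdot> g)" "pconj L (f \<cdot> g) (x \<cdot> y) = pconj L f x \<cdot> pconj L g y"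
    using pprod_closed[OF mult_dom(1)[OF f(2) g(2)]] by (auto simp: conj_dom_def pconj_def)
qed

lemma conj_set_prod:
  assumes f: "f \<in> L1" "P \<subseteq> L1" "P \<subseteq> conj_dom L f" and g: "g \<in> L2" "Q \<subseteq> L2" "Q \<subseteq> conj_dom L g"
  shows "P \<star> Q \<subseteq> conj_dom L (f \<cdot> g)" "pconj L (f \<cdot> g) ` (P \<star> Q) = (pconj L f ` P) \<star> (pconj L g ` Q)"
proof -
  have P: "pconj L f ` P \<subseteq> L1"
    using L1D(3) conj_domD(2) f L1D(2) unfolding pconj_def by (auto simp: subset_iff)
  have Q: "pconj L g ` Q \<subseteq> L2"
    using L2D(3) conj_domD(2) g L2D(2) unfolding pconj_def by (auto simp: subset_iff)
  have c: "x \<cdot> y \<in> conj_dom L (f \<cdot> g)" "pconj L (f \<cdot> g) (x \<cdot> y) = pconj L f x \<cdot> pconj L g y"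
    if "x \<in> P" "y \<in> Q" for x y
    using conj_mult_factors[of f x g y] f g that by auto
  show "P \<star> Q \<subseteq> conj_dom L (f \<cdot> g)"
    using c(1) set_prod_iff[OF f(2) g(2)] by auto
  show "pconj L (f \<cdot> g) ` (P \<star> Q) = (pconj L f ` P) \<star> (pconj L g ` Q)"
  proof (rule equalityI; rule subsetI)
    fix z assume "z \<in> pconj L (f \<cdot> g) ` (P \<star> Q)"
    then obtain x y where "x \<in> P" "y \<in> Q" "z = pconj L (f \<cdot> g) (x \<cdot> y)"
      using set_prod_iff[OF f(2) g(2)] by auto
    then show "z \<in> (pconj L f ` P) \<star> (pconj L g ` Q)"
      unfolding set_prod_iff[OF P Q] using c(2) by blast
  next
    fix z assume "z \<in> (pconj L f ` P) \<star> (pconj L g ` Q)"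
    then obtain x y where xy: "x \<in> P" "y \<in> Q" "z = pconj L f x \<cdot> pconj L g y"
      unfolding set_prod_iff[OF P Q] by blast
    then have "x \<cdot> y \<in> P \<star> Q" "z = pconj L (f \<cdot> g) (x \<cdot> y)"
      using set_prod_iff[OF f(2) g(2)] c(2) by auto
    then show "z \<in> pconj L (f \<cdot> g) ` (P \<star> Q)" by blast
  qed
qed

lemma conj_left_factor:
  assumes "f \<in> L1" "P \<subseteq> L1" "P \<subseteq> conj_dom L f" "Q \<subseteq> L2"
  shows "P \<star> Q \<subseteq> conj_dom L f" "pconj L f ` (P \<star> Q) = (pconj L f ` P) \<star> Q"
proof -
  have Q: "Q \<subseteq> conj_dom L (pone L)" "pconj L (pone L) ` Q = Q"
    using conj_one assms(4) L2D(1) by (auto simp: subset_iff)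
  have "f \<cdot> pone L = f" using one_mult(4) assms(1) L1D(1) by blast
  then show "P \<star> Q \<subseteq> conj_dom L f" "pconj L f ` (P \<star> Q) = (pconj L f ` P) \<star> Q"
    using conj_set_prod[OF assms(1-3) one_L2 assms(4) Q(1)] Q(2) by simp_all
qed

lemma conj_right_factor:
  assumes "g \<in> L2" "Q \<subseteq> L2" "Q \<subseteq> conj_dom L g" "P \<subseteq> L1"
  shows "P \<star> Q \<subseteq> conj_dom L g" "pconj L g ` (P \<star> Q) = P \<star> (pconj L g ` Q)"
proof -
  have P: "P \<subseteq> conj_dom L (pone L)" "pconj L (pone L) ` P = P"
    using conj_one assms(4) L1D(1) by (auto simp: subset_iff)
  have "pone L \<cdot> g = g" using one_mult(2) assms(1) L2D(1) by blast
  then show "P \<star> Q \<subseteq> conj_dom L g" "pconj L g ` (P \<star> Q) = P \<star> (pconj L g ` Q)"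
    using conj_set_prod[OF one_L1 assms(4) P(1) assms(1-3)] P(2) by simp_all
qed

lemma conj_dom_object1:
  assumes "f \<in> L1"
  obtains P where "P \<in> \<Delta>1" "P \<subseteq> conj_dom L f" "pconj L f ` P \<in> \<Delta>1"
proof -
  have "[f] \<in> pdom (prestrict L L1)"
    using F1.pdom_singleton assms by simp
  then obtain P where "P \<in> \<Delta>1" "P \<subseteq> conj_dom (prestrict L L1) f" "pconj L f ` P \<in> \<Delta>1"
    unfolding F1.pdom_iff by auto
  then show ?thesis
    using that conj_dom_prestrict[OF sub1(1) assms] by blast
qed

lemma conj_dom_object2:
  assumes "g \<in> L2"
  obtains P where "P \<in> \<Delta>2" "P \<subseteq> conj_dom L g" "pconj L g ` P \<in> \<Delta>2"
  using locality_product.conj_dom_object1[OF swap assms] by blast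

text \<open>For \<open>x = f g = f' g'\<close> the word \<open>(g', x\<^sup>-\<^sup>1, y, x, g'\<^sup>-\<^sup>1)\<close> has an object path, and multiplying its
  outer letters together gives \<open>(f'\<^sup>-\<^sup>1, y, f')\<close>.\<close>

lemma conj_same_product:
  assumes f: "f \<in> L1" and g: "g \<in> L2" and f': "f' \<in> L1" and g': "g' \<in> L2" and eq: "f \<cdot> g = f' \<cdot> g'"
    and P: "P \<in> \<Delta>1" "P \<subseteq> conj_dom L f" "pconj L f ` P \<in> \<Delta>1" and y: "y \<in> P"
  shows "y \<in> conj_dom L f'" "pconj L f' y = pconj L f y"
proof -
  define x where "x = f \<cdot> g"
  define b where "b = pconj L f y"
  have x': "x = f' \<cdot> g'" by (simp add: x_def eq)
  have fc: "f \<in> pcarrier L" "g \<in> pcarrier L" "f' \<in> pcarrier L" "g' \<in> pcarrier L"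
    using f g f' g' L1D(1) L2D(1) by auto
  have xc: "x \<in> pcarrier L" unfolding x_def by (rule pprod_closed[OF mult_dom(1)[OF f g]])
  note xinv = pinv_closed[OF xc]
  have yS: "y \<in> S1" "y \<in> S" "y \<in> L1" using object1D(2)[OF P(1)] y S12_subset by auto
  have b: "b \<in> S1" "b \<in> S" "b \<in> L1" using object1D(2)[OF P(3)] y S12_subset by (auto simp: b_def)
  have yc: "y \<in> pcarrier L" and bc: "b \<in> pcarrier L" using yS b S_subset by auto
  have yx: "y \<in> conj_dom L x" "pconj L x y = b"
  proof -
    have "y \<cdot> pone L \<in> conj_dom L x" "pconj L x (y \<cdot> pone L) = b \<cdot> pone L"
      using conj_mult_factors[OF f yS(3) _ g one_L2] one_in_conj_dom[OF fc(2)] P(2) y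
      by (auto simp: x_def b_def)
    then show "y \<in> conj_dom L x" "pconj L x y = b"
      using one_mult(4) yc bc by simp_all
  qed
  \<comment> \<open>\<open>Q1\<close> and \<open>Q2\<close> are objects on which \<open>f'\<close>
    and \<open>g'\<close> act. The element \<open>y\<close> need not lie in \<open>Q1\<close>; but
    \<open>x\<close> conjugates \<open>y\<close> into \<open>S\<close>, so
    \<open>object_conj_transfer\<close> permits \<open>Q1 \<star> Q2\<close> to be moved by
    \<open>y\<close>.\<close>
  obtain Q1 where Q1: "Q1 \<in> \<Delta>1" "Q1 \<subseteq> conj_dom L f'" "pconj L f' ` Q1 \<in> \<Delta>1"
    using conj_dom_object1[OF f'] .
  obtain Q2 where Q2: "Q2 \<in> \<Delta>2" "Q2 \<subseteq> conj_dom L g'" "pconj L g' ` Q2 \<in> \<Delta>2"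
    using conj_dom_object2[OF g'] .
  let ?R1 = "pconj L f' ` Q1" and ?R2 = "pconj L g' ` Q2"
  note Q1L = object1D(3)[OF Q1(1)] object1D(3)[OF Q1(3)] and Q2L = object2D(3)[OF Q2(1)] object2D(3)[OF Q2(3)]
  let ?X = "Q1 \<star> Q2"
  have X: "?X \<in> \<Delta>" "?X \<subseteq> conj_dom L x" "pconj L x ` ?X = ?R1 \<star> ?R2" "?R1 \<star> ?R2 \<in> \<Delta>" "?R1 \<star> Q2 \<in> \<Delta>"
    using set_prod_object Q1 Q2 conj_set_prod[OF f' Q1L(1) Q1(2) g' Q2L(1) Q2(2)] by (auto simp: x')
  note transfer = object_conj_transfer[OF xc yS(2) yx(1) _ X(1,2), unfolded yx(2) X(3), OF b(2) X(4)]
  have R1b: "?R1 \<subseteq> conj_dom L b" "pconj L b ` ?R1 \<in> \<Delta>1"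
    using F1.object_conj_S[OF Q1(3) b(1)] conj_dom_prestrict[OF sub1(1) b(3)] by auto
  have R1bL: "pconj L b ` ?R1 \<subseteq> L1" using object1D(3)[OF R1b(2)] .
  have step5: "pconj L x ` pconj L y ` ?X = (pconj L b ` ?R1) \<star> ?R2"
  proof -
    have "pconj L x ` pconj L y ` ?X = pconj L b ` pconj L x ` ?X"
      using transfer(2) by (auto simp: image_image)
    also have "\<dots> = (pconj L b ` ?R1) \<star> ?R2"
      unfolding X(3) by (rule conj_left_factor(2)[OF b(3) Q1L(2) R1b(1) Q2L(2)])
    finally show ?thesis .
  qed
  have xx: "?R1 \<star> ?R2 \<subseteq> conj_dom L (pinv L x)" "pconj L (pinv L x) ` (?R1 \<star> ?R2) = ?X"
    using conj_image_inv[OF xc X(2)] by (simp_all add: X(3))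
  have g'Q: "?R2 \<subseteq> conj_dom L (pinv L g')" "pconj L (pinv L g') ` ?R2 = Q2"
    using conj_image_inv[OF fc(4) Q2(2)] by simp_all
  \<comment> \<open>The path runs through \<open>?R1 \<star> Q2\<close>,
    \<open>?R1 \<star> ?R2\<close>, \<open>?X\<close>, the conjugate of \<open>?X\<close> by
    \<open>y\<close>, and then, with \<open>?R1\<close> replaced by its conjugate under
    \<open>b\<close>, through the products with \<open>?R2\<close> and with
    \<open>Q2\<close>.\<close>
  have "object_path L \<Delta> (?R1 \<star> Q2) [g', pinv L x, y, x, pinv L g']"
    using X object_conj_S[OF X(1) yS(2)] transfer(1) xc xinv fc yc pinv_closed[OF fc(4)] xx
      conj_right_factor[OF g' Q2L(1) Q2(2) Q1L(2)]
      conj_right_factor[OF L2D(2)[OF g'] Q2L(2) g'Q(1) R1bL] g'Q(2)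
      set_prod_object[OF R1b(2) Q2(3)] set_prod_object[OF R1b(2) Q2(1)] step5
    by simp
  then have D: "[g', pinv L x, y, x, pinv L g'] \<in> pdom L" using pdom_iff by blast
  have inv_f': "pinv L f' \<in> L1" "pinv L g' \<in> L2" using L1D(2) L2D(2) f' g' by auto
  have one_f: "f' \<cdot> pone L = f'" "pone L \<cdot> pinv L f' = pinv L f'" "pinv L f' \<cdot> pone L = pinv L f'"
    using one_mult fc pinv_closed by simp_all
  have p1: "x \<cdot> pinv L g' = f'"
    using product_word(2)[of "[f', pone L]" "[g', pinv L g']"] f' g' inv_f' one_L1 one_L2 one_f
      one_mult[OF fc(3)] inv_mult[OF fc(4)] one_mult[OF pinv_closed[OF fc(4)]] by (simp add: x')
  have xi: "pinv L x = pinv L f' \<cdot> pinv L g'"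
    unfolding x' using f' g' by (rule pinv_factors)
  have p2: "g' \<cdot> pinv L x = pinv L f'"
    using product_word(2)[of "[pone L, pinv L f']" "[g', pinv L g']"] f' g' inv_f' one_L1 one_L2 one_f
      one_mult[OF fc(4)] one_mult[OF pinv_closed[OF fc(3)]] inv_mult[OF fc(4)] by (simp add: xi)
  have E1: "[pinv L f', y, x, pinv L g'] \<in> pdom L"
    "pprod L [g', pinv L x, y, x, pinv L g'] = pprod L [pinv L f', y, x, pinv L g']"
    using pprod_assoc[of "[]" "[g', pinv L x]" "[y, x, pinv L g']"] D by (simp_all add: p2)
  have E2: "[pinv L f', y, f'] \<in> pdom L"
    "pprod L [pinv L f', y, x, pinv L g'] = pprod L [pinv L f', y, f']"
    using pprod_assoc[of "[pinv L f', y]" "[x, pinv L g']" "[]"] E1(1) by (simp_all add: p1)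
  then show "y \<in> conj_dom L f'" using yc by (simp add: conj_dom_def)
  have bx: "pprod L [pinv L x, y, x] = b" using yx(2) by (simp add: pconj_def)
  \<comment> \<open>Evaluated from the inside, the same word gives \<open>g' b g'^-1\<close>, which
    is \<open>b\<close> because \<open>b\<close> lies in \<open>L1\<close> and \<open>g'\<close> in
    \<open>L2\<close>.\<close>
  have E3: "pprod L [g', pinv L x, y, x, pinv L g'] = pprod L [g', b, pinv L g']"
    using pprod_assoc[of "[g']" "[pinv L x, y, x]" "[pinv L g']"] D by (simp add: bx)
  have "pprod L [g', b, pinv L g'] = b"
    using product_word(2)[of "[pone L, b, pone L]" "[g', pone L, pinv L g']"] insert_one[of "[]" "[b, pone L]"]
      insert_one[of "[g']" "[pinv L g']"] one_mult[OF bc] one_mult[OF fc(4)] one_mult[OF pinv_closed[OF fc(4)]]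
      inv_mult[OF fc(4)] one_L1 one_L2 b(3) g' inv_f' by simp
  then show "pconj L f' y = pconj L f y"
    using E1(2) E2(2) E3 by (simp add: pconj_def b_def)
qed

interpretation F1: locality p "prestrict L L1" \<Delta>1 S1 by (rule sub1)
interpretation F2: locality p "prestrict L L2" \<Delta>2 S2 by (rule sub2)

text \<open>By \<open>conj_same_product\<close>, \<open>f\<close> and \<open>f'\<close> act alike on
  an object \<open>P\<close> of \<open>L1\<close>, so the word \<open>(f^-1, f')\<close> leads from
  the conjugate of \<open>P\<close> back to \<open>P\<close> and out again. Hence
  \<open>z = f^-1 f'\<close> is defined and lies in \<open>L1\<close>; the relation
  \<open>g = z g'\<close> shows that it lies in \<open>L2\<close> as well.\<close>

lemma factor_unique:
  assumes f: "f \<in> L1" "f' \<in> L1" and g: "g \<in> L2" "g' \<in> L2" and eq: "f \<cdot> g = f' \<cdot> g'"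
  obtains z where "z \<in> L1 \<inter> L2" "f' = f \<cdot> z" "g = z \<cdot> g'"
proof -
  have fc: "f \<in> pcarrier L" "f' \<in> pcarrier L" "g \<in> pcarrier L" "g' \<in> pcarrier L"
    using f g L1D(1) L2D(1) by auto
  obtain P where P: "P \<in> \<Delta>1" "P \<subseteq> conj_dom L f" "pconj L f ` P \<in> \<Delta>1"
    using conj_dom_object1[OF f(1)] .
  have P': "P \<subseteq> conj_dom L f'" "pconj L f' ` P = pconj L f ` P"
    using conj_same_product[OF f(1) g(1) f(2) g(2) eq P] by auto
  have "pconj L f ` P \<subseteq> conj_dom L (pinv L f)" "pconj L (pinv L f) ` pconj L f ` P = P"
    using conj_image_inv[OF fc(1) P(2)] by auto
  moreover have "pconj L f ` P \<subseteq> L1" "P \<subseteq> L1"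
    using object1D(3) P(1,3) by auto
  ultimately have "object_path (prestrict L L1) \<Delta>1 (pconj L f ` P) [pinv L f, f']"
    using P P' f L1D(2) conj_dom_prestrict[OF sub1(1)] by simp
  then have "[pinv L f, f'] \<in> pdom (prestrict L L1)"
    using F1.pdom_iff by blast
  then have D: "[pinv L f, f'] \<in> pdom L" by simp
  define z where "z = pinv L f \<cdot> f'"
  have z1: "z \<in> L1" using D L1D(2,3) f by (simp add: z_def)
  have fz: "f \<cdot> z = f'"
    using cancel_left(3)[OF D] pinv_pinv[OF fc(1)] by (simp add: z_def)
  have "map2 (\<cdot>) [pinv L f, f'] [pone L, g'] = [pinv L f, f \<cdot> g]"
    using one_mult(4)[OF pinv_closed[OF fc(1)]] by (simp add: eq)
  then have "pinv L f \<cdot> (f \<cdot> g) = z \<cdot> (pone L \<cdot> g')"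
    using product_word(2)[of "[pinv L f, f']" "[pone L, g']"] D f g L1D(2) one_mult(1)[OF fc(4)] one_L2
    by (simp add: z_def)
  then have gz: "g = z \<cdot> g'"
    using cancel_left(3)[OF mult_dom(1)[OF f(1) g(1)]] one_mult(2)[OF fc(4)] by simp
  have gzD: "[g', z] \<in> pdom L" "g' \<cdot> z = g"
    using mult_dom[OF z1 g(2)] gz by auto
  have "[pinv L g', g] \<in> pdom L" "pinv L g' \<cdot> g = z"
    using cancel_left(2,3)[OF gzD(1)] gzD(2) by auto
  then have "z \<in> L2"
    using L2D(3)[of "[pinv L g', g]"] L2D(2) g by simp
  then show ?thesis using that z1 fz gz by blast
qed

text \<open>A central letter can be entered in either factor. The last letter goes into the second
  word and all others into the first; both are padded with \<open>pone L\<close>, and (C1) joins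
  them.\<close>

lemma center_dom:
  assumes "zs \<in> lists (L1 \<inter> L2)"
  shows "zs \<in> pdom L"
  using assms
proof (induction zs rule: rev_induct)
  case Nil
  show ?case by (rule pdom_Nil)
next
  case (snoc z zs)
  then have zs: "zs \<in> pdom L" "zs \<in> lists (L1 \<inter> L2)" and z: "z \<in> L1" "z \<in> L2" by auto
  have zc: "z \<in> pcarrier L" using z L1D(1) by auto
  have one: "y \<cdot> pone L = y" if "y \<in> set zs" for y
    using that zs(1) pdom_closed one_mult(4) by blast
  have "replicate (length zs) (pone L) @ [z] \<in> pdom L"
  proof (induction zs)
    case (Cons a zs)
    then show ?case using insert_one[of "[]" "replicate (length zs) (pone L) @ [z]"] by simp
  qed (use pdom_singleton[OF zc] in simp)
  moreover have "zs @ [pone L] \<in> pdom L"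
    using insert_one[of zs "[]"] zs(1) by simp
  ultimately have "map2 (\<cdot>) (zs @ [pone L]) (replicate (length zs) (pone L) @ [z]) \<in> pdom L"
    using zs(2) z one_L1 one_L2 by (intro product_word) auto
  moreover have "map2 (\<cdot>) (zs @ [pone L]) (replicate (length zs) (pone L) @ [z]) = zs @ [z]"
    using one one_mult(2)[OF zc] by (auto simp: list_eq_iff_nth_eq nth_append)
  ultimately show ?case by simp
qed

text \<open>(C1) yields some factorization \<open>hs\<close>, \<open>ks\<close> with
  \<open>hs\<close> in the domain. By \<open>factor_unique\<close> the letters of \<open>fs\<close>
  and \<open>hs\<close> differ by central elements. These form a word over \<open>L2\<close> that
  lies in the domain, and (C1) for \<open>hs\<close> and this word returns
  \<open>fs\<close>.\<close>

lemma dom_factor1: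
  assumes "fs \<in> lists L1" "gs \<in> lists L2" "length fs = length gs" "map2 (\<cdot>) fs gs \<in> pdom L"
  shows "fs \<in> pdom L"
proof -
  obtain hs ks where hk: "hs \<in> pdom L" "hs \<in> lists L1" "ks \<in> lists L2"
    "length hs = length ks" "map2 (\<cdot>) fs gs = map2 (\<cdot>) hs ks"
    using word_decomposition[OF assms(4)] by metis
  have len: "length hs = length fs"
    using arg_cong[OF hk(5), of length] assms(3) hk(4) by simp
  have "\<exists>z. z \<in> L1 \<inter> L2 \<and> fs ! i = hs ! i \<cdot> z" if i: "i < length fs" for i
  proof -
    have "hs ! i \<cdot> ks ! i = fs ! i \<cdot> gs ! i"
      using arg_cong[OF hk(5), of "\<lambda>w. w ! i"] i len hk(4) assms(3) by simp
    moreover have "hs ! i \<in> L1" "fs ! i \<in> L1" "ks ! i \<in> L2" "gs ! i \<in> L2"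
      using i len hk assms by (auto simp: in_lists_conv_set)
    ultimately show ?thesis
      using factor_unique[of "hs ! i" "fs ! i" "ks ! i" "gs ! i"] by metis
  qed
  then obtain z where z: "\<And>i. i < length fs \<Longrightarrow> z i \<in> L1 \<inter> L2 \<and> fs ! i = hs ! i \<cdot> z i"
    by metis
  define zs where "zs = map z [0..<length fs]"
  have zs: "zs \<in> lists (L1 \<inter> L2)" "length zs = length hs"
    using z len by (auto simp: zs_def)
  then have "map2 (\<cdot>) hs zs \<in> pdom L"
    using hk center_dom[OF zs(1)] by (intro product_word(1)) auto
  moreover have "map2 (\<cdot>) hs zs = fs"
    using z len by (intro nth_equalityI) (auto simp: zs_def)
  ultimately show ?thesis by simp
qed

lemma dom_factors:
  assumes "fs \<in> lists L1" "gs \<in> lists L2" "length fs = length gs" "map2 (\<cdot>) fs gs \<in> pdom L"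
  shows "fs \<in> pdom L" "gs \<in> pdom L"
proof -
  show "fs \<in> pdom L" by (rule dom_factor1[OF assms])
  have "gs ! i \<cdot> fs ! i = fs ! i \<cdot> gs ! i" if "i < length fs" for i
    by (rule mult_dom(3)[symmetric]) (use assms(1-3) that in \<open>auto simp: in_lists_conv_set\<close>)
  then have "map2 (\<cdot>) gs fs = map2 (\<cdot>) fs gs"
    using assms(3) by (intro nth_equalityI) auto
  then show "gs \<in> pdom L"
    using locality_product.dom_factor1[OF swap assms(2,1)] assms(3,4) by simp
qed

lemma conj_dom_factors:
  assumes f: "f \<in> L1" "x \<in> L1" and g: "g \<in> L2" "y \<in> L2" and D: "x \<cdot> y \<in> conj_dom L (f \<cdot> g)"
  shows "x \<in> conj_dom L f" "y \<in> conj_dom L g" "pconj L (f \<cdot> g) (x \<cdot> y) = pconj L f x \<cdot> pconj L g y"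
    "pconj L f x \<in> L1" "pconj L g y \<in> L2"
proof -
  have "map2 (\<cdot>) [pinv L f, x, f] [pinv L g, y, g] \<in> pdom L"
    using conj_domD(2)[OF D] pinv_factors[OF f(1) g(1)] by simp
  then have "[pinv L f, x, f] \<in> pdom L" "[pinv L g, y, g] \<in> pdom L"
    using dom_factors[of "[pinv L f, x, f]" "[pinv L g, y, g]"] f g L1D(2) L2D(2) by auto
  then show x: "x \<in> conj_dom L f" and y: "y \<in> conj_dom L g"
    and "pconj L f x \<in> L1" "pconj L g y \<in> L2"
    using f g L1D L2D by (auto simp: conj_dom_def pconj_def)
  show "pconj L (f \<cdot> g) (x \<cdot> y) = pconj L f x \<cdot> pconj L g y"
    by (rule conj_mult_factors(2)[OF f x g y])
qed

lemma conj_center: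
  assumes "f \<in> L1" "z \<in> L1 \<inter> L2"
  shows "z \<in> conj_dom L f" "pconj L f z = z" "f \<in> conj_dom L z" "pconj L z f = f"
proof -
  have fc: "f \<in> pcarrier L" "z \<in> pcarrier L" using assms L1D(1) by auto
  have one: "pone L \<cdot> f = f" "f \<cdot> pone L = f" "pone L \<cdot> z = z" "z \<cdot> pone L = z"
    using one_mult fc by auto
  have "pone L \<cdot> z \<in> conj_dom L (f \<cdot> pone L) \<and>
      pconj L (f \<cdot> pone L) (pone L \<cdot> z) = pconj L f (pone L) \<cdot> pconj L (pone L) z"
    using conj_mult_factors[OF assms(1) one_L1 one_in_conj_dom(1)[OF fc(1)] one_L2 _ conj_one(1)[OF fc(2)]]
      assms(2) by blast
  then show "z \<in> conj_dom L f" "pconj L f z = z"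
    using one one_in_conj_dom(2)[OF fc(1)] conj_one(2)[OF fc(2)] by auto
  have "f \<cdot> pone L \<in> conj_dom L (pone L \<cdot> z) \<and>
      pconj L (pone L \<cdot> z) (f \<cdot> pone L) = pconj L (pone L) f \<cdot> pconj L z (pone L)"
    using conj_mult_factors[OF one_L1 assms(1) conj_one(1)[OF fc(1)] _ one_L2 one_in_conj_dom(1)[OF fc(2)]]
      assms(2) by blast
  then show "f \<in> conj_dom L z" "pconj L z f = f"
    using one one_in_conj_dom(2)[OF fc(2)] conj_one(2)[OF fc(1)] by auto
qed

lemma psubgroup_center: "psubgroup L (L1 \<inter> L2)"
proof -
  have "pprod L w \<in> L1 \<inter> L2" if "w \<in> lists (L1 \<inter> L2)" for w
  proof -
    have "w \<in> lists L1" "w \<in> lists L2" using that by auto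
    then show ?thesis using L1D(3) L2D(3) center_dom[OF that] by blast
  qed
  then show ?thesis
    using center_dom L1D L2D unfolding psubgroup_def partial_subgroup_def by blast
qed

lemma center_mult:
  assumes "f \<in> L1" "z \<in> L1 \<inter> L2"
  shows "f \<cdot> z \<in> L1" "z \<cdot> f = f \<cdot> z"
  using L1D(3)[of "[f, z]"] mult_dom[of f z] assms by auto

section \<open>Projections to the factors\<close>

abbreviation proj1 where "proj1 P \<equiv> cproj L L1 L2 P"
abbreviation proj2 where "proj2 P \<equiv> cproj L L2 L1 P"

lemma proj1_iff: "f \<in> proj1 P \<longleftrightarrow> f \<in> L1 \<and> (\<exists>g\<in>L2. f \<cdot> g \<in> P)"
  by (simp add: cproj_def)

lemma proj2_iff: "g \<in> proj2 P \<longleftrightarrow> g \<in> L2 \<and> (\<exists>f\<in>L1. f \<cdot> g \<in> P)"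
  unfolding cproj_def using mult_dom(3) by (auto; metis)

lemma center_subset_proj1:
  assumes "pone L \<in> P"
  shows "L1 \<inter> L2 \<subseteq> proj1 P"
proof
  fix z assume z: "z \<in> L1 \<inter> L2"
  have "z \<cdot> pinv L z = pone L" using inv_mult(4) z L1D(1) by blast
  then show "z \<in> proj1 P" using z L2D(2)[of z] assms by (auto simp: proj1_iff intro!: bexI[of _ "pinv L z"])
qed

lemma proj1_mem:
  assumes "psubgroup L P" "f \<in> L1" "g \<in> L2" "f \<cdot> g \<in> P"
  shows "f \<in> proj1 P" "g \<in> proj2 P"
  using assms by (auto simp: proj1_iff proj2_iff)

text \<open>A word over the projection is completed by second factors to a word over
  \<open>P\<close>, and \<open>dom_factors\<close> brings the domain membership back to the first
  factors.\<close>

lemma psubgroup_proj1: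
  assumes P: "psubgroup L P"
  shows "psubgroup L (proj1 P)"
proof -
  have "w \<in> pdom L \<and> pprod L w \<in> proj1 P" if w: "w \<in> lists (proj1 P)" for w
  proof -
    have "\<exists>gs. gs \<in> lists L2 \<and> length w = length gs \<and> map2 (\<cdot>) w gs \<in> lists P"
      using w
    proof (induction w rule: list.induct)
      case (Cons f w)
      then obtain gs where "gs \<in> lists L2 \<and> length w = length gs \<and> map2 (\<cdot>) w gs \<in> lists P"
        by auto
      moreover obtain g where "g \<in> L2" "f \<cdot> g \<in> P" using Cons.prems by (auto simp: proj1_iff)
      ultimately show ?case by (intro exI[of _ "g # gs"]) auto
    qed (auto intro: exI[of _ "[]"])
    then obtain gs where gs: "gs \<in> lists L2" "length w = length gs" "map2 (\<cdot>) w gs \<in> lists P"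
      by blast
    have w1: "w \<in> lists L1" using w by (auto simp: in_lists_conv_set proj1_iff)
    note D = dom_factors[OF w1 gs(1,2) psubgroupD(3)[OF P gs(3)]]
    have "pprod L w \<cdot> pprod L gs \<in> P"
      using psubgroupD(4)[OF P gs(3)] product_word(2)[OF D(1) w1 D(2) gs(1,2)] by simp
    then show ?thesis
      using D L1D(3)[OF w1] L2D(3)[OF gs(1)] by (auto simp: proj1_iff)
  qed
  moreover have "pinv L f \<in> proj1 P" if f: "f \<in> proj1 P" for f
  proof -
    obtain g where g: "f \<in> L1" "g \<in> L2" "f \<cdot> g \<in> P" using f by (auto simp: proj1_iff)
    then have "pinv L f \<cdot> pinv L g \<in> P"
      using psubgroupD(2)[OF P g(3)] pinv_factors[OF g(1,2)] by simp
    then show ?thesis using g L1D(2) L2D(2)[OF g(2)] by (auto simp: proj1_iff)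
  qed
  moreover have "proj1 P \<subseteq> pcarrier L" using L1D(1) by (auto simp: proj1_iff)
  ultimately show ?thesis
    unfolding psubgroup_def partial_subgroup_def by blast
qed

lemma subset_proj_product:
  assumes "P \<subseteq> pcarrier L"
  shows "P \<subseteq> proj1 P \<star> proj2 P"
proof
  fix x assume x: "x \<in> P"
  then obtain f g where fg: "f \<in> L1" "g \<in> L2" "x = f \<cdot> g" using decomposition assms by blast
  then have "f \<in> proj1 P" "g \<in> proj2 P" using x by (auto simp: proj1_iff proj2_iff)
  then show "x \<in> proj1 P \<star> proj2 P"
    using fg mult_dom(1) unfolding set_prod_def by blast
qed

text \<open>First factors are determined up to central elements by \<open>factor_unique\<close>;
  projecting a product therefore returns \<open>P\<close> together with the center.\<close>

lemma proj1_set_prod: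
  assumes "P \<subseteq> L1" "Q \<subseteq> L2" "pone L \<in> Q" "x \<in> L1"
  shows "x \<in> proj1 (P \<star> Q) \<longleftrightarrow> (\<exists>a\<in>P. \<exists>z\<in>L1 \<inter> L2. x = a \<cdot> z)"
proof
  assume "x \<in> proj1 (P \<star> Q)"
  then obtain y a b where y: "y \<in> L2" "x \<cdot> y = a \<cdot> b" "a \<in> P" "b \<in> Q"
    using set_prod_iff[OF assms(1,2)] by (auto simp: proj1_iff)
  then obtain z where "z \<in> L1 \<inter> L2" "x = a \<cdot> z"
    using factor_unique[of a x b y] assms by (metis subsetD)
  then show "\<exists>a\<in>P. \<exists>z\<in>L1 \<inter> L2. x = a \<cdot> z" using y by blast
next
  assume "\<exists>a\<in>P. \<exists>z\<in>L1 \<inter> L2. x = a \<cdot> z"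
  then obtain a z where az: "a \<in> P" "z \<in> L1 \<inter> L2" "x = a \<cdot> z" by blast
  have za: "[z, a] \<in> pdom L" "z \<cdot> a = x"
    using mult_dom[of a z] az assms(1) by auto
  have ac: "a \<in> pcarrier L" using az assms(1) L1D(1) by auto
  have "x \<cdot> pinv L z = pinv L z \<cdot> x" using mult_dom(3) assms(4) az(2) L2D(2) by blast
  also have "\<dots> = a \<cdot> pone L" using cancel_left(3)[OF za(1)] one_mult(4)[OF ac] by (simp add: za(2))
  finally have "x \<cdot> pinv L z \<in> P \<star> Q"
    using set_prod_iff[OF assms(1,2)] az(1) assms(3) by blast
  then show "x \<in> proj1 (P \<star> Q)" using assms(4) L2D(2)[of z] az(2) by (auto simp: proj1_iff)
qed

end

section \<open>Objective characteristic\<close>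

context locality
begin

lemma object_normal:
  assumes P: "P \<in> \<Delta>" and K: "psubgroup L K" "P \<subseteq> K" "K \<subseteq> pnormalizer L P" and p: "prime p"
  shows "normal_p_subgroup p (group_on L K) P"
proof -
  interpret K: group "group_on L K" using K(1) by (rule group_on_psubgroup)
  have "subgroup P (group_on L K)"
    using objectD(1)[OF P] K(1,2) by (simp add: subgroup_group_on_iff)
  moreover have "x \<otimes>\<^bsub>group_on L K\<^esub> h \<otimes>\<^bsub>group_on L K\<^esub> inv\<^bsub>group_on L K\<^esub> x \<in> P" if "x \<in> K" "h \<in> P" for x h
  proof -
    have x: "pinv L x \<in> K" "pinv L x \<in> pnormalizer L P" "h \<in> K"
      using psubgroupD(2)[OF K(1) that(1)] K(2,3) that(2) by auto
    \<comment> \<open>\<open>pconj\<close> conjugates from the right, the normality criterion from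
      the left; conjugation by \<open>pinv L x\<close> translates.\<close>
    have eq: "pconj L (pinv L x) h = x \<otimes>\<^bsub>group_on L K\<^esub> h \<otimes>\<^bsub>group_on L K\<^esub> inv\<^bsub>group_on L K\<^esub> x"
      using pconj_group_on[OF K(1) x(1,3)] inv_group_on[OF K(1) that(1)] K.inv_inv[of x] that(1)
      by (simp del: group_on_simps(2))
    have "pconj L (pinv L x) h \<in> P"
      using x(2) that(2) by (auto simp: pnormalizer_def)
    then show ?thesis by (simp only: eq)
  qed
  moreover have "\<exists>n. card P = p ^ n"
  proof -
    interpret S: group "group_on L S" using psubgroup_S by (rule group_on_psubgroup)
    have "subgroup P (group_on L S)" "subgroup S (group_on L S)"
      using objectD[OF P] psubgroup_S by (simp_all add: subgroup_group_on_iff)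
    then show ?thesis
      using S.p_subgroup_mono[OF p _ _ objectD(2)[OF P]] prime_power_S by blast
  qed
  ultimately show ?thesis
    unfolding normal_p_subgroup_def K.normal_inv_iff by simp
qed

lemma commuting_in_normalizer:
  assumes M: "psubgroup L M" and P: "P \<subseteq> M" and g: "g \<in> M" "\<And>y. y \<in> P \<Longrightarrow> g \<cdot> y = y \<cdot> g"
  shows "g \<in> pnormalizer L P"
proof -
  interpret M: group "group_on L M" using M by (rule group_on_psubgroup)
  have "pconj L g y = y" if y: "y \<in> P" for y
  proof -
    have yM: "y \<in> M" using P y by blast
    have "inv\<^bsub>group_on L M\<^esub> g \<otimes>\<^bsub>group_on L M\<^esub> y \<otimes>\<^bsub>group_on L M\<^esub> g = y"
    proof -
      have "g \<otimes>\<^bsub>group_on L M\<^esub> y = y \<otimes>\<^bsub>group_on L M\<^esub> g" using g(2)[OF y] by simp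
      then show ?thesis
        using M.commute_inv[of g y] g(1) yM by (simp del: group_on_simps(2))
    qed
    then show ?thesis
      unfolding pconj_group_on[OF M g(1) yM] .
  qed
  moreover have "P \<subseteq> conj_dom L g"
    using psubgroup_conj(1)[OF M g(1)] P by blast
  ultimately show ?thesis
    using g(1) psubgroupD(1)[OF M] by (auto simp: pnormalizer_def)
qed

text \<open>\<open>S\<close> is normal in its normalizer, so \<open>S Z\<close> is a p-subgroup
  containing \<open>S\<close>, and maximality of \<open>S\<close> gives
  \<open>S Z = S\<close>.\<close>

lemma p_subgroup_subset_S:
  assumes p: "prime p" and Z: "psubgroup L Z" "card Z = p ^ i" "Z \<subseteq> pnormalizer L S"
  shows "Z \<subseteq> S"
proof -
  let ?M = "pnormalizer L S"
  have M: "psubgroup L ?M" "S \<subseteq> ?M"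
    using psubgroup_normalizer object_normalizes_self S_object by auto
  interpret M: group "group_on L ?M" using M(1) by (rule group_on_psubgroup)
  have fin: "finite (carrier (group_on L ?M))"
    using psubgroupD(1)[OF M(1)] finite_pcarrier by (auto intro: finite_subset)
  have S: "S \<lhd> group_on L ?M" "\<exists>n. card S = p ^ n"
    using object_normal[OF S_object M order.refl p] by (auto simp: normal_p_subgroup_def)
  have Zs: "subgroup Z (group_on L ?M)"
    using Z M(1) by (simp add: subgroup_group_on_iff)
  obtain n where n: "card S = p ^ n" using S(2) by blast
  let ?T = "S <#>\<^bsub>group_on L ?M\<^esub> Z"
  have T: "subgroup ?T (group_on L ?M)" "\<exists>k. card ?T = p ^ k"
    using M.normal_mult_p_subgroup[OF p fin S(1) n Zs Z(2)] by auto
  have "s \<cdot> pone L \<in> ?T" if "s \<in> S" for s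
    using that psubgroupD(5)[OF Z(1)] by (auto simp: set_mult_def)
  then have "S \<subseteq> ?T" using one_mult(4) S_subset by (auto simp: subset_iff)
  moreover have "pone L \<cdot> z \<in> ?T" if "z \<in> Z" for z
    using that psubgroupD(5)[OF psubgroup_S] by (auto simp: set_mult_def)
  then have "Z \<subseteq> ?T" using one_mult(2) psubgroupD(1)[OF Z(1)] by (auto simp: subset_iff)
  moreover have "p_psubgroup p L ?T"
    using T M(1) by (simp add: p_psubgroup_def subgroup_group_on_iff)
  ultimately show ?thesis using S_maximal by blast
qed

end

context locality_product
begin

interpretation F1: locality p "prestrict L L1" \<Delta>1 S1 by (rule sub1)
interpretation F2: locality p "prestrict L L2" \<Delta>2 S2 by (rule sub2)

lemma normalizer1:
  assumes "P \<in> \<Delta>1"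
  shows "pnormalizer (prestrict L L1) P = L1 \<inter> pnormalizer L P" "psubgroup L (L1 \<inter> pnormalizer L P)"
proof -
  show eq: "pnormalizer (prestrict L L1) P = L1 \<inter> pnormalizer L P"
    using pnormalizer_prestrict[OF sub1(1) object1D(3)[OF assms]] .
  show "psubgroup L (L1 \<inter> pnormalizer L P)"
    using F1.psubgroup_normalizer[OF assms] unfolding eq psubgroup_prestrict[OF sub1(1)] by simp
qed

lemma center_commutes:
  assumes "z \<in> L1 \<inter> L2" "x \<in> pcarrier L"
  shows "x \<in> conj_dom L z" "pconj L z x = x"
proof -
  obtain f g where fg: "f \<in> L1" "g \<in> L2" "x = f \<cdot> g" using decomposition assms(2) by blast
  have z: "z \<in> L1" "pconj L (pone L) g = g" "g \<in> conj_dom L (pone L)" "z \<cdot> pone L = z"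
    using assms(1) L1D(1) L2D(1) fg(2) conj_one one_mult(4) by auto
  show "x \<in> conj_dom L z" "pconj L z x = x"
    using conj_mult_factors[OF z(1) fg(1) conj_center(3)[OF fg(1) assms(1)] one_L2 fg(2) z(3)]
      conj_center(4)[OF fg(1) assms(1)] z fg(3) by simp_all
qed

lemma center_subset_normalizer:
  assumes "P \<subseteq> pcarrier L"
  shows "L1 \<inter> L2 \<subseteq> pnormalizer L P"
  using center_commutes assms L1D(1) by (auto simp: pnormalizer_def subset_iff image_iff)

text \<open>The center commutes with \<open>L1\<close>, hence with \<open>O_p\<close> of the
  normalizer in \<open>L1\<close> of an object. Characteristic p puts it inside this
  \<open>O_p\<close>, so it is a p-group; as it also normalizes \<open>S\<close>, it lies in
  \<open>S\<close>.\<close>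

lemma center_subset_S_if_characteristic_p:
  assumes "objective_characteristic_p p (prestrict L L1) \<Delta>1 S1"
  shows "L1 \<inter> L2 \<subseteq> S"
proof -
  let ?Z = "L1 \<inter> L2"
  obtain P where P: "P \<in> \<Delta>1" using F1.objects_nonempty by blast
  let ?N = "L1 \<inter> pnormalizer L P"
  note N = normalizer1[OF P]
  have char: "characteristic_p p (group_on L ?N)"
    using assms P N(1) by (auto simp: objective_characteristic_p_def)
  interpret N: group "group_on L ?N" using N(2) by (rule group_on_psubgroup)
  have fin: "finite (carrier (group_on L ?N))"
    using char by (simp add: characteristic_p_def)
  have PL: "P \<subseteq> pcarrier L" using object1D(3)[OF P] L1D(1) by blast
  have ZN: "?Z \<subseteq> ?N"
    using center_subset_normalizer[OF PL] by blast
  have core: "subgroup (p_core p (group_on L ?N)) (group_on L ?N)" "\<exists>n. card (p_core p (group_on L ?N)) = p ^ n"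
    using N.p_core_greatest[OF prime fin] by (auto simp: normal_p_subgroup_def normal_imp_subgroup)
  have "p_core p (group_on L ?N) \<subseteq> L1" using subgroup.subset[OF core(1)] by simp
  then have "z \<cdot> x = x \<cdot> z" if "z \<in> ?Z" "x \<in> p_core p (group_on L ?N)" for z x
    using center_mult(2)[of x z] that by blast
  then have "?Z \<subseteq> centralizer (group_on L ?N) (p_core p (group_on L ?N))"
    using ZN by (auto simp: centralizer_def)
  then have Zc: "?Z \<subseteq> p_core p (group_on L ?N)"
    using char by (auto simp: characteristic_p_def)
  have "subgroup ?Z (group_on L ?N)"
    using psubgroup_center ZN N(2) by (simp add: subgroup_group_on_iff)
  then obtain j where "card ?Z = p ^ j"
    using N.p_subgroup_mono[OF prime _ core(1) Zc] core(2) by blast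
  then show ?thesis
    using p_subgroup_subset_S[OF prime psubgroup_center] center_subset_normalizer[OF S_subset] by blast
qed

end

locale locality_product_center = locality_product +
  assumes center_S: "L1 \<inter> L2 \<subseteq> S"
begin

interpretation F1: locality p "prestrict L L1" \<Delta>1 S1 by (rule sub1)
interpretation F2: locality p "prestrict L L2" \<Delta>2 S2 by (rule sub2)

lemma center_swap: "locality_product_center p L \<Delta> S L2 \<Delta>2 S2 L1 \<Delta>1 S1"
  using swap center_S by (simp add: locality_product_center_def locality_product_center_axioms_def Int_commute)

lemma psubgroup_S1: "psubgroup L S1"
  using F1.psubgroup_S psubgroup_prestrict[OF sub1(1)] by blast

text \<open>An element of \<open>S\<close> has a factorization with factors in \<open>S1\<close> and
  \<open>S2\<close>. Any other first factor differs from that one by a central element, which lies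
  in \<open>S1\<close> by \<open>center_S\<close>.\<close>

lemma proj1_subset_S1:
  assumes "P \<subseteq> S"
  shows "proj1 P \<subseteq> S1"
proof
  fix f assume "f \<in> proj1 P"
  then obtain g where g: "f \<in> L1" "g \<in> L2" "f \<cdot> g \<in> S" using assms by (auto simp: proj1_iff)
  then obtain s t where st: "s \<in> S1" "t \<in> S2" "f \<cdot> g = s \<cdot> t"
    using S_eq set_prod_iff[OF S12_subset(1,2)] by blast
  then obtain z where z: "z \<in> L1 \<inter> L2" "f = s \<cdot> z"
    using factor_unique[of s f t g] g S12_subset by (metis subsetD)
  then have "z \<in> S1" using center_S sub1(2) by blast
  then show "f \<in> S1" using z st(1) psubgroup_mult[OF psubgroup_S1] by blast
qed

lemma proj1_object:
  assumes P: "P \<in> \<Delta>"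
  shows "proj1 P \<in> \<Delta>1"
proof -
  obtain Q1 Q2 where Q: "Q1 \<in> \<Delta>1" "Q2 \<in> \<Delta>2" "Q1 \<star> Q2 \<subseteq> P"
    using P unfolding \<Delta>_eq by blast
  have "x \<in> proj1 P" if x: "x \<in> Q1" for x
  proof -
    have "x \<cdot> pone L \<in> Q1 \<star> Q2"
      using set_prod_iff[OF object1D(3)[OF Q(1)] object2D(3)[OF Q(2)]] x psubgroupD(5)[OF object2D(1)[OF Q(2)]]
      by blast
    then show ?thesis
      using Q(3) x object1D(3)[OF Q(1)] one_L2 by (auto simp: proj1_iff)
  qed
  moreover have "psubgroup (prestrict L L1) (proj1 P)"
    unfolding psubgroup_prestrict[OF sub1(1)]
    using psubgroup_proj1[OF objectD(1)[OF P]] by (auto simp: proj1_iff)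
  ultimately show ?thesis
    using F1.object_overgroup[OF _ proj1_subset_S1[OF objectD(2)[OF P]] Q(1)] by blast
qed

lemma proj2_object:
  assumes P: "P \<in> \<Delta>"
  shows "proj2 P \<in> \<Delta>2"
  by (rule locality_product_center.proj1_object[OF center_swap assms])

end

section \<open>Projections of conjugates and normalizers\<close>

context locality_product
begin

text \<open>Conjugation by \<open>f g\<close> acts on first factors through \<open>f\<close> alone.
  For the inclusion from right to left, a first factor of a conjugate is the conjugate of a first
  factor times a central \<open>z\<close>; this \<open>z\<close> is absorbed, since it lies in
  \<open>proj1 P\<close> and is fixed by \<open>f\<close>.\<close>

lemma proj1_conj:
  assumes f: "f \<in> L1" and g: "g \<in> L2" and P: "P \<subseteq> conj_dom L (f \<cdot> g)" "psubgroup L P"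
  shows "proj1 P \<subseteq> conj_dom L f" "pconj L f ` proj1 P = proj1 (pconj L (f \<cdot> g) ` P)"
proof -
  have fc: "f \<in> pcarrier L" using f L1D(1) by blast
  have dom: "x \<in> conj_dom L f" "y \<in> conj_dom L g" "pconj L (f \<cdot> g) (x \<cdot> y) = pconj L f x \<cdot> pconj L g y"
    "pconj L f x \<in> L1" "pconj L g y \<in> L2" if "x \<in> L1" "y \<in> L2" "x \<cdot> y \<in> P" for x y
    using conj_dom_factors[OF f that(1) g that(2)] P(1) that(3) by auto
  show "proj1 P \<subseteq> conj_dom L f"
    using dom(1) by (auto simp: proj1_iff)
  show "pconj L f ` proj1 P = proj1 (pconj L (f \<cdot> g) ` P)"
  proof (rule equalityI; rule subsetI)
    fix u assume "u \<in> pconj L f ` proj1 P"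
    then obtain x y where xy: "x \<in> L1" "y \<in> L2" "x \<cdot> y \<in> P" "u = pconj L f x" by (auto simp: proj1_iff)
    then show "u \<in> proj1 (pconj L (f \<cdot> g) ` P)"
      using dom[OF xy(1-3)] by (auto simp: proj1_iff intro!: bexI[of _ "pconj L g y"] image_eqI[of _ _ "x \<cdot> y"])
  next
    fix u assume "u \<in> proj1 (pconj L (f \<cdot> g) ` P)"
    then obtain v q where v: "u \<in> L1" "v \<in> L2" "q \<in> P" "u \<cdot> v = pconj L (f \<cdot> g) q" by (auto simp: proj1_iff)
    obtain x y where xy: "x \<in> L1" "y \<in> L2" "q = x \<cdot> y"
      using decomposition[of q] v(3) psubgroupD(1)[OF P(2)] by blast
    note d = dom[OF xy(1,2) v(3)[unfolded xy(3)]]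
    obtain z where z: "z \<in> L1 \<inter> L2" "u = pconj L f x \<cdot> z"
      using factor_unique[OF d(4) v(1) d(5) v(2)] d(3) v(4) xy(3) by metis
    have xz: "x \<cdot> z \<in> proj1 P"
    proof -
      have "x \<in> proj1 P" using v(3) xy by (auto simp: proj1_iff)
      moreover have "z \<in> proj1 P" using center_subset_proj1[OF psubgroupD(5)[OF P(2)]] z(1) by blast
      ultimately show ?thesis using psubgroup_mult[OF psubgroup_proj1[OF P(2)]] by blast
    qed
    have "z \<in> pcarrier L" "f \<cdot> pone L = f" using z(1) L1D(1) one_mult(4)[OF fc] by auto
    then have "pconj L f (x \<cdot> z) = pconj L f x \<cdot> z"
      using conj_mult_factors(2)[OF f xy(1) d(1) one_L2, of z] conj_one[of z] z(1) by auto
    then show "u \<in> pconj L f ` proj1 P" using xz z(2) by (metis image_eqI)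
  qed
qed

lemma proj1_normalizer:
  assumes f: "f \<in> L1" and g: "g \<in> L2" and P: "f \<cdot> g \<in> pnormalizer L P" "psubgroup L P"
  shows "f \<in> pnormalizer L (proj1 P)"
  using proj1_conj[OF f g _ P(2)] P(1) f L1D(1) by (auto simp: pnormalizer_def)

lemma proj2_normalizer:
  assumes f: "f \<in> L1" and g: "g \<in> L2" and P: "f \<cdot> g \<in> pnormalizer L P" "psubgroup L P"
  shows "g \<in> pnormalizer L (proj2 P)"
  using locality_product.proj1_normalizer[OF swap g f _ P(2)] P(1) mult_dom(3)[OF f g] by simp

lemma normalizer_set_prod1:
  assumes "f \<in> L1" "f \<in> pnormalizer L P" "P \<subseteq> L1" "Q \<subseteq> L2"
  shows "f \<in> pnormalizer L (P \<star> Q)"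
  using conj_left_factor[OF assms(1,3) _ assms(4)] assms(2) by (auto simp: pnormalizer_def)

lemma normalizer_set_prod2:
  assumes "g \<in> L2" "g \<in> pnormalizer L Q" "P \<subseteq> L1" "Q \<subseteq> L2"
  shows "g \<in> pnormalizer L (P \<star> Q)"
  using conj_right_factor[OF assms(1,4) _ assms(3)] assms(2) by (auto simp: pnormalizer_def)

lemma proj1_set_prod_eq:
  assumes "psubgroup L P" "P \<subseteq> L1" "Q \<subseteq> L2" "pone L \<in> Q" "L1 \<inter> L2 \<subseteq> P"
  shows "proj1 (P \<star> Q) = P"
proof (rule equalityI; rule subsetI)
  show "x \<in> P" if "x \<in> proj1 (P \<star> Q)" for x
  proof -
    have "x \<in> L1" using that by (simp add: proj1_iff)
    then obtain a z where "a \<in> P" "z \<in> L1 \<inter> L2" "x = a \<cdot> z"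
      using proj1_set_prod[OF assms(2-4), of x] \<open>x \<in> proj1 (P \<star> Q)\<close> by blast
    then show ?thesis using psubgroup_mult[OF assms(1)] assms(5) by blast
  qed
  show "x \<in> proj1 (P \<star> Q)" if "x \<in> P" for x
  proof -
    have "x \<in> L1" "x = x \<cdot> pone L" using that assms(2) L1D(1) one_mult(4) by auto
    then show ?thesis
      using proj1_set_prod[OF assms(2-4)] that one_L1 one_L2 by blast
  qed
qed

text \<open>An element that normalizes a subgroup normalizes its projections, factor by factor.
  Since \<open>P1\<close> and \<open>P2\<close> contain the center, they are the projections of
  their product.\<close>

lemma normalizer_product:
  assumes P1: "P1 \<in> \<Delta>1" "L1 \<inter> L2 \<subseteq> P1" and P2: "P2 \<in> \<Delta>2" "L1 \<inter> L2 \<subseteq> P2"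
  shows "L1 \<inter> pnormalizer L P1 \<subseteq> pnormalizer L (P1 \<star> P2)" "L2 \<inter> pnormalizer L P2 \<subseteq> pnormalizer L (P1 \<star> P2)"
    "x \<in> pnormalizer L (P1 \<star> P2) \<Longrightarrow> \<exists>f\<in>L1 \<inter> pnormalizer L P1. \<exists>g\<in>L2 \<inter> pnormalizer L P2. x = f \<cdot> g"
proof -
  note L = object1D(3)[OF P1(1)] object2D(3)[OF P2(1)]
  show "L1 \<inter> pnormalizer L P1 \<subseteq> pnormalizer L (P1 \<star> P2)" "L2 \<inter> pnormalizer L P2 \<subseteq> pnormalizer L (P1 \<star> P2)"
    using normalizer_set_prod1[OF _ _ L] normalizer_set_prod2[OF _ _ L] by auto
  assume x: "x \<in> pnormalizer L (P1 \<star> P2)"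
  then obtain f g where fg: "f \<in> L1" "g \<in> L2" "x = f \<cdot> g"
    using decomposition[of x] by (auto simp: pnormalizer_def)
  have "proj1 (P1 \<star> P2) = P1"
    using proj1_set_prod_eq[OF object1D(1)[OF P1(1)] L _ P1(2)] psubgroupD(5)[OF object2D(1)[OF P2(1)]] by simp
  moreover have "proj2 (P1 \<star> P2) = P2"
    using locality_product.proj1_set_prod_eq[OF swap object2D(1)[OF P2(1)] L(2,1)] P2(2)
      psubgroupD(5)[OF object1D(1)[OF P1(1)]] set_prod_commute[OF L] by (simp add: Int_commute)
  ultimately have "f \<in> pnormalizer L P1" "g \<in> pnormalizer L P2"
    using proj1_normalizer[OF fg(1,2), of "P1 \<star> P2"] proj2_normalizer[OF fg(1,2), of "P1 \<star> P2"]
      x fg(3) objectD(1)[OF set_prod_object[OF P1(1) P2(1)]] by simp_all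
  then show "\<exists>f\<in>L1 \<inter> pnormalizer L P1. \<exists>g\<in>L2 \<inter> pnormalizer L P2. x = f \<cdot> g"
    using fg by blast
qed

lemma normalizer2:
  assumes "P \<in> \<Delta>2"
  shows "pnormalizer (prestrict L L2) P = L2 \<inter> pnormalizer L P" "psubgroup L (L2 \<inter> pnormalizer L P)"
  using locality_product.normalizer1[OF swap assms] by auto

end

context partial_group
begin

text \<open>Passes from the right conjugation of \<open>pnormalizer\<close> to the left conjugation
  in which normality is stated for groups.\<close>

lemma normalizer_conj_closed:
  assumes M: "psubgroup L M" and g: "g \<in> M" "g \<in> pnormalizer L P" and A: "psubgroup L A" "g \<in> A"
    and P: "P \<subseteq> M" "x \<in> P"
  shows "g \<otimes>\<^bsub>group_on L M\<^esub> x \<otimes>\<^bsub>group_on L M\<^esub> inv\<^bsub>group_on L M\<^esub> g \<in> P"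
proof -
  interpret M: group "group_on L M" using M by (rule group_on_psubgroup)
  have g': "pinv L g \<in> M" "x \<in> M" using psubgroupD(2)[OF M g(1)] P by auto
  have eq: "pconj L (pinv L g) x = g \<otimes>\<^bsub>group_on L M\<^esub> x \<otimes>\<^bsub>group_on L M\<^esub> inv\<^bsub>group_on L M\<^esub> g"
    using pconj_group_on[OF M g'] inv_group_on[OF M g(1)] M.inv_inv[of g] g(1)
    by (simp del: group_on_simps(2))
  have "pconj L g ` P = P" "P \<subseteq> conj_dom L g" "g \<in> pcarrier L"
    using g(2) by (auto simp: pnormalizer_def)
  then have "pconj L (pinv L g) ` P = P"
    using conj_image_inv(2)[of g P] by simp
  then have "pconj L (pinv L g) x \<in> P" using P(2) by blast
  then show ?thesis by (simp only: eq)
qed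

end

context locality_product_center
begin

interpretation F1: locality p "prestrict L L1" \<Delta>1 S1 by (rule sub1)

text \<open>\<open>characteristic_p_in_central_product\<close> requires one finite group around all
  the normalizers. The normalizer \<open>M\<close> of \<open>P1 \<star> P2\<close> serves: it
  contains \<open>K\<close>, the normalizer of \<open>P\<close>, because normalizing
  \<open>P\<close> implies normalizing both projections.\<close>

lemma objective_characteristic_p_product:
  assumes "objective_characteristic_p p (prestrict L L1) \<Delta>1 S1" "objective_characteristic_p p (prestrict L L2) \<Delta>2 S2"
  shows "objective_characteristic_p p L \<Delta> S"
  unfolding objective_characteristic_p_def
proof (intro conjI ballI)
  fix P assume P: "P \<in> \<Delta>"
  define P1 P2 where "P1 = proj1 P" and "P2 = proj2 P"
  have P1: "P1 \<in> \<Delta>1" and P2: "P2 \<in> \<Delta>2"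
    using proj1_object[OF P] proj2_object[OF P] by (auto simp: P1_def P2_def)
  note L = object1D(3)[OF P1] object2D(3)[OF P2]
  note one_P = psubgroupD(5)[OF objectD(1)[OF P]]
  have Z: "L1 \<inter> L2 \<subseteq> P1" "L1 \<inter> L2 \<subseteq> P2"
    using center_subset_proj1[OF one_P] locality_product.center_subset_proj1[OF swap one_P]
    by (auto simp: P1_def P2_def)
  define H where "H = P1 \<star> P2"
  have H: "H \<in> \<Delta>" using set_prod_object[OF P1 P2] by (simp add: H_def)
  have PH: "P \<subseteq> H"
    using subset_proj_product[OF objectD(3)[OF P]] by (simp add: H_def P1_def P2_def)
  define M A B K where "M = pnormalizer L H" and "A = L1 \<inter> pnormalizer L P1" and "B = L2 \<inter> pnormalizer L P2"
    and "K = pnormalizer L P"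
  have M: "psubgroup L M" and K: "psubgroup L K"
    using psubgroup_normalizer[OF H] psubgroup_normalizer[OF P] by (auto simp: M_def K_def)
  note np = normalizer_product[OF P1 Z(1) P2 Z(2), folded H_def, folded M_def A_def B_def]
  have AB: "psubgroup L A" "psubgroup L B"
    using normalizer1(2)[OF P1] normalizer2(2)[OF P2] by (auto simp: A_def B_def)
  have HM: "H \<subseteq> M" using object_normalizes_self[OF H] by (simp add: M_def)
  have P1A: "P1 \<subseteq> A" and P2B: "P2 \<subseteq> B"
    using F1.object_normalizes_self[OF P1] normalizer1(1)[OF P1] A_def
      locality.object_normalizes_self[OF sub2(3) P2] normalizer2(1)[OF P2] B_def by auto
  have KM: "\<exists>f\<in>A. \<exists>g\<in>B. x = f \<cdot> g" if x: "x \<in> K" for x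
  proof -
    obtain f g where fg: "f \<in> L1" "g \<in> L2" "x = f \<cdot> g"
      using decomposition[of x] x psubgroupD(1)[OF K] by blast
    have "f \<in> A" "g \<in> B"
      using proj1_normalizer[OF fg(1,2) _ objectD(1)[OF P]] proj2_normalizer[OF fg(1,2) _ objectD(1)[OF P]]
        fg x by (auto simp: A_def B_def K_def P1_def P2_def)
    then show ?thesis using fg by blast
  qed
  have KM': "K \<subseteq> M"
    using KM np(1,2) psubgroup_mult[OF M] by blast
  interpret M: group "group_on L M" using M by (rule group_on_psubgroup)
  have fin: "finite (carrier (group_on L M))"
    using psubgroupD(1)[OF M] finite_pcarrier by (auto intro: finite_subset)
  have sub: "subgroup A (group_on L M)" "subgroup B (group_on L M)" "subgroup K (group_on L M)"
    using AB K KM' np(1,2) M by (simp_all add: subgroup_group_on_iff)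
  have "subgroup (A \<inter> B) (group_on L M)" using M.subgroups_Inter_pair[OF sub(1,2)] .
  then have "psubgroup L (A \<inter> B)" using M by (simp add: subgroup_group_on_iff)
  \<comment> \<open>The intersection consists of central elements of \<open>L\<close>, so it lies in
    \<open>S\<close>; this is what makes its order a power of \<open>p\<close>.\<close>
  moreover have "A \<inter> B \<subseteq> S" using center_S by (auto simp: A_def B_def)
  ultimately have "subgroup (A \<inter> B) (group_on L S)" "subgroup S (group_on L S)"
    using psubgroup_S by (simp_all add: subgroup_group_on_iff)
  then obtain i where i: "card (A \<inter> B) = p ^ i"
    using group.p_subgroup_mono[OF group_on_psubgroup[OF psubgroup_S] prime _ _ \<open>A \<inter> B \<subseteq> S\<close>] prime_power_S
    by blast
  have "characteristic_p p (group_on L M\<lparr>carrier := K\<rparr>)"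
  proof (rule M.characteristic_p_in_central_product[OF prime fin sub(1,2,3) _ _ i P1A P2B])
    show "g \<otimes>\<^bsub>group_on L M\<^esub> h = h \<otimes>\<^bsub>group_on L M\<^esub> g" if "g \<in> A" "h \<in> B" for g h
      using mult_dom(3)[of g h] that by (simp add: A_def B_def)
    show "\<exists>g\<in>A. \<exists>h\<in>B. k = g \<otimes>\<^bsub>group_on L M\<^esub> h" if "k \<in> K" for k
      using KM[OF that] by simp
    show "g \<otimes>\<^bsub>group_on L M\<^esub> a \<otimes>\<^bsub>group_on L M\<^esub> inv\<^bsub>group_on L M\<^esub> g \<in> P1" if "g \<in> A" "a \<in> P1" for g a
      using normalizer_conj_closed[OF M _ _ AB(1)] that np(1) P1A A_def by blast
    show "g \<otimes>\<^bsub>group_on L M\<^esub> a \<otimes>\<^bsub>group_on L M\<^esub> inv\<^bsub>group_on L M\<^esub> g \<in> P2" if "g \<in> B" "a \<in> P2" for g a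
      using normalizer_conj_closed[OF M _ _ AB(2)] that np(2) P2B B_def by blast
    show "\<exists>b\<in>P2. a \<otimes>\<^bsub>group_on L M\<^esub> b \<in> P" if "a \<in> P1" for a
      using that proj1_mem(2)[OF objectD(1)[OF P]] unfolding P1_def P2_def proj1_iff group_on_simps by blast
    show "\<exists>a\<in>P1. a \<otimes>\<^bsub>group_on L M\<^esub> b \<in> P" if "b \<in> P2" for b
      using that proj1_mem(1)[OF objectD(1)[OF P]] unfolding P1_def P2_def proj2_iff group_on_simps by blast
    show "normal_p_subgroup p (group_on L M\<lparr>carrier := K\<rparr>) P"
      using object_normal[OF P K _ _ prime] object_normalizes_self[OF P] by (simp add: K_def)
    show "\<exists>a\<in>P1. \<exists>b\<in>P2. x = a \<otimes>\<^bsub>group_on L M\<^esub> b" if "x \<in> P" for x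
      using PH that set_prod_iff[OF L] by (auto simp: H_def)
    show "centralizer (group_on L M) P \<subseteq> K"
      using commuting_in_normalizer[OF M _ , of P] PH HM by (auto simp: centralizer_def K_def)
    show "characteristic_p p (group_on L M\<lparr>carrier := A\<rparr>)" "characteristic_p p (group_on L M\<lparr>carrier := B\<rparr>)"
      using assms P1 P2 normalizer1(1)[OF P1] normalizer2(1)[OF P2]
      by (auto simp: objective_characteristic_p_def A_def B_def)
  qed
  then show "characteristic_p p (group_on L (pnormalizer L P))"
    by (simp add: K_def)
qed (rule locality_axioms)

text \<open>\<open>Q1\<close> is completed by an arbitrary object \<open>Q2\<close> of the second
  factor. The projection \<open>P1\<close> of their product is \<open>Q1\<close> times the center,
  and \<open>Q1\<close> and \<open>P1\<close> take the places of \<open>Q\<close> and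
  \<open>P\<close> in \<open>characteristic_p_central_factor\<close>, inside the normalizer of
  \<open>P1 \<star> P2\<close>.\<close>

lemma objective_characteristic_p_factor1:
  assumes "objective_characteristic_p p L \<Delta> S"
  shows "objective_characteristic_p p (prestrict L L1) \<Delta>1 S1"
  unfolding objective_characteristic_p_def
proof (intro conjI ballI)
  fix Q1 assume Q1: "Q1 \<in> \<Delta>1"
  obtain Q2 where Q2: "Q2 \<in> \<Delta>2" using locality.objects_nonempty[OF sub2(3)] by blast
  define P where "P = Q1 \<star> Q2"
  have P: "P \<in> \<Delta>" using set_prod_object[OF Q1 Q2] by (simp add: P_def)
  note LQ = object1D(3)[OF Q1] object2D(3)[OF Q2]
  define P1 P2 where "P1 = proj1 P" and "P2 = proj2 P"
  have P1: "P1 \<in> \<Delta>1" and P2: "P2 \<in> \<Delta>2"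
    using proj1_object[OF P] proj2_object[OF P] by (auto simp: P1_def P2_def)
  note L = object1D(3)[OF P1] object2D(3)[OF P2]
  note one_P = psubgroupD(5)[OF objectD(1)[OF P]]
  have Z: "L1 \<inter> L2 \<subseteq> P1" "L1 \<inter> L2 \<subseteq> P2"
    using center_subset_proj1[OF one_P] locality_product.center_subset_proj1[OF swap one_P]
    by (auto simp: P1_def P2_def)
  note one_Q2 = psubgroupD(5)[OF object2D(1)[OF Q2]]
  have P1_iff: "x \<in> P1 \<longleftrightarrow> (\<exists>a\<in>Q1. \<exists>z\<in>L1 \<inter> L2. x = a \<cdot> z)" if "x \<in> L1" for x
    using proj1_set_prod[OF LQ one_Q2 that] by (simp add: P1_def P_def)
  have Q1P1: "Q1 \<subseteq> P1"
  proof
    fix x assume "x \<in> Q1"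
    then have "x \<in> L1" "x = x \<cdot> pone L" using LQ(1) L1D(1) one_mult(4) by auto
    then show "x \<in> P1" using P1_iff \<open>x \<in> Q1\<close> one_L1 one_L2 by blast
  qed
  define H where "H = P1 \<star> P2"
  have H: "H \<in> \<Delta>" using set_prod_object[OF P1 P2] by (simp add: H_def)
  define M A B K where "M = pnormalizer L H" and "A = L1 \<inter> pnormalizer L P1" and "B = L2 \<inter> pnormalizer L P2"
    and "K = L1 \<inter> pnormalizer L Q1"
  have M: "psubgroup L M" and K: "psubgroup L K"
    using psubgroup_normalizer[OF H] normalizer1(2)[OF Q1] by (auto simp: M_def K_def)
  note np = normalizer_product[OF P1 Z(1) P2 Z(2), folded H_def, folded M_def A_def B_def]
  have AB: "psubgroup L A" "psubgroup L B"
    using normalizer1(2)[OF P1] normalizer2(2)[OF P2] by (auto simp: A_def B_def)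
  have P1A: "P1 \<subseteq> A"
    using F1.object_normalizes_self[OF P1] normalizer1(1)[OF P1] A_def by auto
  have Q1K: "Q1 \<subseteq> K"
    using F1.object_normalizes_self[OF Q1] normalizer1(1)[OF Q1] K_def by auto
  have KA: "K \<subseteq> A"
  proof
    fix f assume "f \<in> K"
    then have f: "f \<in> L1" "f \<in> pnormalizer L Q1" by (auto simp: K_def)
    have "f \<cdot> pone L = f" using one_mult(4) f(1) L1D(1) by blast
    then have "f \<in> pnormalizer L (proj1 P)"
      using proj1_normalizer[OF f(1) one_L2 _ objectD(1)[OF P]] normalizer_set_prod1[OF f LQ]
      by (simp add: P_def)
    then show "f \<in> A" using f by (simp add: A_def P1_def)
  qed
  interpret M: group "group_on L M" using M by (rule group_on_psubgroup)
  have fin: "finite (carrier (group_on L M))"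
    using psubgroupD(1)[OF M] finite_pcarrier by (auto intro: finite_subset)
  have sub: "subgroup A (group_on L M)" "subgroup B (group_on L M)" "subgroup K (group_on L M)"
    using AB K KA np(1,2) M by (auto simp add: subgroup_group_on_iff)
  have "characteristic_p p (group_on L M\<lparr>carrier := K\<rparr>)"
  proof (rule M.characteristic_p_central_factor[OF prime fin _ sub(1,2,3) KA _ _ _ _ _ _ Q1P1])
    show "characteristic_p p (group_on L M)"
      using assms H by (auto simp: objective_characteristic_p_def M_def)
    show "g \<otimes>\<^bsub>group_on L M\<^esub> h = h \<otimes>\<^bsub>group_on L M\<^esub> g" if "g \<in> A" "h \<in> B" for g h
      using mult_dom(3)[of g h] that by (simp add: A_def B_def)
    show "\<exists>g\<in>A. \<exists>h\<in>B. x = g \<otimes>\<^bsub>group_on L M\<^esub> h" if "x \<in> carrier (group_on L M)" for x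
      using np(3) that by simp
    show "normal_p_subgroup p (group_on L M\<lparr>carrier := K\<rparr>) Q1"
      using F1.object_normal[OF Q1 _ _ _ prime, of K] Q1K K normalizer1(1)[OF Q1]
        psubgroup_prestrict[OF sub1(1), of K] by (simp add: K_def)
    show "A \<inter> centralizer (group_on L M) Q1 \<subseteq> K"
    proof
      fix x assume x: "x \<in> A \<inter> centralizer (group_on L M) Q1"
      have "Q1 \<subseteq> M" using Q1K KA np(1) by blast
      then have "x \<in> pnormalizer L Q1"
        using x by (intro commuting_in_normalizer[OF M]) (auto simp: centralizer_def)
      then show "x \<in> K" using x by (simp add: K_def A_def)
    qed
    show "P1 \<subseteq> A" by (rule P1A)
    show "\<exists>a\<in>Q1. \<exists>b\<in>A \<inter> B. x = a \<otimes>\<^bsub>group_on L M\<^esub> b" if x: "x \<in> P1" for x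
    proof -
      have "x \<in> L1" using x L by blast
      then obtain a z where az: "a \<in> Q1" "z \<in> L1 \<inter> L2" "x = a \<cdot> z" using P1_iff x by blast
      moreover have "z \<in> A \<inter> B"
        using az(2) center_subset_normalizer[OF order.trans[OF L(1) L1D(1)]]
          center_subset_normalizer[OF order.trans[OF L(2) L2D(1)]]
        by (auto simp: A_def B_def)
      ultimately show ?thesis by auto
    qed
    show "g \<otimes>\<^bsub>group_on L M\<^esub> a \<otimes>\<^bsub>group_on L M\<^esub> inv\<^bsub>group_on L M\<^esub> g \<in> P1" if "g \<in> A" "a \<in> P1" for g a
      using normalizer_conj_closed[OF M _ _ AB(1)] that np(1) P1A A_def by blast
  qed
  then show "characteristic_p p (group_on (prestrict L L1) (pnormalizer (prestrict L L1) Q1))"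
    using normalizer1(1)[OF Q1] by (simp add: K_def)
qed (rule sub1)

end

section \<open>Fusion systems\<close>

context fusion_system
begin

lemma identity_morphism:
  assumes "subgroup P G" "subgroup Q G" "P \<subseteq> Q"
  shows "restrict (\<lambda>x. x) P \<in> F P Q"
proof -
  have "conj_map G P \<one> = restrict (\<lambda>x. x) P"
    using subgroup.mem_carrier[OF assms(1)] by (auto simp: conj_map_def)
  then show ?thesis
    using inner[OF assms(1,2) one_closed] assms(3) by auto
qed

lemma restrict_morphism:
  assumes "\<phi> \<in> F A B" "subgroup P G" "P \<subseteq> A"
  shows "restrict \<phi> P \<in> F P B"
proof -
  have "compose P \<phi> (restrict (\<lambda>x. x) P) \<in> F P B"
    using comp[OF identity_morphism assms(1)] objects[OF assms(1)] assms(2,3) by blast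
  moreover have "compose P \<phi> (restrict (\<lambda>x. x) P) = restrict \<phi> P"
    by (auto simp: compose_def fun_eq_iff)
  ultimately show ?thesis by simp
qed

lemma morphismD:
  assumes "\<phi> \<in> F P Q"
  shows "\<phi> ` P \<subseteq> Q" "inj_on \<phi> P" "\<phi> \<in> extensional P" "\<lbrakk>x \<in> P; y \<in> P\<rbrakk> \<Longrightarrow> \<phi> (x \<otimes> y) = \<phi> x \<otimes> \<phi> y"
    "subgroup P G" "subgroup Q G"
  using injective_hom[OF assms] objects[OF assms] by (auto simp: hom_def)

lemma finite_object:
  assumes "subgroup P G"
  shows "finite P"
  using finite_carrier subgroup.subset[OF assms] by (rule rev_finite_subset)

lemma automorphism_image:
  assumes "\<phi> \<in> F P P"
  shows "\<phi> ` P = P"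
  using morphismD[OF assms] finite_object endo_inj_surj by blast

lemma automorphism_Bij: "F P P \<subseteq> Bij P"
proof
  fix \<phi> assume "\<phi> \<in> F P P"
  then show "\<phi> \<in> Bij P"
    using morphismD(2,3)[of \<phi> P P] automorphism_image[of \<phi> P] by (simp add: Bij_def bij_betw_def)
qed

lemma subgroup_automorphisms:
  assumes P: "subgroup P G"
  shows "subgroup (F P P) (BijGroup P)"
proof -
  interpret B: group "BijGroup P" by (rule group_BijGroup)
  show ?thesis
  proof (rule B.subgroupI)
    show "F P P \<subseteq> carrier (BijGroup P)" using automorphism_Bij by (simp add: BijGroup_def)
    show "F P P \<noteq> {}" using identity_morphism[OF P P] by blast
    show "inv\<^bsub>BijGroup P\<^esub> \<phi> \<in> F P P" if \<phi>: "\<phi> \<in> F P P" for \<phi>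
    proof -
      have "restrict (inv_into P \<phi>) P \<in> F P P"
        using iso_onto_image[OF \<phi>] automorphism_image[OF \<phi>] by simp
      moreover have "inv\<^bsub>BijGroup P\<^esub> \<phi> = restrict (inv_into P \<phi>) P"
        using inv_BijGroup automorphism_Bij \<phi> by (metis subsetD)
      ultimately show ?thesis by simp
    qed
    show "\<phi> \<otimes>\<^bsub>BijGroup P\<^esub> \<psi> \<in> F P P" if "\<phi> \<in> F P P" "\<psi> \<in> F P P" for \<phi> \<psi>
      using comp[OF that(2,1)] that automorphism_Bij[of P] by (auto simp: BijGroup_def)
  qed
qed

lemma group_Aut_fus:
  assumes "subgroup P G"
  shows "group (Aut_fus F P)"
  unfolding Aut_fus_def
  by (rule group.subgroup_imp_group[OF group_BijGroup subgroup_automorphisms[OF assms]])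

lemma Aut_fus_simps:
  "carrier (Aut_fus F P) = F P P" "\<one>\<^bsub>Aut_fus F P\<^esub> = restrict (\<lambda>x. x) P"
  "\<lbrakk>\<phi> \<in> F P P; \<psi> \<in> F P P\<rbrakk> \<Longrightarrow> \<phi> \<otimes>\<^bsub>Aut_fus F P\<^esub> \<psi> = compose P \<phi> \<psi>"
  using automorphism_Bij[of P] by (auto simp: Aut_fus_def BijGroup_def)

lemma finite_Aut_fus:
  assumes "subgroup P G"
  shows "finite (carrier (Aut_fus F P))"
proof -
  have "F P P \<subseteq> P \<rightarrow>\<^sub>E P"
  proof
    fix \<phi> assume "\<phi> \<in> F P P"
    then show "\<phi> \<in> P \<rightarrow>\<^sub>E P"
      using morphismD(1,3)[of \<phi> P P] by (auto simp: PiE_def)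
  qed
  then show ?thesis
    using finite_object[OF assms] by (auto simp: Aut_fus_simps intro: finite_subset finite_PiE)
qed

lemma conj_map_automorphism:
  assumes "subgroup P G" "g \<in> carrier G" "\<And>a. a \<in> P \<Longrightarrow> inv g \<otimes> a \<otimes> g \<in> P"
  shows "conj_map G P g \<in> F P P"
  using inner[OF assms(1,1,2)] assms(3) by (auto simp: conj_map_def)

text \<open>The order is reversed: \<open>conj_map\<close> is right conjugation, while automorphisms
  are composed as functions written on the left.\<close>

lemma conj_map_mult:
  assumes P: "subgroup P G" and g: "g \<in> carrier G" "\<And>a. a \<in> P \<Longrightarrow> inv g \<otimes> a \<otimes> g \<in> P"
    and h: "h \<in> carrier G" "\<And>a. a \<in> P \<Longrightarrow> inv h \<otimes> a \<otimes> h \<in> P"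
  shows "conj_map G P h \<otimes>\<^bsub>Aut_fus F P\<^esub> conj_map G P g = conj_map G P (g \<otimes> h)"
proof -
  have "conj_map G P h \<otimes>\<^bsub>Aut_fus F P\<^esub> conj_map G P g = compose P (conj_map G P h) (conj_map G P g)"
    using conj_map_automorphism[OF P g] conj_map_automorphism[OF P h] by (simp add: Aut_fus_simps)
  also have "\<dots> = conj_map G P (g \<otimes> h)"
    using g h subgroup.mem_carrier[OF P]
    by (auto simp: conj_map_def compose_def fun_eq_iff inv_mult_group m_assoc)
  finally show ?thesis .
qed

lemma conj_map_one:
  assumes "subgroup P G"
  shows "conj_map G P \<one> = \<one>\<^bsub>Aut_fus F P\<^esub>"
  using subgroup.mem_carrier[OF assms] by (auto simp: conj_map_def Aut_fus_simps)

lemma conj_map_pow: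
  assumes P: "subgroup P G" and X: "subgroup X G" "\<And>x a. x \<in> X \<Longrightarrow> a \<in> P \<Longrightarrow> inv x \<otimes> a \<otimes> x \<in> P"
    and g: "g \<in> X"
  shows "conj_map G P g [^]\<^bsub>Aut_fus F P\<^esub> (n::nat) = conj_map G P (g [^] n) \<and> g [^] n \<in> X"
proof (induction n)
  case 0
  then show ?case using conj_map_one[OF P] subgroup.one_closed[OF X(1)] by simp
next
  case (Suc n)
  interpret X: subgroup X G by fact
  have "g \<otimes> g [^] n = g [^] Suc n"
    using nat_pow_Suc2[of g n] g by simp
  then show ?case
    using Suc conj_map_mult[OF P, of g "g [^] n"] X(2) g X.m_closed[OF g] by auto
qed

lemma morphism_inv:
  assumes "\<phi> \<in> F P Q" "g \<in> P"
  shows "\<phi> \<one> = \<one>" "\<phi> (inv g) = inv (\<phi> g)"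
proof -
  note \<phi> = morphismD[OF assms(1)]
  interpret P: subgroup P G by (rule \<phi>(5))
  interpret Q: subgroup Q G by (rule \<phi>(6))
  have im: "\<phi> x \<in> carrier G" if "x \<in> P" for x using \<phi>(1) Q.subset that by blast
  show one: "\<phi> \<one> = \<one>"
    using \<phi>(4)[of \<one> \<one>] im[OF P.one_closed] by simp
  then have "\<phi> (inv g) \<otimes> \<phi> g = \<one>"
    using \<phi>(4)[of "inv g" g] assms(2) by simp
  then show "\<phi> (inv g) = inv (\<phi> g)"
    using im assms(2) by (intro inv_equality[symmetric]) auto
qed

text \<open>Conjugating the map \<open>c_g\<close> by \<open>\<phi>\<close> gives the map induced by
  \<open>\<psi> g\<close>. The extension \<open>\<psi>\<close> allows \<open>g\<close> to lie
  outside \<open>P\<close>; for \<open>Q = P\<close> and \<open>\<psi> = \<phi>\<close> this is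
  normality of the inner automorphisms.\<close>

lemma automorphism_conj_map:
  assumes \<phi>: "\<phi> \<in> F P P" and \<psi>: "\<psi> \<in> F Q Q" "P \<subseteq> Q" "\<And>a. a \<in> P \<Longrightarrow> \<psi> a = \<phi> a" and g: "g \<in> Q"
    and norm: "\<And>a. a \<in> P \<Longrightarrow> inv g \<otimes> a \<otimes> g \<in> P"
  shows "a \<in> P \<Longrightarrow> \<psi> (inv g \<otimes> a \<otimes> g) = inv (\<psi> g) \<otimes> \<psi> a \<otimes> \<psi> g"
    and "\<And>a. a \<in> P \<Longrightarrow> inv (\<psi> g) \<otimes> a \<otimes> \<psi> g \<in> P"
    and "\<phi> \<otimes>\<^bsub>Aut_fus F P\<^esub> conj_map G P g = conj_map G P (\<psi> g) \<otimes>\<^bsub>Aut_fus F P\<^esub> \<phi>"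
proof -
  note \<phi>' = morphismD[OF \<phi>] and \<psi>' = morphismD[OF \<psi>(1)]
  interpret Q: subgroup Q G by (rule \<psi>'(5))
  have gc: "g \<in> carrier G" "\<psi> g \<in> carrier G" using g \<psi>'(1) Q.subset by auto
  have conj: "\<psi> (inv g \<otimes> a \<otimes> g) = inv (\<psi> g) \<otimes> \<psi> a \<otimes> \<psi> g" if "a \<in> P" for a
    using that g \<psi>(2) \<psi>'(4)[of "inv g \<otimes> a" g] \<psi>'(4)[of "inv g" a] morphism_inv(2)[OF \<psi>(1) g] by auto
  then show "a \<in> P \<Longrightarrow> \<psi> (inv g \<otimes> a \<otimes> g) = inv (\<psi> g) \<otimes> \<psi> a \<otimes> \<psi> g" .
  show norm': "inv (\<psi> g) \<otimes> a \<otimes> \<psi> g \<in> P" if "a \<in> P" for a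
  proof -
    have "a \<in> \<phi> ` P" using automorphism_image[OF \<phi>] that by simp
    then obtain b where "b \<in> P" "a = \<phi> b" by blast
    then have b: "b \<in> P" "a = \<psi> b" using \<psi>(3) by simp_all
    then have "inv (\<psi> g) \<otimes> a \<otimes> \<psi> g = \<phi> (inv g \<otimes> b \<otimes> g)"
      using conj[OF b(1)] \<psi>(3)[OF norm[OF b(1)]] by simp
    then show ?thesis using \<phi>'(1) norm[OF b(1)] by auto
  qed
  have "\<phi> \<otimes>\<^bsub>Aut_fus F P\<^esub> conj_map G P g = compose P \<phi> (conj_map G P g)"
    using conj_map_automorphism[OF \<phi>'(5) gc(1) norm] \<phi> by (simp add: Aut_fus_simps)
  also have "\<dots> = compose P (conj_map G P (\<psi> g)) \<phi>"
  proof
    fix a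
    show "compose P \<phi> (conj_map G P g) a = compose P (conj_map G P (\<psi> g)) \<phi> a"
    proof (cases "a \<in> P")
      case True
      have "\<phi> a \<in> P" using \<phi>'(1) True by blast
      then show ?thesis
        using conj[OF True] \<psi>(3)[OF norm[OF True]] \<psi>(3)[OF True] True
        by (simp add: compose_def conj_map_def)
    qed (simp add: compose_def)
  qed
  also have "\<dots> = conj_map G P (\<psi> g) \<otimes>\<^bsub>Aut_fus F P\<^esub> \<phi>"
    using conj_map_automorphism[OF \<phi>'(5) gc(2) norm'] \<phi> by (simp add: Aut_fus_simps)
  finally show "\<phi> \<otimes>\<^bsub>Aut_fus F P\<^esub> conj_map G P g = conj_map G P (\<psi> g) \<otimes>\<^bsub>Aut_fus F P\<^esub> \<phi>" .
qed

text \<open>Stated for a p-subgroup \<open>X\<close> normalizing \<open>P\<close>, to cover both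
  \<open>X = P\<close> in \<open>radical_iff\<close> and the normalizer of \<open>P\<close> in a
  larger subgroup.\<close>

lemma normal_p_subgroup_conj_maps:
  assumes p: "prime p" and P: "subgroup P G" and X: "subgroup X G" "card X = p ^ i"
    and norm: "\<And>x a. x \<in> X \<Longrightarrow> a \<in> P \<Longrightarrow> inv x \<otimes> a \<otimes> x \<in> P"
    and act: "\<And>\<phi> x. \<phi> \<in> F P P \<Longrightarrow> x \<in> X \<Longrightarrow>
      \<exists>y\<in>X. \<phi> \<otimes>\<^bsub>Aut_fus F P\<^esub> conj_map G P x = conj_map G P y \<otimes>\<^bsub>Aut_fus F P\<^esub> \<phi>"
  shows "normal_p_subgroup p (Aut_fus F P) (conj_map G P ` X)"
proof -
  interpret A: group "Aut_fus F P" using P by (rule group_Aut_fus)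
  interpret X: subgroup X G by fact
  have cm: "conj_map G P x \<in> F P P" if "x \<in> X" for x
    by (rule conj_map_automorphism[OF P X.mem_carrier[OF that] norm[OF that]])
  have mult: "conj_map G P h \<otimes>\<^bsub>Aut_fus F P\<^esub> conj_map G P g = conj_map G P (g \<otimes> h)" if "g \<in> X" "h \<in> X" for g h
    by (rule conj_map_mult[OF P X.mem_carrier[OF that(1)] norm[OF that(1)] X.mem_carrier[OF that(2)] norm[OF that(2)]])
  have sub: "subgroup (conj_map G P ` X) (Aut_fus F P)"
  proof (rule A.subgroupI)
    show "conj_map G P ` X \<subseteq> carrier (Aut_fus F P)" using cm by (auto simp: Aut_fus_simps)
    show "conj_map G P ` X \<noteq> {}" using X.one_closed by blast
    fix \<phi> assume "\<phi> \<in> conj_map G P ` X"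
    then obtain g where g: "g \<in> X" "\<phi> = conj_map G P g" by blast
    have "conj_map G P (inv g) \<otimes>\<^bsub>Aut_fus F P\<^esub> conj_map G P g = \<one>\<^bsub>Aut_fus F P\<^esub>"
      using mult[of g "inv g"] g conj_map_one[OF P] by simp
    then have "inv\<^bsub>Aut_fus F P\<^esub> \<phi> = conj_map G P (inv g)"
      using g cm by (intro A.inv_equality) (auto simp: Aut_fus_simps)
    then show "inv\<^bsub>Aut_fus F P\<^esub> \<phi> \<in> conj_map G P ` X" using g by simp
    fix \<psi> assume "\<psi> \<in> conj_map G P ` X"
    then obtain h where h: "h \<in> X" "\<psi> = conj_map G P h" by blast
    have "\<phi> \<otimes>\<^bsub>Aut_fus F P\<^esub> \<psi> = conj_map G P (h \<otimes> g)" using mult[of h g] g h by simp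
    then show "\<phi> \<otimes>\<^bsub>Aut_fus F P\<^esub> \<psi> \<in> conj_map G P ` X" using g h by simp
  qed
  have fX: "finite X" using finite_object[OF X(1)] .
  have "\<exists>k::nat. \<phi> [^]\<^bsub>Aut_fus F P\<^esub> (p ^ k) = \<one>\<^bsub>Aut_fus F P\<^esub>" if "\<phi> \<in> conj_map G P ` X" for \<phi>
  proof -
    obtain g where g: "g \<in> X" "\<phi> = conj_map G P g" using \<open>\<phi> \<in> conj_map G P ` X\<close> by blast
    have "g [^] (p ^ i) = \<one>" using pow_card_subgroup[OF X(1) fX g(1)] X(2) by simp
    then show ?thesis
      using conj_map_pow[OF P X(1) norm g(1), of "p ^ i"] conj_map_one[OF P] g(2) by auto
  qed
  then have "\<exists>n. card (conj_map G P ` X) = p ^ n"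
    using A.card_prime_power_iff[OF p sub] fX by blast
  moreover have "\<phi> \<otimes>\<^bsub>Aut_fus F P\<^esub> c \<otimes>\<^bsub>Aut_fus F P\<^esub> inv\<^bsub>Aut_fus F P\<^esub> \<phi> \<in> conj_map G P ` X"
    if \<phi>: "\<phi> \<in> carrier (Aut_fus F P)" and c: "c \<in> conj_map G P ` X" for \<phi> c
  proof -
    obtain g where g: "g \<in> X" "c = conj_map G P g" using c by blast
    obtain y where y: "y \<in> X" "\<phi> \<otimes>\<^bsub>Aut_fus F P\<^esub> conj_map G P g = conj_map G P y \<otimes>\<^bsub>Aut_fus F P\<^esub> \<phi>"
      using act[OF _ g(1)] \<phi> by (auto simp: Aut_fus_simps)
    have "conj_map G P y \<in> carrier (Aut_fus F P)" using cm[OF y(1)] by (simp add: Aut_fus_simps)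
    then have "\<phi> \<otimes>\<^bsub>Aut_fus F P\<^esub> c \<otimes>\<^bsub>Aut_fus F P\<^esub> inv\<^bsub>Aut_fus F P\<^esub> \<phi> = conj_map G P y"
      using y(2) g(2) \<phi> by simp
    then show ?thesis using y(1) by simp
  qed
  ultimately show ?thesis
    using sub unfolding normal_p_subgroup_def A.normal_inv_iff by blast
qed

text \<open>The inner automorphisms always form a normal p-subgroup of \<open>Aut(P)\<close>, so
  radicality is a matter of the opposite inclusion.\<close>

lemma radical_iff:
  assumes p: "prime p" and P: "subgroup P G" "card P = p ^ i"
  shows "radical p G F P \<longleftrightarrow> (\<forall>N. normal_p_subgroup p (Aut_fus F P) N \<longrightarrow> N \<subseteq> conj_map G P ` P)"
proof -
  interpret A: group "Aut_fus F P" using P(1) by (rule group_Aut_fus)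
  note core = A.p_core_greatest[OF p finite_Aut_fus[OF P(1)]]
  have "normal_p_subgroup p (Aut_fus F P) (conj_map G P ` P)"
  proof (rule normal_p_subgroup_conj_maps[OF p P(1) P])
    show norm: "inv x \<otimes> a \<otimes> x \<in> P" if "x \<in> P" "a \<in> P" for x a
      using that P(1) by (simp add: subgroup.m_closed subgroup.m_inv_closed)
    show "\<exists>y\<in>P. \<phi> \<otimes>\<^bsub>Aut_fus F P\<^esub> conj_map G P x = conj_map G P y \<otimes>\<^bsub>Aut_fus F P\<^esub> \<phi>"
      if "\<phi> \<in> F P P" "x \<in> P" for \<phi> x
      using automorphism_conj_map(3)[OF that(1,1) order.refl refl that(2) norm[OF that(2)]]
        morphismD(1)[OF that(1)] that(2) by blast
  qed
  then show ?thesis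
    unfolding radical_def using core by blast
qed

end

text \<open>Every step of a chain is the restriction of a generator of \<open>locality_fusion\<close>. The source of that
  generator is an object, but the subgroups along the chain need not be objects.\<close>

fun fusion_chain :: "'a partial_structure \<Rightarrow> 'a set set \<Rightarrow> 'a set \<Rightarrow> 'a set \<Rightarrow> 'a list \<Rightarrow> bool" where
  "fusion_chain L \<Delta> S P [] \<longleftrightarrow> True"
| "fusion_chain L \<Delta> S P (g # w) \<longleftrightarrow>
     (\<exists>A\<in>\<Delta>. P \<subseteq> A \<and> g \<in> pcarrier L \<and> A \<subseteq> conj_dom L g \<and> pconj L g ` A \<subseteq> S) \<and>
     fusion_chain L \<Delta> S (pconj L g ` P) w"

text \<open>An explicit form of the generated fusion system, since an intersection over all fusion
  systems gives no hold on single morphisms. The image only has to lie in \<open>Q\<close>, because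
  inclusions are morphisms.\<close>

definition chain_fusion :: "'a partial_structure \<Rightarrow> 'a set set \<Rightarrow> 'a set \<Rightarrow> 'a morphism_sets" where
  "chain_fusion L \<Delta> S P Q = {restrict (conj_word L w) P |w. fusion_chain L \<Delta> S P w \<and>
     psubgroup L P \<and> P \<subseteq> S \<and> psubgroup L Q \<and> Q \<subseteq> S \<and> conj_word L w ` P \<subseteq> Q}"

lemma fusion_chain_append:
  "fusion_chain L \<Delta> S P (u @ v) \<longleftrightarrow> fusion_chain L \<Delta> S P u \<and> fusion_chain L \<Delta> S (conj_word L u ` P) v"
  by (induction u arbitrary: P) (auto simp: image_image)

lemma fusion_chain_mono:
  "fusion_chain L \<Delta> S P w \<Longrightarrow> Q \<subseteq> P \<Longrightarrow> fusion_chain L \<Delta> S Q w"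
proof (induction w arbitrary: P Q)
  case (Cons g w)
  then obtain A where "A \<in> \<Delta>" "P \<subseteq> A" "g \<in> pcarrier L" "A \<subseteq> conj_dom L g" "pconj L g ` A \<subseteq> S"
    by auto
  moreover from this have "Q \<subseteq> A" using Cons.prems(2) by simp
  moreover have "fusion_chain L \<Delta> S (pconj L g ` Q) w"
    using Cons.IH[of "pconj L g ` P" "pconj L g ` Q"] Cons.prems by (simp add: image_mono)
  ultimately show ?case by auto
qed simp

section \<open>The fusion system of a locality in terms of chains\<close>

context locality
begin

lemma group_S: "group (group_on L S)"
  using psubgroup_S by (rule group_on_psubgroup)

lemma subgroup_S_iff: "subgroup P (group_on L S) \<longleftrightarrow> psubgroup L P \<and> P \<subseteq> S"
  using psubgroup_S by (rule subgroup_group_on_iff)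

lemma subgroup_conj_object:
  assumes g: "g \<in> pcarrier L" and A: "A \<in> \<Delta>" "A \<subseteq> conj_dom L g" "pconj L g ` A \<subseteq> S"
    and P: "psubgroup L P" "P \<subseteq> A"
  shows "psubgroup L (pconj L g ` P)"
proof (rule psubgroup_subset[OF objectD(1)[OF object_conj(1)[OF g A]]])
  show "pconj L g ` P \<subseteq> pconj L g ` A" using P(2) by blast
  show "pone L \<in> pconj L g ` P"
    using one_in_conj_dom(2)[OF g] psubgroupD(5)[OF P(1)] by (metis image_eqI)
  show "pinv L y \<in> pconj L g ` P" if y: "y \<in> pconj L g ` P" for y
  proof -
    obtain x where x: "x \<in> P" "y = pconj L g x" using y by blast
    then have "pinv L y = pconj L g (pinv L x)" using conj_pinv(2)[OF g, of x] A(2) P(2) by auto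
    then show ?thesis using psubgroupD(2)[OF P(1) x(1)] by blast
  qed
  show "x \<cdot> y \<in> pconj L g ` P" if xy: "x \<in> pconj L g ` P" "y \<in> pconj L g ` P" for x y
  proof -
    obtain a b where ab: "a \<in> P" "b \<in> P" "x = pconj L g a" "y = pconj L g b" using xy by blast
    then have "x \<cdot> y = pconj L g (a \<cdot> b)" using object_conj(2)[OF g A subsetD[OF P(2) ab(1)] subsetD[OF P(2) ab(2)]] by simp
    then show ?thesis using psubgroup_mult[OF P(1) ab(1,2)] by blast
  qed
qed

text \<open>At each step the current subgroup lies in an object \<open>A\<close>, and conjugation is
  injective and multiplicative on \<open>A\<close>.\<close>

lemma fusion_chain_hom:
  assumes "fusion_chain L \<Delta> S P w" "psubgroup L P" "P \<subseteq> S"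
  shows "psubgroup L (conj_word L w ` P) \<and> conj_word L w ` P \<subseteq> S \<and> inj_on (conj_word L w) P \<and>
    (\<forall>x\<in>P. \<forall>y\<in>P. conj_word L w (x \<cdot> y) = conj_word L w x \<cdot> conj_word L w y)"
  using assms
proof (induction w arbitrary: P)
  case Nil
  then show ?case by simp
next
  case (Cons g w)
  then obtain A where A: "A \<in> \<Delta>" "P \<subseteq> A" "g \<in> pcarrier L" "A \<subseteq> conj_dom L g" "pconj L g ` A \<subseteq> S"
    by auto
  let ?Q = "pconj L g ` P"
  have Q: "psubgroup L ?Q" "?Q \<subseteq> S"
    using subgroup_conj_object[OF A(3,1,4,5) Cons.prems(2) A(2)] A(2,5) by auto
  have IH: "psubgroup L (conj_word L w ` ?Q)" "conj_word L w ` ?Q \<subseteq> S" "inj_on (conj_word L w) ?Q"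
    "\<And>x y. x \<in> ?Q \<Longrightarrow> y \<in> ?Q \<Longrightarrow> conj_word L w (x \<cdot> y) = conj_word L w x \<cdot> conj_word L w y"
    using Cons.IH[OF _ Q] Cons.prems(1) by auto
  have "inj_on (pconj L g) P"
    using conj_inj[OF A(3)] A(2,4) by (intro inj_onI) blast
  moreover have "conj_word L w \<circ> pconj L g = conj_word L (g # w)"
    by (simp add: fun_eq_iff)
  ultimately have "inj_on (conj_word L (g # w)) P"
    using IH(3) comp_inj_on[of "pconj L g" P "conj_word L w"] by simp
  moreover have "conj_word L (g # w) (x \<cdot> y) = conj_word L (g # w) x \<cdot> conj_word L (g # w) y"
    if "x \<in> P" "y \<in> P" for x y
    using IH(4)[of "pconj L g x" "pconj L g y"] object_conj(2)[OF A(3,1,4,5) subsetD[OF A(2) that(1)] subsetD[OF A(2) that(2)]] that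
    by simp
  moreover have "conj_word L (g # w) ` P = conj_word L w ` ?Q"
    by (simp add: image_image)
  ultimately show ?case
    using IH(1,2) by (simp del: conj_word.simps)
qed

lemma fusion_chain_one:
  assumes "fusion_chain L \<Delta> S P w" "psubgroup L P" "P \<subseteq> S"
  shows "conj_word L w (pone L) = pone L"
proof -
  note hom = fusion_chain_hom[OF assms]
  have one: "pone L \<in> P" using assms(2) by (rule psubgroupD)
  let ?e = "conj_word L w (pone L)"
  have e: "?e \<in> S" using hom one by blast
  have "?e \<cdot> ?e = ?e"
    using hom one one_mult(2)[OF pone_closed] by metis
  then show ?thesis
    using group.l_cancel_one[OF group_S, of ?e ?e] e by simp
qed

lemma fusion_chain_reverse:
  assumes "fusion_chain L \<Delta> S P w"
  shows "fusion_chain L \<Delta> S (conj_word L w ` P) (word_inv L w) \<and>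
    (\<forall>x\<in>P. conj_word L (word_inv L w) (conj_word L w x) = x)"
  using assms
proof (induction w arbitrary: P)
  case Nil
  then show ?case by simp
next
  case (Cons g w)
  then obtain A where A: "A \<in> \<Delta>" "P \<subseteq> A" "g \<in> pcarrier L" "A \<subseteq> conj_dom L g" "pconj L g ` A \<subseteq> S"
    by auto
  let ?Q = "pconj L g ` P"
  have IH: "fusion_chain L \<Delta> S (conj_word L w ` ?Q) (word_inv L w)"
    "\<And>x. x \<in> ?Q \<Longrightarrow> conj_word L (word_inv L w) (conj_word L w x) = x"
    using Cons.IH[of ?Q] Cons.prems by auto
  have "conj_word L (word_inv L w) ` conj_word L w ` ?Q = ?Q"
    using IH(2) by (auto simp: image_image)
  moreover have "fusion_chain L \<Delta> S ?Q [pinv L g]"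
    using object_conj(1)[OF A(3,1,4,5)] conj_image_inv[OF A(3,4)] A(2) objectD(2)[OF A(1)] pinv_closed[OF A(3)]
    by (auto intro!: bexI[of _ "pconj L g ` A"])
  ultimately show ?case
    using IH conj_inv(5)[OF A(3)] A(2,4)
    by (auto simp: fusion_chain_append image_image conj_word_append subset_iff)
qed

lemma chain_fusionI:
  assumes "fusion_chain L \<Delta> S P w" "psubgroup L P" "P \<subseteq> S" "psubgroup L Q" "Q \<subseteq> S" "conj_word L w ` P \<subseteq> Q"
  shows "restrict (conj_word L w) P \<in> chain_fusion L \<Delta> S P Q"
  using assms unfolding chain_fusion_def by blast

lemma conj_map_group_on:
  assumes "P \<subseteq> S" "g \<in> S"
  shows "conj_map (group_on L S) P g = restrict (pconj L g) P"
  unfolding conj_map_def using pconj_group_on[OF psubgroup_S assms(2)] assms(1)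
  by (intro restrict_ext) (metis subsetD)

text \<open>Conjugation by an element of \<open>S\<close> is a one-letter chain because
  \<open>S\<close> is itself an object. Composition is concatenation of chains, and inversion is
  reversal.\<close>

lemma fusion_system_chain: "fusion_system (group_on L S) (chain_fusion L \<Delta> S)"
proof (unfold fusion_system_def fusion_system_axioms_def, intro conjI allI impI group_S)
  show "finite (carrier (group_on L S))" using finite_S by simp
next
  fix \<phi> P Q assume "\<phi> \<in> chain_fusion L \<Delta> S P Q"
  then obtain w where w: "fusion_chain L \<Delta> S P w" "psubgroup L P" "P \<subseteq> S" "psubgroup L Q" "Q \<subseteq> S"
    "conj_word L w ` P \<subseteq> Q" "\<phi> = restrict (conj_word L w) P"
    unfolding chain_fusion_def by blast
  note hom = fusion_chain_hom[OF w(1-3)]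
  show "subgroup P (group_on L S)" "subgroup Q (group_on L S)"
    using w subgroup_S_iff by auto
  show "\<phi> \<in> hom (group_on L S\<lparr>carrier := P\<rparr>) (group_on L S\<lparr>carrier := Q\<rparr>)"
    using hom w(6,7) psubgroup_mult[OF w(2)] by (intro homI) auto
  show "\<phi> \<in> extensional P" using w(7) by simp
  show "inj_on \<phi> P" using hom w(7) by (simp add: inj_on_restrict_eq)
  have im: "\<phi> ` P = conj_word L w ` P" by (simp add: w(7))
  show "\<phi> \<in> chain_fusion L \<Delta> S P (\<phi> ` P)"
    unfolding im unfolding w(7) using w(1-3) hom by (intro chain_fusionI) auto
  have rev: "fusion_chain L \<Delta> S (conj_word L w ` P) (word_inv L w)"
    "\<And>x. x \<in> P \<Longrightarrow> conj_word L (word_inv L w) (conj_word L w x) = x"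
    using fusion_chain_reverse[OF w(1)] by auto
  have "restrict (inv_into P \<phi>) (\<phi> ` P) = restrict (conj_word L (word_inv L w)) (\<phi> ` P)"
  proof (rule restrict_ext)
    fix y assume "y \<in> \<phi> ` P"
    then obtain x where x: "x \<in> P" "y = \<phi> x" by blast
    then show "inv_into P \<phi> y = conj_word L (word_inv L w) y"
      using inv_into_f_f[OF \<open>inj_on \<phi> P\<close> x(1)] rev(2)[OF x(1)] w(7) by simp
  qed
  moreover have "restrict (conj_word L (word_inv L w)) (\<phi> ` P) \<in> chain_fusion L \<Delta> S (\<phi> ` P) P"
    unfolding im using w(2,3) hom rev by (intro chain_fusionI) auto
  ultimately show "restrict (inv_into P \<phi>) (\<phi> ` P) \<in> chain_fusion L \<Delta> S (\<phi> ` P) P"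
    by simp
next
  fix P Q g
  assume PQ: "subgroup P (group_on L S)" "subgroup Q (group_on L S)"
    and g: "g \<in> carrier (group_on L S)" and im: "conj_map (group_on L S) P g ` P \<subseteq> Q"
  have P: "psubgroup L P" "P \<subseteq> S" "psubgroup L Q" "Q \<subseteq> S" and gS: "g \<in> S"
    using PQ g by (simp_all add: subgroup_S_iff)
  have eq: "conj_map (group_on L S) P g = restrict (conj_word L [g]) P"
    using conj_map_group_on[OF P(2) gS] by (simp add: fun_eq_iff)
  have "fusion_chain L \<Delta> S P [g]"
    using P(2) gS S_subset S_object object_conj_S(1)[OF S_object gS] psubgroup_conj_image[OF psubgroup_S gS]
    by (auto intro!: bexI[of _ S])
  then show "conj_map (group_on L S) P g \<in> chain_fusion L \<Delta> S P Q"
    unfolding eq using P im[unfolded eq] by (intro chain_fusionI) auto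
next
  fix \<phi> P Q \<psi> R
  assume "\<phi> \<in> chain_fusion L \<Delta> S P Q" "\<psi> \<in> chain_fusion L \<Delta> S Q R"
  then obtain u v where u: "fusion_chain L \<Delta> S P u" "psubgroup L P" "P \<subseteq> S" "conj_word L u ` P \<subseteq> Q"
      "\<phi> = restrict (conj_word L u) P"
    and v: "fusion_chain L \<Delta> S Q v" "psubgroup L R" "R \<subseteq> S" "conj_word L v ` Q \<subseteq> R"
      "\<psi> = restrict (conj_word L v) Q"
    unfolding chain_fusion_def by blast
  have "compose P \<psi> \<phi> = restrict (conj_word L (u @ v)) P"
    using u(4) by (auto simp: compose_def fun_eq_iff u(5) v(5) conj_word_append)
  moreover have "fusion_chain L \<Delta> S P (u @ v)"
    using u(1) fusion_chain_mono[OF v(1) u(4)] by (simp add: fusion_chain_append)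
  moreover have "conj_word L (u @ v) ` P \<subseteq> R"
    using u(4) v(4) by (auto simp: conj_word_append)
  ultimately show "compose P \<psi> \<phi> \<in> chain_fusion L \<Delta> S P R"
    using u v by (simp add: chain_fusionI)
qed

text \<open>The chains form a fusion system that contains the generators. Conversely, conjugation
  along a chain is a composite of restricted generators, so it belongs to every fusion system
  containing the generators.\<close>

lemma locality_fusion_eq_chain_fusion: "locality_fusion L \<Delta> S = chain_fusion L \<Delta> S"
proof (intro ext equalityI)
  let ?X = "\<lambda>P Q. {restrict (pconj L g) P |g. P \<in> \<Delta> \<and> g \<in> pcarrier L \<and> P \<subseteq> conj_dom L g \<and>
        pconj L g ` P \<subseteq> S \<and> Q = pconj L g ` P}"
  fix P Q
  have "?X P Q \<subseteq> chain_fusion L \<Delta> S P Q" for P Q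
  proof
    fix \<phi> assume "\<phi> \<in> ?X P Q"
    then obtain g where g: "P \<in> \<Delta>" "g \<in> pcarrier L" "P \<subseteq> conj_dom L g" "pconj L g ` P \<subseteq> S"
      "Q = pconj L g ` P" "\<phi> = restrict (pconj L g) P" by blast
    have "\<phi> = restrict (conj_word L [g]) P" by (simp add: g(6) fun_eq_iff)
    then show "\<phi> \<in> chain_fusion L \<Delta> S P Q"
      using g objectD[OF g(1)] objectD(1)[OF object_conj(1)[OF g(2,1,3,4)]]
      by (auto intro!: chain_fusionI)
  qed
  then show "locality_fusion L \<Delta> S P Q \<subseteq> chain_fusion L \<Delta> S P Q"
    unfolding locality_fusion_def generated_fusion_system_def using fusion_system_chain by blast
  have "restrict (conj_word L w) P \<in> F P Q"
    if F: "fusion_system (group_on L S) F" "\<And>P Q. ?X P Q \<subseteq> F P Q"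
      and w: "fusion_chain L \<Delta> S P w" "psubgroup L P" "P \<subseteq> S" "psubgroup L Q" "Q \<subseteq> S" "conj_word L w ` P \<subseteq> Q"
    for w F P
    using w
  proof (induction w arbitrary: P)
    case Nil
    interpret F: fusion_system "group_on L S" F by (rule F)
    have "restrict (\<lambda>x. x) P \<in> F P Q"
      using Nil by (intro F.identity_morphism) (auto simp: subgroup_S_iff)
    then show ?case by (simp add: restrict_def)
  next
    case (Cons g w)
    interpret F: fusion_system "group_on L S" F by (rule F)
    obtain A where A: "A \<in> \<Delta>" "P \<subseteq> A" "g \<in> pcarrier L" "A \<subseteq> conj_dom L g" "pconj L g ` A \<subseteq> S"
      using Cons.prems(1) by auto
    let ?P' = "pconj L g ` P"
    have "restrict (pconj L g) A \<in> F A (pconj L g ` A)"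
      using A F(2)[of A "pconj L g ` A"] by blast
    then have "restrict (restrict (pconj L g) A) P \<in> F P (pconj L g ` A)"
      by (rule F.restrict_morphism) (use Cons.prems(2,3) A(2) subgroup_S_iff in auto)
    moreover have "restrict (restrict (pconj L g) A) P = restrict (pconj L g) P"
      using A(2) by (auto simp: restrict_def fun_eq_iff)
    ultimately have "restrict (pconj L g) P \<in> F P (pconj L g ` A)"
      by simp
    \<comment> \<open>The target is cut down to the image, so that it becomes the source of the
      remaining chain.\<close>
    then have 1: "restrict (pconj L g) P \<in> F P ?P'"
      using F.iso_onto_image[of "restrict (pconj L g) P" P "pconj L g ` A"] by simp
    have "psubgroup L ?P'" "?P' \<subseteq> S"
      using subgroup_conj_object[OF A(3,1,4,5) Cons.prems(2) A(2)] A(2,5) by auto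
    then have 2: "restrict (conj_word L w) ?P' \<in> F ?P' Q"
      by (intro Cons.IH) (use Cons.prems in \<open>auto simp: image_image\<close>)
    have "compose P (restrict (conj_word L w) ?P') (restrict (pconj L g) P) = restrict (conj_word L (g # w)) P"
      by (auto simp: compose_def fun_eq_iff)
    then show ?case using F.comp[OF 1 2] by (simp only:)
  qed
  note contained = this
  show "chain_fusion L \<Delta> S P Q \<subseteq> locality_fusion L \<Delta> S P Q"
  proof
    fix \<phi> assume "\<phi> \<in> chain_fusion L \<Delta> S P Q"
    then obtain w where w: "fusion_chain L \<Delta> S P w" "psubgroup L P" "P \<subseteq> S" "psubgroup L Q" "Q \<subseteq> S"
      "conj_word L w ` P \<subseteq> Q" "\<phi> = restrict (conj_word L w) P"
      unfolding chain_fusion_def by blast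
    show "\<phi> \<in> locality_fusion L \<Delta> S P Q"
      unfolding locality_fusion_def generated_fusion_system_def
    proof (rule InterI)
      fix Y assume "Y \<in> {F P Q |F. fusion_system (group_on L S) F \<and> (\<forall>P Q. ?X P Q \<subseteq> F P Q)}"
      then obtain F where F: "Y = F P Q" "fusion_system (group_on L S) F" "\<forall>P Q. ?X P Q \<subseteq> F P Q"
        by blast
      show "\<phi> \<in> Y"
        unfolding F(1) w(7) by (rule contained[OF F(2) F(3)[rule_format] w(1-6)])
    qed
  qed
qed

lemma S_mult:
  assumes "x \<in> S" "y \<in> S" "z \<in> S"
  shows "x \<cdot> y \<in> S" "x \<cdot> y \<cdot> z = x \<cdot> (y \<cdot> z)" "x \<cdot> z = y \<cdot> z \<longleftrightarrow> x = y" "z \<cdot> x = z \<cdot> y \<longleftrightarrow> x = y"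
proof -
  interpret group "group_on L S" by (rule group_S)
  show "x \<cdot> y \<in> S" "x \<cdot> y \<cdot> z = x \<cdot> (y \<cdot> z)" "x \<cdot> z = y \<cdot> z \<longleftrightarrow> x = y" "z \<cdot> x = z \<cdot> y \<longleftrightarrow> x = y"
    using m_closed[of x y] m_assoc[of x y z] right_cancel[of z x y] Units_l_cancel[of z x y] assms
    by simp_all
qed

end

section \<open>Chains and centric subgroups in a central product\<close>

context locality_product_center
begin

interpretation F1: locality p "prestrict L L1" \<Delta>1 S1 by (rule sub1)
interpretation F2: locality p "prestrict L L2" \<Delta>2 S2 by (rule sub2)

abbreviation Fus where "Fus \<equiv> chain_fusion L \<Delta> S"
abbreviation Fus1 where "Fus1 \<equiv> chain_fusion (prestrict L L1) \<Delta>1 S1"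
abbreviation Fus2 where "Fus2 \<equiv> chain_fusion (prestrict L L2) \<Delta>2 S2"

lemma fusion_chain1_Cons:
  assumes "fusion_chain (prestrict L L1) \<Delta>1 S1 P (g # w)"
  obtains A where "A \<in> \<Delta>1" "P \<subseteq> A" "g \<in> L1" "A \<subseteq> conj_dom L g" "pconj L g ` A \<subseteq> S1" "A \<subseteq> L1"
    "fusion_chain (prestrict L L1) \<Delta>1 S1 (pconj L g ` P) w"
proof -
  obtain A where A: "A \<in> \<Delta>1" "P \<subseteq> A" "g \<in> L1" "A \<subseteq> conj_dom (prestrict L L1) g" "pconj L g ` A \<subseteq> S1"
    using assms by auto
  then show ?thesis
    using that[OF A(1-3) _ A(5) object1D(3)[OF A(1)]] conj_dom_prestrict[OF sub1(1) A(3)] assms by auto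
qed

lemma set_prod_mono: "P \<subseteq> P' \<Longrightarrow> Q \<subseteq> Q' \<Longrightarrow> P \<star> Q \<subseteq> P' \<star> Q'"
  unfolding set_prod_def by blast

text \<open>Letters from \<open>L1\<close> act trivially on \<open>L2\<close>, so each step remains
  valid when its object \<open>A\<close> is enlarged to \<open>A \<star> S2\<close>.\<close>

lemma fusion_chain_extend:
  assumes "fusion_chain (prestrict L L1) \<Delta>1 S1 P w" "P \<subseteq> L1" "Q \<subseteq> S2"
  shows "fusion_chain L \<Delta> S (P \<star> Q) w \<and> (\<forall>x\<in>P. \<forall>y\<in>L2. conj_word L w (x \<cdot> y) = conj_word L w x \<cdot> y)"
  using assms(1,2)
proof (induction w arbitrary: P)
  case Nil
  then show ?case by simp
next
  case (Cons g w)
  obtain A where A: "A \<in> \<Delta>1" "P \<subseteq> A" "g \<in> L1" "A \<subseteq> conj_dom L g" "pconj L g ` A \<subseteq> S1" "A \<subseteq> L1"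
    "fusion_chain (prestrict L L1) \<Delta>1 S1 (pconj L g ` P) w"
    using fusion_chain1_Cons[OF Cons.prems(1)] .
  have gc: "g \<in> pcarrier L" using A(3) L1D(1) by blast
  have Q: "Q \<subseteq> L2" using assms(3) S12_subset by blast
  have P': "pconj L g ` P \<subseteq> L1" using A(2,5) S12_subset by blast
  note IH = Cons.IH[OF A(7) P']
  note AS = conj_left_factor[OF A(3) A(6) A(4) S12_subset(2)]
  have "A \<star> S2 \<in> \<Delta>" using set_prod_object[OF A(1) F2.S_object] .
  moreover have "pconj L g ` (A \<star> S2) \<subseteq> S"
    unfolding AS(2) using set_prod_subset_S[OF A(5)] by simp
  moreover have "P \<star> Q \<subseteq> A \<star> S2" using set_prod_mono[OF A(2) assms(3)] .
  moreover have "pconj L g ` (P \<star> Q) = (pconj L g ` P) \<star> Q"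
    using conj_left_factor(2)[OF A(3) Cons.prems(2) _ Q] A(2,4) by blast
  ultimately have chain: "fusion_chain L \<Delta> S (P \<star> Q) (g # w)"
    using IH AS(1) gc by auto
  moreover have "conj_word L (g # w) (x \<cdot> y) = conj_word L (g # w) x \<cdot> y" if x: "x \<in> P" and y: "y \<in> L2" for x y
  proof -
    have "x \<in> L1" "x \<in> conj_dom L g" using x A(2,4,6) by auto
    moreover have "y \<in> pcarrier L" "g \<cdot> pone L = g" using y L2D(1) gc one_mult(4) by auto
    ultimately have "pconj L g (x \<cdot> y) = pconj L g x \<cdot> y"
      using conj_mult_factors(2)[OF A(3) _ _ one_L2 y] conj_one[of y] by simp
    then show ?thesis using IH x y by simp
  qed
  ultimately show ?case by blast
qed

lemma proj2_conj:
  assumes f: "f \<in> L1" and g: "g \<in> L2" and P: "P \<subseteq> conj_dom L (f \<cdot> g)" "psubgroup L P"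
  shows "proj2 P \<subseteq> conj_dom L g" "pconj L g ` proj2 P = proj2 (pconj L (f \<cdot> g) ` P)"
  using locality_product.proj1_conj[OF swap g f _ P(2)] P(1) mult_dom(3)[OF f g] by simp_all

lemma proj1_mono: "P \<subseteq> Q \<Longrightarrow> proj1 P \<subseteq> proj1 Q" and proj2_mono: "P \<subseteq> Q \<Longrightarrow> proj2 P \<subseteq> proj2 Q"
  by (auto simp: cproj_def)

lemma proj_subset: "proj1 P \<subseteq> L1" "proj2 P \<subseteq> L2"
  by (auto simp: cproj_def)

lemma proj2_subset_S2: "P \<subseteq> S \<Longrightarrow> proj2 P \<subseteq> S2"
  by (rule locality_product_center.proj1_subset_S1[OF center_swap])

text \<open>Each letter is factored as \<open>g = f h\<close>; the letters \<open>f\<close> make up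
  \<open>u\<close> and the letters \<open>h\<close> make up \<open>v\<close>, with the projections
  of the objects as sources. The clause that \<open>w\<close> is a chain on
  \<open>proj1 P \<star> proj2 P\<close> is what later extends automorphisms of
  \<open>P\<close>.\<close>

lemma fusion_chain_split:
  assumes "fusion_chain L \<Delta> S P w" "psubgroup L P" "P \<subseteq> S"
  shows "\<exists>u v. fusion_chain (prestrict L L1) \<Delta>1 S1 (proj1 P) u \<and> fusion_chain (prestrict L L2) \<Delta>2 S2 (proj2 P) v \<and>
    fusion_chain L \<Delta> S (proj1 P \<star> proj2 P) w \<and>
    (\<forall>x\<in>proj1 P. \<forall>y\<in>proj2 P. conj_word L w (x \<cdot> y) = conj_word L u x \<cdot> conj_word L v y) \<and>
    conj_word L u ` proj1 P = proj1 (conj_word L w ` P) \<and> conj_word L v ` proj2 P = proj2 (conj_word L w ` P)"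
  using assms
proof (induction w arbitrary: P)
  case Nil
  show ?case by (intro exI[of _ "[]"]) simp
next
  case (Cons g w)
  then obtain A where A: "A \<in> \<Delta>" "P \<subseteq> A" "g \<in> pcarrier L" "A \<subseteq> conj_dom L g" "pconj L g ` A \<subseteq> S"
    "fusion_chain L \<Delta> S (pconj L g ` P) w" by auto
  obtain f h where fh: "f \<in> L1" "h \<in> L2" "g = f \<cdot> h" using decomposition[OF A(3)] .
  let ?P = "pconj L g ` P"
  have P': "psubgroup L ?P" "?P \<subseteq> S"
    using subgroup_conj_object[OF A(3,1,4,5) Cons.prems(2) A(2)] A(2,5) by auto
  have Pd: "P \<subseteq> conj_dom L (f \<cdot> h)" using A(2,4) fh(3) by blast
  note c1 = proj1_conj[OF fh(1,2) Pd Cons.prems(2), folded fh(3)]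
  note c2 = proj2_conj[OF fh(1,2) Pd Cons.prems(2), folded fh(3)]
  note A1 = proj1_conj[OF fh(1,2) A(4)[unfolded fh(3)] objectD(1)[OF A(1)], folded fh(3)]
  note A2 = proj2_conj[OF fh(1,2) A(4)[unfolded fh(3)] objectD(1)[OF A(1)], folded fh(3)]
  have A1S: "pconj L f ` proj1 A \<subseteq> S1" and A2S: "pconj L h ` proj2 A \<subseteq> S2"
    unfolding A1(2) A2(2) using proj1_subset_S1 proj2_subset_S2 A(5) by auto
  obtain u v where uv: "fusion_chain (prestrict L L1) \<Delta>1 S1 (proj1 ?P) u" "fusion_chain (prestrict L L2) \<Delta>2 S2 (proj2 ?P) v"
    "fusion_chain L \<Delta> S (proj1 ?P \<star> proj2 ?P) w"
    "\<And>x y. x \<in> proj1 ?P \<Longrightarrow> y \<in> proj2 ?P \<Longrightarrow> conj_word L w (x \<cdot> y) = conj_word L u x \<cdot> conj_word L v y"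
    "conj_word L u ` proj1 ?P = proj1 (conj_word L w ` ?P)" "conj_word L v ` proj2 ?P = proj2 (conj_word L w ` ?P)"
    using Cons.IH[OF A(6) P'] by (elim exE conjE, intro that) (assumption | drule (1) bspec)+
  have chain1: "fusion_chain (prestrict L L1) \<Delta>1 S1 (proj1 P) (f # u)"
    using proj1_object[OF A(1)] proj1_mono[OF A(2)] fh(1) A1(1) A1S uv(1) c1(2) proj_subset(1)[of A]
      conj_dom_prestrict[OF sub1(1) fh(1)] by (auto intro!: bexI[of _ "proj1 A"])
  have chain2: "fusion_chain (prestrict L L2) \<Delta>2 S2 (proj2 P) (h # v)"
    using proj2_object[OF A(1)] proj2_mono[OF A(2)] fh(2) A2(1) A2S uv(2) c2(2) proj_subset(2)[of A]
      conj_dom_prestrict[OF sub2(1) fh(2)] by (auto intro!: bexI[of _ "proj2 A"])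
  note AA = conj_set_prod[OF fh(1) proj_subset(1) A1(1) fh(2) proj_subset(2) A2(1), folded fh(3)]
  note PP = conj_set_prod[OF fh(1) proj_subset(1) c1(1) fh(2) proj_subset(2) c2(1), folded fh(3)]
  have "pconj L g ` (proj1 A \<star> proj2 A) \<subseteq> S"
    unfolding AA(2) by (rule set_prod_subset_S[OF A1S A2S])
  then have chain: "fusion_chain L \<Delta> S (proj1 P \<star> proj2 P) (g # w)"
    using set_prod_object[OF proj1_object[OF A(1)] proj2_object[OF A(1)]] AA(1) A(3) uv(3)
      set_prod_mono[OF proj1_mono[OF A(2)] proj2_mono[OF A(2)]] PP(2) c1(2) c2(2)
    by (auto intro!: bexI[of _ "proj1 A \<star> proj2 A"])
  have conj: "conj_word L (g # w) (x \<cdot> y) = conj_word L (f # u) x \<cdot> conj_word L (h # v) y"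
    if x: "x \<in> proj1 P" and y: "y \<in> proj2 P" for x y
  proof -
    have "pconj L g (x \<cdot> y) = pconj L f x \<cdot> pconj L h y"
      unfolding fh(3) using x y proj_subset[of P] c1(1) c2(1) by (intro conj_mult_factors(2)[OF fh(1) _ _ fh(2)]) auto
    moreover have "pconj L f x \<in> proj1 ?P" "pconj L h y \<in> proj2 ?P"
      using x y c1(2) c2(2) by auto
    ultimately show ?thesis using uv(4) by simp
  qed
  have im: "conj_word L (f # u) ` proj1 P = proj1 (conj_word L (g # w) ` P)"
    "conj_word L (h # v) ` proj2 P = proj2 (conj_word L (g # w) ` P)"
    using uv(5,6) unfolding c1(2)[symmetric] c2(2)[symmetric] by (simp_all add: image_image)
  show ?case
    using chain1 chain2 chain conj im by blast
qed

end

text \<open>Containing the center makes \<open>P1\<close> and \<open>P2\<close> the projections of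
  their product. Projections of a subgroup of \<open>S\<close> always have this property, see
  \<open>proj_split_subgroup\<close>.\<close>

locale split_subgroup = locality_product_center +
  fixes P1 P2 :: "'a set"
  assumes P1: "psubgroup L P1" "P1 \<subseteq> S1" "L1 \<inter> L2 \<subseteq> P1"
    and P2: "psubgroup L P2" "P2 \<subseteq> S2" "L1 \<inter> L2 \<subseteq> P2"
begin

interpretation F1: locality p "prestrict L L1" \<Delta>1 S1 by (rule sub1)
interpretation F2: locality p "prestrict L L2" \<Delta>2 S2 by (rule sub2)

lemma split_swap: "split_subgroup p L \<Delta> S L2 \<Delta>2 S2 L1 \<Delta>1 S1 P2 P1"
  using center_swap P1 P2 by (simp add: split_subgroup_def split_subgroup_axioms_def Int_commute)

lemma P_subset: "P1 \<subseteq> L1" "P2 \<subseteq> L2" "P1 \<subseteq> S" "P2 \<subseteq> S"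
  using P1(2) P2(2) S12_subset by auto

lemma P_one: "pone L \<in> P1" "pone L \<in> P2"
  using psubgroupD(5) P1(1) P2(1) by auto

abbreviation P where "P \<equiv> P1 \<star> P2"

lemma P_commute: "P2 \<star> P1 = P"
  using set_prod_commute[OF P_subset(1,2)] by simp

lemma psubgroup_P: "psubgroup L P" and P_S: "P \<subseteq> S"
  using psubgroup_set_prod[OF P1(1) P_subset(1) P2(1) P_subset(2)] set_prod_subset_S[OF P1(2) P2(2)] by auto

lemma P_iff: "x \<in> P \<longleftrightarrow> (\<exists>a\<in>P1. \<exists>b\<in>P2. x = a \<cdot> b)"
  by (rule set_prod_iff[OF P_subset(1,2)])

lemma P_I: "a \<in> P1 \<Longrightarrow> b \<in> P2 \<Longrightarrow> a \<cdot> b \<in> P"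
  using P_iff by blast

lemma P1_P: "P1 \<subseteq> P"
proof
  fix a assume a: "a \<in> P1"
  then have "a \<cdot> pone L = a" using one_mult(4) P_subset(3) S_subset by blast
  then show "a \<in> P" using P_I[OF a P_one(2)] by simp
qed

lemma P2_P: "P2 \<subseteq> P"
  using split_subgroup.P1_P[OF split_swap] P_commute by simp

lemma proj1_P: "proj1 P = P1"
  by (rule proj1_set_prod_eq[OF P1(1) P_subset(1,2) P_one(2) P1(3)])

lemma proj2_P: "proj2 P = P2"
  using locality_product.proj1_set_prod_eq[OF swap P2(1) P_subset(2,1) P_one(1)] P2(3) P_commute
  by (simp add: Int_commute)

lemma psubgroup1: "psubgroup (prestrict L L1) P1"
  using P1(1) P_subset(1) psubgroup_prestrict[OF sub1(1)] by blast

lemma Fus_split: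
  assumes "\<phi> \<in> Fus P Q"
  obtains u v where "fusion_chain (prestrict L L1) \<Delta>1 S1 P1 u" "fusion_chain (prestrict L L2) \<Delta>2 S2 P2 v"
    "\<And>x y. x \<in> P1 \<Longrightarrow> y \<in> P2 \<Longrightarrow> \<phi> (x \<cdot> y) = conj_word L u x \<cdot> conj_word L v y"
    "conj_word L u ` P1 = proj1 (\<phi> ` P)" "conj_word L v ` P2 = proj2 (\<phi> ` P)"
    "\<And>x. x \<in> P1 \<Longrightarrow> \<phi> x = conj_word L u x" "\<And>y. y \<in> P2 \<Longrightarrow> \<phi> y = conj_word L v y"
proof -
  obtain w where w: "fusion_chain L \<Delta> S P w" "\<phi> = restrict (conj_word L w) P"
    using assms unfolding chain_fusion_def by blast
  have im: "conj_word L w ` P = \<phi> ` P" by (simp add: w(2))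
  obtain u v where uv: "fusion_chain (prestrict L L1) \<Delta>1 S1 P1 u" "fusion_chain (prestrict L L2) \<Delta>2 S2 P2 v"
    "\<And>x y. x \<in> P1 \<Longrightarrow> y \<in> P2 \<Longrightarrow> conj_word L w (x \<cdot> y) = conj_word L u x \<cdot> conj_word L v y"
    "conj_word L u ` P1 = proj1 (\<phi> ` P)" "conj_word L v ` P2 = proj2 (\<phi> ` P)"
    using fusion_chain_split[OF w(1) psubgroup_P P_S, unfolded proj1_P proj2_P im]
    by (elim exE conjE, intro that) (assumption | drule (1) bspec)+
  have \<phi>: "\<phi> (x \<cdot> y) = conj_word L u x \<cdot> conj_word L v y" if "x \<in> P1" "y \<in> P2" for x y
    using uv(3)[OF that] P_I[OF that] by (simp add: w(2))
  have "conj_word L u (pone L) = pone L"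
    using F1.fusion_chain_one[OF uv(1) psubgroup1 P1(2)] by simp
  moreover have "conj_word L v (pone L) = pone L"
    using F2.fusion_chain_one[OF uv(2) split_subgroup.psubgroup1[OF split_swap] P2(2)] by simp
  moreover have "conj_word L u x \<in> pcarrier L" "x \<in> pcarrier L" if "x \<in> P1" for x
    using uv(4) that P_subset(3) S_subset L1D(1) proj_subset(1)[of "\<phi> ` P"] by blast+
  moreover have "conj_word L v x \<in> pcarrier L" "x \<in> pcarrier L" if "x \<in> P2" for x
    using uv(5) that P_subset(4) S_subset L2D(1) proj_subset(2)[of "\<phi> ` P"] by blast+
  ultimately have "\<phi> x = conj_word L u x" if "x \<in> P1" for x
    using \<phi>[OF that P_one(2)] one_mult(4) that by simp
  moreover have "\<phi> y = conj_word L v y" if "y \<in> P2" for y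
    using \<phi>[OF P_one(1) that] one_mult(2) that \<open>conj_word L u (pone L) = pone L\<close>
      \<open>\<And>x. x \<in> P2 \<Longrightarrow> conj_word L v x \<in> pcarrier L\<close> \<open>\<And>x. x \<in> P2 \<Longrightarrow> x \<in> pcarrier L\<close> by simp
  ultimately show ?thesis
    using that[OF uv(1,2) \<phi> uv(4,5)] by blast
qed

text \<open>The chain of \<open>\<alpha>\<close> is reused on \<open>P\<close>, where it leaves
  second factors unchanged. It fixes central elements, whence the last clause: the image of
  \<open>P1\<close> again contains the center.\<close>

lemma Fus_lift1:
  assumes "\<alpha> \<in> Fus1 P1 Q"
  obtains \<phi> where "\<phi> \<in> Fus P (Q \<star> P2)" "\<And>x y. x \<in> P1 \<Longrightarrow> y \<in> P2 \<Longrightarrow> \<phi> (x \<cdot> y) = \<alpha> x \<cdot> y" "L1 \<inter> L2 \<subseteq> \<alpha> ` P1"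
proof -
  obtain u where u: "fusion_chain (prestrict L L1) \<Delta>1 S1 P1 u" "psubgroup (prestrict L L1) Q" "Q \<subseteq> S1"
    "conj_word L u ` P1 \<subseteq> Q" "\<alpha> = restrict (conj_word L u) P1"
    using assms unfolding chain_fusion_def by auto
  have Q: "psubgroup L Q" "Q \<subseteq> L1" using u(2) psubgroup_prestrict[OF sub1(1)] by auto
  note ext = fusion_chain_extend[OF u(1) P_subset(1) P2(2)]
  have ext2: "conj_word L u (x \<cdot> y) = conj_word L u x \<cdot> y" if "x \<in> P1" "y \<in> L2" for x y
    using ext that by blast
  define \<phi> where "\<phi> = restrict (conj_word L u) P"
  have "conj_word L u ` P \<subseteq> Q \<star> P2"
  proof
    fix z assume "z \<in> conj_word L u ` P"
    then obtain c where c: "c \<in> P" "z = conj_word L u c" by blast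
    obtain x y where "x \<in> P1" "y \<in> P2" "c = x \<cdot> y" using c(1) unfolding P_iff by blast
    then have xy: "x \<in> P1" "y \<in> P2" "z = conj_word L u (x \<cdot> y)" using c(2) by simp_all
    then have "z = conj_word L u x \<cdot> y" using ext2 P_subset by blast
    then show "z \<in> Q \<star> P2" using set_prod_iff[OF Q(2) P_subset(2)] xy u(4) by blast
  qed
  then have "\<phi> \<in> Fus P (Q \<star> P2)"
    unfolding \<phi>_def using ext psubgroup_P P_S psubgroup_set_prod[OF Q P2(1) P_subset(2)]
      set_prod_subset_S[OF u(3) P2(2)] by (intro chain_fusionI) auto
  moreover have "\<phi> (x \<cdot> y) = \<alpha> x \<cdot> y" if "x \<in> P1" "y \<in> P2" for x y
    using ext2[of x y] P_I[OF that] that P_subset(2) by (auto simp: \<phi>_def u(5))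
  moreover have "z \<in> \<alpha> ` P1" if z: "z \<in> L1 \<inter> L2" for z
  proof -
    have zc: "z \<in> pcarrier L" "pone L \<cdot> z = z" using z L1D(1) one_mult(2) by auto
    have "conj_word L u (pone L) = pone L"
      using F1.fusion_chain_one[OF u(1) psubgroup1 P1(2)] by simp
    then have "conj_word L u z = z" using ext2[OF P_one(1), of z] z zc by simp
    moreover have "z \<in> P1" using z P1(3) by blast
    ultimately have "\<alpha> z = z" by (simp add: u(5))
    then show ?thesis using \<open>z \<in> P1\<close> by (metis image_eqI)
  qed
  ultimately show ?thesis using that by blast
qed

text \<open>A conjugate \<open>Q\<close> of \<open>P1\<close> gives the conjugate
  \<open>Q \<star> P2\<close> of \<open>P\<close>. An element of \<open>S1\<close> that centralizes
  \<open>Q\<close> centralizes this product, so it lies there, and projecting returns it to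
  \<open>Q\<close> because \<open>Q\<close> contains the center.\<close>

lemma centric_factor1:
  assumes "centric (group_on L S) Fus P"
  shows "centric (group_on L S1) Fus1 P1"
  unfolding centric_def
proof (intro allI impI)
  fix Q assume "\<exists>\<alpha>\<in>Fus1 P1 Q. \<alpha> ` P1 = Q"
  then obtain \<alpha> where \<alpha>: "\<alpha> \<in> Fus1 P1 Q" "\<alpha> ` P1 = Q" by blast
  obtain \<phi> where \<phi>: "\<phi> \<in> Fus P (Q \<star> P2)" "\<And>x y. x \<in> P1 \<Longrightarrow> y \<in> P2 \<Longrightarrow> \<phi> (x \<cdot> y) = \<alpha> x \<cdot> y" "L1 \<inter> L2 \<subseteq> \<alpha> ` P1"
    by (rule Fus_lift1[OF \<alpha>(1)], rule that) blast+
  have Q: "psubgroup L Q" "Q \<subseteq> L1" "Q \<subseteq> S"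
    using \<alpha>(1) psubgroup_prestrict[OF sub1(1), of Q] S12_subset unfolding chain_fusion_def by auto
  note iff = set_prod_iff[OF Q(2) P_subset(2)]
  have "\<phi> ` P = Q \<star> P2"
  proof (rule equalityI; rule subsetI)
    fix z assume "z \<in> \<phi> ` P"
    then obtain c where c: "c \<in> P" "z = \<phi> c" by blast
    obtain a b where ab: "a \<in> P1" "b \<in> P2" "c = a \<cdot> b" using c(1) unfolding P_iff by blast
    then have "z = \<alpha> a \<cdot> b" "\<alpha> a \<in> Q" using c(2) \<phi>(2) \<alpha>(2) by auto
    then show "z \<in> Q \<star> P2" unfolding iff using ab(2) by blast
  next
    fix z assume "z \<in> Q \<star> P2"
    then obtain x y where "x \<in> P1" "y \<in> P2" "z = \<alpha> x \<cdot> y" unfolding iff using \<alpha>(2) by blast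
    then show "z \<in> \<phi> ` P" using \<phi>(2) P_I by (metis image_eqI)
  qed
  then have cent: "centralizer (group_on L S) (Q \<star> P2) \<subseteq> Q \<star> P2"
    using assms \<phi>(1) unfolding centric_def by blast
  show "centralizer (group_on L S1) Q \<subseteq> Q"
  proof
    fix x assume x: "x \<in> centralizer (group_on L S1) Q"
    then have xS: "x \<in> S1" "x \<in> S" "x \<in> L1" and xQ: "\<And>q. q \<in> Q \<Longrightarrow> x \<cdot> q = q \<cdot> x"
      using S12_subset by (auto simp: centralizer_def)
    have "x \<cdot> z = z \<cdot> x" if z: "z \<in> Q \<star> P2" for z
    proof -
      obtain q y where qy: "q \<in> Q" "y \<in> P2" "z = q \<cdot> y" using z iff by blast
      have S: "q \<in> S" "y \<in> S" "x \<cdot> y = y \<cdot> x"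
        using qy Q(3) P_subset mult_dom(3)[OF xS(3)] by auto
      then show ?thesis
        using xQ[OF qy(1)] xS(2) qy(3) by (metis S_mult(2))
    qed
    then have "x \<in> centralizer (group_on L S) (Q \<star> P2)"
      using xS(2) by (simp add: centralizer_def)
    then have "x \<in> Q \<star> P2" using cent by blast
    moreover have "x \<cdot> pone L = x" using one_mult(4) xS(2) S_subset by blast
    ultimately have "x \<cdot> pone L \<in> Q \<star> P2" by simp
    then have "x \<in> proj1 (Q \<star> P2)" using xS(3) one_L2 by (auto simp: proj1_iff)
    then show "x \<in> Q"
      using proj1_set_prod_eq[OF Q(1,2) P_subset(2) P_one(2)] \<phi>(3) \<alpha>(2) by simp
  qed
qed

text \<open>A conjugate of \<open>P\<close> has components \<open>?Q1\<close> and
  \<open>?Q2\<close>, conjugates of \<open>P1\<close> and \<open>P2\<close>. If \<open>s t\<close>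
  centralizes it, then \<open>s\<close> centralizes \<open>?Q1\<close>, because \<open>t\<close>
  commutes with \<open>L1\<close>; likewise for \<open>t\<close> and \<open>?Q2\<close>.\<close>

lemma centric_product:
  assumes "centric (group_on L S1) Fus1 P1" "centric (group_on L S2) Fus2 P2"
  shows "centric (group_on L S) Fus P"
  unfolding centric_def
proof (intro allI impI subsetI)
  fix Q x assume "\<exists>\<phi>\<in>Fus P Q. \<phi> ` P = Q" and x: "x \<in> centralizer (group_on L S) Q"
  then obtain \<phi> where \<phi>: "\<phi> \<in> Fus P Q" "\<phi> ` P = Q" by blast
  obtain u v where uv: "fusion_chain (prestrict L L1) \<Delta>1 S1 P1 u" "fusion_chain (prestrict L L2) \<Delta>2 S2 P2 v"
    "\<And>x y. x \<in> P1 \<Longrightarrow> y \<in> P2 \<Longrightarrow> \<phi> (x \<cdot> y) = conj_word L u x \<cdot> conj_word L v y"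
    "conj_word L u ` P1 = proj1 (\<phi> ` P)" "conj_word L v ` P2 = proj2 (\<phi> ` P)"
    "\<And>x. x \<in> P1 \<Longrightarrow> \<phi> x = conj_word L u x" "\<And>y. y \<in> P2 \<Longrightarrow> \<phi> y = conj_word L v y"
    by (rule Fus_split[OF \<phi>(1)], rule that) blast+
  let ?Q1 = "conj_word L u ` P1" and ?Q2 = "conj_word L v ` P2"
  note P2' = split_subgroup.psubgroup1[OF split_swap]
  have Q1: "psubgroup (prestrict L L1) ?Q1" "?Q1 \<subseteq> S1"
    using F1.fusion_chain_hom[OF uv(1) psubgroup1 P1(2)] by auto
  have Q2: "psubgroup (prestrict L L2) ?Q2" "?Q2 \<subseteq> S2"
    using F2.fusion_chain_hom[OF uv(2) P2' P2(2)] by auto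
  have r1: "restrict (conj_word L u) P1 \<in> Fus1 P1 ?Q1"
    using F1.chain_fusionI[OF uv(1) psubgroup1 P1(2) Q1] by simp
  have r2: "restrict (conj_word L v) P2 \<in> Fus2 P2 ?Q2"
    using F2.chain_fusionI[OF uv(2) P2' P2(2) Q2] by simp
  have c1: "centralizer (group_on L S1) ?Q1 \<subseteq> ?Q1"
    using assms(1) r1 unfolding centric_def by force
  have c2: "centralizer (group_on L S2) ?Q2 \<subseteq> ?Q2"
    using assms(2) r2 unfolding centric_def by force
  have xS: "x \<in> S" and xQ: "\<And>q. q \<in> Q \<Longrightarrow> x \<cdot> q = q \<cdot> x"
    using x by (auto simp: centralizer_def)
  obtain s t where st: "s \<in> S1" "t \<in> S2" "x = s \<cdot> t"
    using xS S_eq set_prod_iff[OF S12_subset(1,2)] by blast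
  have stS: "s \<in> S" "t \<in> S" "s \<in> L1" "t \<in> L2" using st S12_subset by auto
  have "s \<cdot> q = q \<cdot> s" if q: "q \<in> ?Q1" for q
  proof -
    obtain a where a: "a \<in> P1" "q = conj_word L u a" using q by blast
    then have "q = \<phi> a" "a \<in> P" using uv(6) P1_P by auto
    then have "q \<in> Q" using \<phi>(2) by blast
    moreover have qS: "q \<in> S" "q \<in> L1" using q Q1(2) S12_subset by auto
    moreover have "t \<cdot> q = q \<cdot> t" using mult_dom(3)[OF qS(2) stS(4)] by simp
    ultimately have "s \<cdot> q \<cdot> t = q \<cdot> s \<cdot> t"
      using xQ[of q] stS qS(1) st(3) by (metis S_mult(2))
    then show ?thesis
      using S_mult(3)[OF S_mult(1)[OF stS(1) qS(1) stS(2)] S_mult(1)[OF qS(1) stS(1) stS(2)] stS(2)] by blast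
  qed
  then have s: "s \<in> ?Q1" using c1 st(1) by (auto simp: centralizer_def)
  have "t \<cdot> q = q \<cdot> t" if q: "q \<in> ?Q2" for q
  proof -
    obtain a where a: "a \<in> P2" "q = conj_word L v a" using q by blast
    then have "q = \<phi> a" "a \<in> P" using uv(7) P2_P by auto
    then have "q \<in> Q" using \<phi>(2) by blast
    moreover have qS: "q \<in> S" "q \<in> L2" using q Q2(2) S12_subset by auto
    moreover have "s \<cdot> q = q \<cdot> s" using mult_dom(3)[OF stS(3) qS(2)] by simp
    ultimately have "s \<cdot> (t \<cdot> q) = s \<cdot> (q \<cdot> t)"
      using xQ[of q] stS qS(1) st(3) by (metis S_mult(2))
    then show ?thesis
      using S_mult(4)[OF S_mult(1)[OF stS(2) qS(1) stS(1)] S_mult(1)[OF qS(1) stS(2) stS(1)] stS(1)] by blast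
  qed
  then have t: "t \<in> ?Q2" using c2 st(2) by (auto simp: centralizer_def)
  obtain a b where "a \<in> P1" "b \<in> P2" "s = conj_word L u a" "t = conj_word L v b" using s t by blast
  then show "x \<in> Q" using uv(3)[of a b] st(3) \<phi>(2) P_I[of a b] by (metis image_eqI)
qed

end

section \<open>The subgroup \<open>S\<close> is centric and radical\<close>

context locality
begin

lemma object_S_only: "P \<in> \<Delta> \<Longrightarrow> S \<subseteq> P \<Longrightarrow> P = S"
  using objectD(2) by blast

lemma conj_S_subset_imp_normalizes:
  assumes g: "g \<in> pcarrier L" and S: "S \<subseteq> conj_dom L g" "pconj L g ` S \<subseteq> S"
  shows "g \<in> pnormalizer L S"
proof -
  have "inj_on (pconj L g) S"
    using conj_inj[OF g] S(1) by (intro inj_onI) blast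
  then have "pconj L g ` S = S"
    using endo_inj_surj[OF finite_S S(2)] by blast
  then show ?thesis using g S(1) by (simp add: pnormalizer_def)
qed

text \<open>The only object containing \<open>S\<close> is \<open>S\<close>, so all letters of a
  chain from \<open>S\<close> to \<open>S\<close> normalize \<open>S\<close>. The chain is then a
  word of the domain and may be replaced by its product.\<close>

lemma automorphism_S:
  assumes "\<phi> \<in> chain_fusion L \<Delta> S S S"
  obtains g where "g \<in> pnormalizer L S" "\<phi> = restrict (pconj L g) S"
proof -
  obtain w where w: "fusion_chain L \<Delta> S S w" "\<phi> = restrict (conj_word L w) S"
    using assms unfolding chain_fusion_def by blast
  have "w \<in> lists (pnormalizer L S)"
    using w(1)
  proof (induction w)
    case (Cons g w)
    then obtain A where A: "A \<in> \<Delta>" "S \<subseteq> A" "g \<in> pcarrier L" "A \<subseteq> conj_dom L g" "pconj L g ` A \<subseteq> S"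
      "fusion_chain L \<Delta> S (pconj L g ` S) w" by auto
    have "A = S" using object_S_only A(1,2) by blast
    then have g: "g \<in> pnormalizer L S" using conj_S_subset_imp_normalizes A(3-5) by blast
    then have "pconj L g ` S = S" by (simp add: pnormalizer_def)
    then show ?case using Cons.IH A(6) g by simp
  qed simp
  note path = normalizer_path(1)[OF S_object this]
  have "w \<in> pdom L" using path pdom_iff by blast
  then have "pprod L w \<in> pnormalizer L S"
    using psubgroupD(4)[OF psubgroup_normalizer[OF S_object]] \<open>w \<in> lists (pnormalizer L S)\<close> by blast
  moreover have "\<phi> = restrict (pconj L (pprod L w)) S"
    unfolding w(2) using object_path_pprod(2)[OF path] by (intro restrict_ext) simp
  ultimately show ?thesis using that by blast
qed

text \<open>By cardinality \<open>S\<close> is its own only conjugate.\<close>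

lemma centric_S: "centric (group_on L S) (chain_fusion L \<Delta> S) S"
  unfolding centric_def
proof (intro allI impI)
  interpret FS: fusion_system "group_on L S" "chain_fusion L \<Delta> S" by (rule fusion_system_chain)
  fix Q assume "\<exists>\<phi>\<in>chain_fusion L \<Delta> S S Q. \<phi> ` S = Q"
  then obtain \<phi> where \<phi>: "\<phi> \<in> chain_fusion L \<Delta> S S Q" "\<phi> ` S = Q" by blast
  have "Q \<subseteq> S" using subgroup.subset[OF FS.morphismD(6)[OF \<phi>(1)]] by simp
  then have "Q = S"
    using endo_inj_surj[OF finite_S _ FS.morphismD(2)[OF \<phi>(1)]] \<phi>(2) by simp
  then show "centralizer (group_on L S) Q \<subseteq> Q" by (auto simp: centralizer_def)
qed

text \<open>The preimage in \<open>N\<^sub>L(S)\<close> of a \<open>p\<close>-group of automorphisms of \<open>S\<close> is a \<open>p\<close>-group, because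
  \<open>C\<^sub>L(S) \<le> S\<close>, hence it is contained in \<open>S\<close>.\<close>

lemma radical_S:
  assumes p: "prime p" and char: "objective_characteristic_p p L \<Delta> S"
  shows "radical p (group_on L S) (chain_fusion L \<Delta> S) S"
proof -
  let ?F = "chain_fusion L \<Delta> S" and ?K = "pnormalizer L S"
  interpret FS: fusion_system "group_on L S" ?F by (rule fusion_system_chain)
  have K: "psubgroup L ?K" "S \<subseteq> ?K"
    using psubgroup_normalizer object_normalizes_self S_object by auto
  interpret K: group "group_on L ?K" using K(1) by (rule group_on_psubgroup)
  have SS: "subgroup S (group_on L S)" using subgroup_S_iff psubgroup_S by blast
  interpret A: group "Aut_fus ?F S" using SS by (rule FS.group_Aut_fus)
  obtain k where k: "card S = p ^ k" using prime_power_S by blast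
  have fin: "finite ?K" using psubgroupD(1)[OF K(1)] finite_pcarrier by (rule finite_subset)
  have finK: "finite (carrier (group_on L ?K))" using fin by simp
  \<comment> \<open>\<open>O_p\<close> of the normalizer of \<open>S\<close> is a p-subgroup
    containing \<open>S\<close>, so it equals \<open>S\<close> by maximality; characteristic p then
    puts the centralizer of \<open>S\<close> in the normalizer into \<open>S\<close>.\<close>
  have CS: "c \<in> S" if c: "c \<in> ?K" "\<And>s. s \<in> S \<Longrightarrow> c \<cdot> s = s \<cdot> c" for c
  proof -
    note core = K.p_core_greatest[OF p finK]
    have sub: "subgroup (p_core p (group_on L ?K)) (group_on L ?K)" "\<exists>n. card (p_core p (group_on L ?K)) = p ^ n"
      using core by (auto simp: normal_p_subgroup_def normal_imp_subgroup)
    then have "p_psubgroup p L (p_core p (group_on L ?K))"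
      using K(1) by (simp add: p_psubgroup_def subgroup_group_on_iff)
    moreover have "S \<subseteq> p_core p (group_on L ?K)"
      using core object_normal[OF S_object K order.refl p] by blast
    ultimately have "p_core p (group_on L ?K) = S" using S_maximal by blast
    moreover have "centralizer (group_on L ?K) (p_core p (group_on L ?K)) \<subseteq> p_core p (group_on L ?K)"
      using char S_object unfolding objective_characteristic_p_def characteristic_p_def by blast
    ultimately have "centralizer (group_on L ?K) S \<subseteq> S" by simp
    then show ?thesis using c by (auto simp: centralizer_def)
  qed
  define c where "c g = restrict (pconj L g) S" for g
  have cF: "c g \<in> ?F S S" if g: "g \<in> ?K" for g
  proof -
    have "fusion_chain L \<Delta> S S [g]"
      using g S_object by (auto simp: pnormalizer_def)
    moreover have "conj_word L [g] ` S \<subseteq> S" using g by (auto simp: pnormalizer_def)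
    ultimately have "restrict (conj_word L [g]) S \<in> ?F S S"
      using psubgroup_S by (intro chain_fusionI) auto
    moreover have "restrict (conj_word L [g]) S = c g" by (simp add: c_def fun_eq_iff)
    ultimately show ?thesis by simp
  qed
  have stable: "pconj L g s \<in> S" if "g \<in> ?K" "s \<in> S" for g s
    using that by (auto simp: pnormalizer_def)
  have cm: "c (g \<cdot> h) = c h \<otimes>\<^bsub>Aut_fus ?F S\<^esub> c g" if "g \<in> ?K" "h \<in> ?K" for g h
  proof -
    have "c h \<otimes>\<^bsub>Aut_fus ?F S\<^esub> c g = compose S (c h) (c g)"
      using cF that by (simp add: FS.Aut_fus_simps)
    also have "\<dots> = c (g \<cdot> h)"
      using psubgroup_conj_mult[OF K(1) that] K(2) stable[OF that(1)]
      by (auto simp: c_def compose_def fun_eq_iff subset_iff)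
    finally show ?thesis ..
  qed
  have c1: "c (pone L) = \<one>\<^bsub>Aut_fus ?F S\<^esub>"
    using conj_one(2) S_subset by (auto simp: c_def FS.Aut_fus_simps fun_eq_iff)
  have cpow: "c (g [^]\<^bsub>group_on L ?K\<^esub> n) = c g [^]\<^bsub>Aut_fus ?F S\<^esub> n" if g: "g \<in> ?K" for g and n :: nat
  proof (induction n)
    case (Suc n)
    have "g [^]\<^bsub>group_on L ?K\<^esub> n \<in> ?K" using K.nat_pow_closed[of g n] g by simp
    then show ?case
      using cm[of g "g [^]\<^bsub>group_on L ?K\<^esub> n"] g K.nat_pow_Suc2[of g n] Suc by simp
  qed (simp add: c1)
  have "N \<subseteq> conj_map (group_on L S) S ` S" if N: "normal_p_subgroup p (Aut_fus ?F S) N" for N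
  proof
    fix \<phi> assume \<phi>: "\<phi> \<in> N"
    interpret N: normal N "Aut_fus ?F S" using N by (simp add: normal_p_subgroup_def)
    have NF: "N \<subseteq> ?F S S" using N.subset by (simp add: FS.Aut_fus_simps)
    obtain j where j: "card N = p ^ j" using N by (auto simp: normal_p_subgroup_def)
    have Nfin: "finite N" using N.subset FS.finite_Aut_fus[OF SS] by (rule finite_subset)
    define M where "M = {g \<in> ?K. c g \<in> N}"
    have M: "subgroup M (group_on L ?K)"
    proof (rule K.subgroupI)
      show "M \<noteq> {}"
        using c1 N.one_closed psubgroupD(5)[OF K(1)] by (auto simp: M_def)
      fix g assume g: "g \<in> M"
      have gK: "g \<in> ?K" "pinv L g \<in> ?K" using g psubgroupD(2)[OF K(1)] by (auto simp: M_def)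
      have "c (pinv L g) \<otimes>\<^bsub>Aut_fus ?F S\<^esub> c g = \<one>\<^bsub>Aut_fus ?F S\<^esub>"
        using cm[of g "pinv L g"] gK inv_mult(4)[of g] psubgroupD(1)[OF K(1)] c1 by auto
      then have "c (pinv L g) = inv\<^bsub>Aut_fus ?F S\<^esub> c g"
        using cF gK by (intro A.inv_equality[symmetric]) (auto simp: FS.Aut_fus_simps)
      then show "inv\<^bsub>group_on L ?K\<^esub> g \<in> M"
        using g gK inv_group_on[OF K(1) gK(1)] by (auto simp: M_def)
      fix h assume h: "h \<in> M"
      then show "g \<otimes>\<^bsub>group_on L ?K\<^esub> h \<in> M"
        using g cm[of g h] psubgroup_mult[OF K(1)] by (auto simp: M_def)
    qed (auto simp: M_def)
    have "\<exists>n::nat. g [^]\<^bsub>group_on L ?K\<^esub> (p ^ n) = \<one>\<^bsub>group_on L ?K\<^esub>" if g: "g \<in> M" for g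
    proof -
      have gK: "g \<in> ?K" "c g \<in> N" using g by (auto simp: M_def)
      \<comment> \<open>The exponent \<open>p^j = |N|\<close> annihilates the automorphism induced
        by \<open>g\<close>, so \<open>?x\<close> centralizes \<open>S\<close> and hence lies in
        \<open>S\<close>; the exponent \<open>p^k = |S|\<close> does the rest.\<close>
      let ?x = "g [^]\<^bsub>group_on L ?K\<^esub> (p ^ j)"
      have x: "?x \<in> ?K" using K.nat_pow_closed[of g] gK by simp
      have "c ?x = \<one>\<^bsub>Aut_fus ?F S\<^esub>"
        using cpow[OF gK(1)] A.pow_card_subgroup[OF N.subgroup_axioms Nfin gK(2)] j by simp
      then have trivial: "pconj L ?x s = s" if "s \<in> S" for s
        using that by (simp add: c_def FS.Aut_fus_simps fun_eq_iff) metis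
      have "?x \<cdot> s = s \<cdot> ?x" if s: "s \<in> S" for s
      proof -
        have "s \<in> conj_dom L ?x" "?x \<in> pcarrier L" using x s by (auto simp: pnormalizer_def)
        then show ?thesis using conj_inv(2)[of ?x s] trivial[OF s] by simp
      qed
      then have xS: "?x \<in> S" using CS x by blast
      have "subgroup S (group_on L ?K)" using K psubgroup_S by (simp add: subgroup_group_on_iff)
      then have "?x [^]\<^bsub>group_on L ?K\<^esub> (p ^ k) = \<one>\<^bsub>group_on L ?K\<^esub>"
        using K.pow_card_subgroup[OF _ finite_S xS] k by simp
      then have "g [^]\<^bsub>group_on L ?K\<^esub> (p ^ (j + k)) = \<one>\<^bsub>group_on L ?K\<^esub>"
        using gK(1) by (simp add: K.nat_pow_pow power_add)
      then show ?thesis by blast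
    qed
    then obtain m where m: "card M = p ^ m"
      using K.card_prime_power_iff[OF p M] fin by (metis (no_types, lifting) M_def finite_subset mem_Collect_eq subsetI)
    have "psubgroup L M" "M \<subseteq> ?K" using M K(1) by (simp_all add: subgroup_group_on_iff)
    then have MS: "M \<subseteq> S" using p_subgroup_subset_S[OF p _ m] by blast
    have "\<phi> \<in> ?F S S" using \<phi> NF by blast
    then obtain g where g: "g \<in> ?K" "\<phi> = restrict (pconj L g) S"
      by (rule automorphism_S)
    then have "g \<in> S" using MS \<phi> by (auto simp: M_def c_def)
    then show "\<phi> \<in> conj_map (group_on L S) S ` S"
      using conj_map_group_on[OF order.refl] g(2) by auto
  qed
  then show ?thesis
    using FS.radical_iff[OF p SS k] by blast
qed

end

context locality_product_center
begin

interpretation F1: locality p "prestrict L L1" \<Delta>1 S1 by (rule sub1)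

lemma fusion_system_Fus: "fusion_system (group_on L S) Fus" "fusion_system (group_on L S1) Fus1"
  "fusion_system (group_on L S2) Fus2"
  using fusion_system_chain F1.fusion_system_chain locality.fusion_system_chain[OF sub2(3)] by simp_all

lemma proj_split_subgroup:
  assumes "psubgroup L P" "P \<subseteq> S"
  shows "split_subgroup p L \<Delta> S L1 \<Delta>1 S1 L2 \<Delta>2 S2 (proj1 P) (proj2 P)"
proof -
  have "L1 \<inter> L2 \<subseteq> proj1 P" "L1 \<inter> L2 \<subseteq> proj2 P"
    using center_subset_proj1 locality_product.center_subset_proj1[OF swap] psubgroupD(5)[OF assms(1)]
    by (auto simp: Int_commute)
  moreover have "psubgroup L (proj1 P)" "psubgroup L (proj2 P)"
    using psubgroup_proj1 locality_product.psubgroup_proj1[OF swap] assms(1) by auto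
  ultimately show ?thesis
    using proj1_subset_S1 proj2_subset_S2 assms(2) locality_product_center_axioms
    by (simp add: split_subgroup_def split_subgroup_axioms_def)
qed

end

section \<open>Automorphisms and radicality of a product of subgroups\<close>

context split_subgroup
begin

interpretation F1: locality p "prestrict L L1" \<Delta>1 S1 by (rule sub1)
interpretation FS: fusion_system "group_on L S" Fus by (rule fusion_system_Fus)
interpretation FS1: fusion_system "group_on L S1" Fus1 by (rule fusion_system_Fus)
interpretation FS2: fusion_system "group_on L S2" Fus2 by (rule fusion_system_Fus)

lemma subgroups: "subgroup P (group_on L S)" "subgroup P1 (group_on L S1)" "subgroup P2 (group_on L S2)"
  using subgroup_S_iff psubgroup_P P_S F1.subgroup_S_iff psubgroup1 P1(2)
    locality.subgroup_S_iff[OF sub2(3)] split_subgroup.psubgroup1[OF split_swap] P2(2) by simp_all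

lemma restrict_automorphism1:
  assumes "\<phi> \<in> Fus P P"
  shows "restrict \<phi> P1 \<in> Fus1 P1 P1"
proof -
  obtain u v where u: "fusion_chain (prestrict L L1) \<Delta>1 S1 P1 u" "conj_word L u ` P1 = proj1 (\<phi> ` P)"
    "\<And>x. x \<in> P1 \<Longrightarrow> \<phi> x = conj_word L u x"
    by (rule Fus_split[OF assms], rule that) blast+
  have im: "conj_word L u ` P1 = P1"
    using u(2) FS.automorphism_image[OF assms] proj1_P by simp
  have "restrict \<phi> P1 = restrict (conj_word L u) P1"
    using u(3) by (intro restrict_ext)
  then show ?thesis
    using F1.chain_fusionI[OF u(1) psubgroup1 P1(2) psubgroup1 P1(2)] im by simp
qed

lemma restrict_automorphism2:
  assumes "\<phi> \<in> Fus P P"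
  shows "restrict \<phi> P2 \<in> Fus2 P2 P2"
  using split_subgroup.restrict_automorphism1[OF split_swap] assms P_commute by simp

lemma automorphism_mult:
  assumes "\<phi> \<in> Fus P P" "x \<in> P1" "y \<in> P2"
  shows "\<phi> (x \<cdot> y) = \<phi> x \<cdot> \<phi> y"
  using FS.morphismD(4)[OF assms(1), of x y] assms(2,3) P1_P P2_P by auto

lemma automorphism_eqI:
  assumes "\<phi> \<in> Fus P P" "\<psi> \<in> Fus P P" "restrict \<phi> P1 = restrict \<psi> P1" "restrict \<phi> P2 = restrict \<psi> P2"
  shows "\<phi> = \<psi>"
proof (rule extensionalityI[OF FS.morphismD(3)[OF assms(1)] FS.morphismD(3)[OF assms(2)]])
  fix z assume "z \<in> P"
  then obtain x y where xy: "x \<in> P1" "y \<in> P2" "z = x \<cdot> y" unfolding P_iff by blast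
  have "\<phi> x = \<psi> x" "\<phi> y = \<psi> y"
    using fun_cong[OF assms(3), of x] fun_cong[OF assms(4), of y] xy by simp_all
  then show "\<phi> z = \<psi> z"
    using automorphism_mult[OF assms(1) xy(1,2)] automorphism_mult[OF assms(2) xy(1,2)] xy(3) by simp
qed

lemma lift_automorphism1:
  assumes "\<alpha> \<in> Fus1 P1 P1"
  shows "\<exists>\<phi>\<in>Fus P P. restrict \<phi> P1 = \<alpha> \<and> restrict \<phi> P2 = restrict (\<lambda>x. x) P2"
proof -
  obtain \<phi> where \<phi>: "\<phi> \<in> Fus P P" "\<And>x y. x \<in> P1 \<Longrightarrow> y \<in> P2 \<Longrightarrow> \<phi> (x \<cdot> y) = \<alpha> x \<cdot> y"
    by (rule Fus_lift1[OF assms], rule that) blast+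
  have \<alpha>1: "\<alpha> (pone L) = pone L"
    using FS1.morphism_inv(1)[OF assms P_one(1)] by simp
  have c: "x \<in> pcarrier L" if "x \<in> P" for x using that P_S S_subset by blast
  have "\<phi> x = \<alpha> x" if x: "x \<in> P1" for x
  proof -
    have "\<alpha> x \<in> P1" using FS1.morphismD(1)[OF assms] x by blast
    then have "\<alpha> x \<in> P" "x \<in> P" using x P1_P by auto
    then show ?thesis using \<phi>(2)[OF x P_one(2)] one_mult(4)[OF c] by simp
  qed
  moreover have "\<phi> y = y" if y: "y \<in> P2" for y
    using \<phi>(2)[OF P_one(1) y] one_mult(2)[OF c[OF subsetD[OF P2_P y]]] \<alpha>1 by simp
  ultimately have "restrict \<phi> P1 = \<alpha>" "restrict \<phi> P2 = restrict (\<lambda>x. x) P2"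
    using FS1.morphismD(3)[OF assms] by (auto simp: restrict_def extensional_def fun_eq_iff)
  then show ?thesis using \<phi>(1) by blast
qed

lemma restrict_compose1:
  assumes "\<phi> \<in> Fus P P" "\<psi> \<in> Fus P P"
  shows "restrict (\<phi> \<otimes>\<^bsub>Aut_fus Fus P\<^esub> \<psi>) P1 = restrict \<phi> P1 \<otimes>\<^bsub>Aut_fus Fus1 P1\<^esub> restrict \<psi> P1"
proof -
  have "\<psi> x \<in> P1" if "x \<in> P1" for x
    using FS1.morphismD(1)[OF restrict_automorphism1[OF assms(2)]] that by auto
  then show ?thesis
    using FS.Aut_fus_simps(3)[OF assms] FS1.Aut_fus_simps(3)[OF restrict_automorphism1[OF assms(1)] restrict_automorphism1[OF assms(2)]]
      P1_P by (auto simp: compose_def fun_eq_iff restrict_def subset_iff)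
qed

text \<open>The two restrictions determine an automorphism because \<open>P\<close> is the product
  of \<open>P1\<close> and \<open>P2\<close>; an automorphism of one factor lifts, with the identity
  on the other, by \<open>Fus_lift1\<close>.\<close>

lemma Aut_direct_factors:
  "direct_factors (Aut_fus Fus P) (Aut_fus Fus1 P1) (Aut_fus Fus2 P2) (\<lambda>\<phi>. restrict \<phi> P1) (\<lambda>\<phi>. restrict \<phi> P2)"
proof (intro direct_factors.intro direct_factors_axioms.intro)
  show "group (Aut_fus Fus P)" "group (Aut_fus Fus1 P1)" "group (Aut_fus Fus2 P2)"
    using FS.group_Aut_fus FS1.group_Aut_fus FS2.group_Aut_fus subgroups by auto
  show "finite (carrier (Aut_fus Fus P))" by (rule FS.finite_Aut_fus[OF subgroups(1)])
  show "(\<lambda>\<phi>. restrict \<phi> P1) \<in> hom (Aut_fus Fus P) (Aut_fus Fus1 P1)"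
    using restrict_automorphism1 restrict_compose1
    by (intro homI) (auto simp: FS.Aut_fus_simps(1) FS1.Aut_fus_simps(1))
  show "(\<lambda>\<phi>. restrict \<phi> P2) \<in> hom (Aut_fus Fus P) (Aut_fus Fus2 P2)"
    using restrict_automorphism2 split_subgroup.restrict_compose1[OF split_swap]
    by (intro homI) (auto simp: FS.Aut_fus_simps(1) FS2.Aut_fus_simps(1) P_commute)
  show "\<phi> = \<one>\<^bsub>Aut_fus Fus P\<^esub>" if "\<phi> \<in> carrier (Aut_fus Fus P)"
    "restrict \<phi> P1 = \<one>\<^bsub>Aut_fus Fus1 P1\<^esub>" "restrict \<phi> P2 = \<one>\<^bsub>Aut_fus Fus2 P2\<^esub>" for \<phi>
  proof (rule automorphism_eqI)
    show "\<phi> \<in> Fus P P" using that(1) by (simp add: FS.Aut_fus_simps(1))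
    show "\<one>\<^bsub>Aut_fus Fus P\<^esub> \<in> Fus P P"
      using FS.identity_morphism[OF subgroups(1,1)] by (simp add: FS.Aut_fus_simps(2))
    show "restrict \<phi> P1 = restrict \<one>\<^bsub>Aut_fus Fus P\<^esub> P1" "restrict \<phi> P2 = restrict \<one>\<^bsub>Aut_fus Fus P\<^esub> P2"
      unfolding that(2,3) using P1_P P2_P
      by (auto simp: FS.Aut_fus_simps(2) FS1.Aut_fus_simps(2) FS2.Aut_fus_simps(2) restrict_def fun_eq_iff)
  qed
  show "\<exists>\<phi>\<in>carrier (Aut_fus Fus P). restrict \<phi> P1 = \<alpha> \<and> restrict \<phi> P2 = \<one>\<^bsub>Aut_fus Fus2 P2\<^esub>"
    if "\<alpha> \<in> carrier (Aut_fus Fus1 P1)" for \<alpha>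
    using lift_automorphism1[of \<alpha>] that by (simp add: FS.Aut_fus_simps(1) FS1.Aut_fus_simps(1) FS2.Aut_fus_simps(2))
  show "\<exists>\<phi>\<in>carrier (Aut_fus Fus P). restrict \<phi> P2 = \<alpha> \<and> restrict \<phi> P1 = \<one>\<^bsub>Aut_fus Fus1 P1\<^esub>"
    if "\<alpha> \<in> carrier (Aut_fus Fus2 P2)" for \<alpha>
    using split_subgroup.lift_automorphism1[OF split_swap, of \<alpha>] that P_commute
    by (simp add: FS.Aut_fus_simps(1) FS1.Aut_fus_simps(2) FS2.Aut_fus_simps(1))
qed

text \<open>The factor \<open>b\<close> lies in \<open>L2\<close> and acts trivially on
  \<open>P1\<close>.\<close>

lemma restrict_conj_map1:
  assumes "a \<in> P1" "b \<in> P2"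
  shows "restrict (conj_map (group_on L S) P (a \<cdot> b)) P1 = conj_map (group_on L S1) P1 a"
proof -
  have ab: "a \<cdot> b \<in> S" "a \<in> S1" "a \<in> L1" "b \<in> L2"
    using P_I[OF assms] P_S assms P1(2) P_subset by auto
  have "pconj L (a \<cdot> b) x = pconj L a x" if x: "x \<in> P1" for x
  proof -
    have x': "x \<in> L1" "x \<in> pcarrier L" "x \<in> conj_dom L a"
      using x P_subset L1D(1) psubgroup_conj(1)[OF P1(1) assms(1) x] by auto
    have b': "b \<in> pcarrier L" using ab(4) L2D(1) by blast
    have "pconj L a x \<in> P1" using psubgroup_conj(2)[OF P1(1) assms(1) x] .
    then have "pconj L a x \<in> pcarrier L" using psubgroupD(1)[OF P1(1)] by blast
    then show ?thesis
      using conj_mult_factors(2)[OF ab(3) x'(1,3) ab(4) one_L2 one_in_conj_dom(1)[OF b']]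
        one_in_conj_dom(2)[OF b'] one_mult(4) x'(2) by simp
  qed
  then show ?thesis
    using conj_map_group_on[OF P_S ab(1)] F1.conj_map_group_on[OF P1(2) ab(2)] P1_P
    by (auto simp: restrict_def fun_eq_iff)
qed

lemma restrict_conj_map2:
  assumes "a \<in> P1" "b \<in> P2"
  shows "restrict (conj_map (group_on L S) P (a \<cdot> b)) P2 = conj_map (group_on L S2) P2 b"
proof -
  have "b \<cdot> a = a \<cdot> b"
    by (rule mult_dom(3)[OF subsetD[OF P_subset(1) assms(1)] subsetD[OF P_subset(2) assms(2)], symmetric])
  then show ?thesis
    using split_subgroup.restrict_conj_map1[OF split_swap assms(2,1)] P_commute by simp
qed

lemma cards: "\<exists>i. card P = p ^ i" "\<exists>i. card P1 = p ^ i"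
proof -
  have "subgroup S (group_on L S)" "subgroup P1 (group_on L S)"
    using subgroup_S_iff psubgroup_S P1(1) P_subset(3) by auto
  then show "\<exists>i. card P = p ^ i" "\<exists>i. card P1 = p ^ i"
    using group.p_subgroup_mono[OF group_S prime subgroups(1) _ P_S]
      group.p_subgroup_mono[OF group_S prime _ _ P_subset(3)] prime_power_S by blast+
qed

text \<open>A normal p-subgroup of \<open>Aut(P1)\<close> is copied into \<open>Aut(P)\<close>,
  where radicality makes its elements inner; restriction to \<open>P1\<close> returns them as
  conjugations by first factors.\<close>

lemma radical_factor1:
  assumes "radical p (group_on L S) Fus P"
  shows "radical p (group_on L S1) Fus1 P1"
proof -
  interpret D: direct_factors "Aut_fus Fus P" "Aut_fus Fus1 P1" "Aut_fus Fus2 P2"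
    "\<lambda>\<phi>. restrict \<phi> P1" "\<lambda>\<phi>. restrict \<phi> P2" by (rule Aut_direct_factors)
  obtain i j where card: "card P = p ^ i" "card P1 = p ^ j" using cards by blast
  have "N \<subseteq> conj_map (group_on L S1) P1 ` P1" if N: "normal_p_subgroup p (Aut_fus Fus1 P1) N" for N
  proof
    fix \<alpha> assume \<alpha>: "\<alpha> \<in> N"
    let ?M = "{\<phi> \<in> carrier (Aut_fus Fus P). restrict \<phi> P1 \<in> N \<and> restrict \<phi> P2 = \<one>\<^bsub>Aut_fus Fus2 P2\<^esub>}"
    have M: "?M \<subseteq> conj_map (group_on L S) P ` P"
      using D.normal_p_subgroup_lift1[OF prime N] assms FS.radical_iff[OF prime subgroups(1) card(1)] by blast
    have "\<alpha> \<in> carrier (Aut_fus Fus1 P1)"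
      using N \<alpha> normal_imp_subgroup subgroup.mem_carrier by (fastforce simp: normal_p_subgroup_def)
    then obtain \<phi> where \<phi>: "\<phi> \<in> carrier (Aut_fus Fus P)" "restrict \<phi> P1 = \<alpha>" "restrict \<phi> P2 = \<one>\<^bsub>Aut_fus Fus2 P2\<^esub>"
      using D.lift1 by blast
    then have "\<phi> \<in> ?M" using \<alpha> by simp
    then obtain y where y: "y \<in> P" "\<phi> = conj_map (group_on L S) P y" using M by blast
    obtain a b where ab: "a \<in> P1" "b \<in> P2" "y = a \<cdot> b" using y(1) unfolding P_iff by blast
    have "\<alpha> = conj_map (group_on L S1) P1 a"
      using restrict_conj_map1[OF ab(1,2)] \<phi>(2) y(2) ab(3) by simp
    then show "\<alpha> \<in> conj_map (group_on L S1) P1 ` P1" using ab(1) by blast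
  qed
  then show ?thesis using FS1.radical_iff[OF prime subgroups(2) card(2)] by blast
qed

lemma radical_restrict1:
  assumes "radical p (group_on L S1) Fus1 P1" and N: "normal_p_subgroup p (Aut_fus Fus P) N" "\<phi> \<in> N"
  shows "restrict \<phi> P1 \<in> conj_map (group_on L S1) P1 ` P1"
proof -
  interpret D: direct_factors "Aut_fus Fus P" "Aut_fus Fus1 P1" "Aut_fus Fus2 P2"
    "\<lambda>\<phi>. restrict \<phi> P1" "\<lambda>\<phi>. restrict \<phi> P2" by (rule Aut_direct_factors)
  obtain j where card: "card P1 = p ^ j" using cards by blast
  have "(\<lambda>\<phi>. restrict \<phi> P1) ` N \<subseteq> conj_map (group_on L S1) P1 ` P1"
    using D.normal_p_subgroup_image1[OF prime N(1)] assms(1) FS1.radical_iff[OF prime subgroups(2) card] by blast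
  then show ?thesis using N(2) by blast
qed

text \<open>An automorphism that is conjugation by \<open>a\<close> on \<open>P1\<close> and by
  \<open>b\<close> on \<open>P2\<close> is conjugation by \<open>a \<cdot> b\<close>, so being inner
  can be tested on the factors.\<close>

lemma radical_product:
  assumes "radical p (group_on L S1) Fus1 P1" "radical p (group_on L S2) Fus2 P2"
  shows "radical p (group_on L S) Fus P"
proof -
  obtain i where card: "card P = p ^ i" using cards by blast
  have "N \<subseteq> conj_map (group_on L S) P ` P" if N: "normal_p_subgroup p (Aut_fus Fus P) N" for N
  proof
    fix \<phi> assume \<phi>: "\<phi> \<in> N"
    have N2: "normal_p_subgroup p (Aut_fus Fus (P2 \<star> P1)) N" using N P_commute by simp
    obtain a where a: "a \<in> P1" "restrict \<phi> P1 = conj_map (group_on L S1) P1 a"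
      using radical_restrict1[OF assms(1) N \<phi>] by blast
    obtain b where b: "b \<in> P2" "restrict \<phi> P2 = conj_map (group_on L S2) P2 b"
      using split_subgroup.radical_restrict1[OF split_swap assms(2) N2 \<phi>] by blast
    have "\<phi> = conj_map (group_on L S) P (a \<cdot> b)"
    proof (rule automorphism_eqI)
      show "\<phi> \<in> Fus P P"
        using N \<phi> normal_imp_subgroup subgroup.subset by (fastforce simp: normal_p_subgroup_def FS.Aut_fus_simps(1))
      have ab: "a \<cdot> b \<in> P" using P_I a b by blast
      interpret P: subgroup P "group_on L S" by (rule subgroups)
      show "conj_map (group_on L S) P (a \<cdot> b) \<in> Fus P P"
        by (rule FS.conj_map_automorphism[OF subgroups(1)])
          (use ab P.mem_carrier P.m_closed P.m_inv_closed in blast)+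
    qed (use a b restrict_conj_map1 restrict_conj_map2 in simp_all)
    then show "\<phi> \<in> conj_map (group_on L S) P ` P" using P_I a(1) b(1) by blast
  qed
  then show ?thesis using FS.radical_iff[OF prime subgroups(1) card] by blast
qed

end

section \<open>Centric radical subgroups of the product and of the factors\<close>

context locality_product_center
begin

interpretation F1: locality p "prestrict L L1" \<Delta>1 S1 by (rule sub1)

text \<open>The chain inducing \<open>\<phi>\<close> also runs on the product of the projections; it
  maps this product to itself because it maps \<open>P\<close> onto \<open>P\<close> and commutes
  with projecting.\<close>

lemma automorphism_extends_to_projections:
  assumes "\<phi> \<in> Fus P P"
  obtains \<psi> where "\<psi> \<in> Fus (proj1 P \<star> proj2 P) (proj1 P \<star> proj2 P)" "\<And>a. a \<in> P \<Longrightarrow> \<psi> a = \<phi> a"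
proof -
  interpret FS: fusion_system "group_on L S" Fus by (rule fusion_system_Fus)
  obtain w where w: "fusion_chain L \<Delta> S P w" "\<phi> = restrict (conj_word L w) P" "psubgroup L P" "P \<subseteq> S"
    using assms unfolding chain_fusion_def by blast
  interpret H: split_subgroup p L \<Delta> S L1 \<Delta>1 S1 L2 \<Delta>2 S2 "proj1 P" "proj2 P"
    by (rule proj_split_subgroup[OF w(3,4)])
  have im: "conj_word L w ` P = P"
    using FS.automorphism_image[OF assms] by (simp add: w(2))
  obtain u v where uv: "fusion_chain L \<Delta> S (proj1 P \<star> proj2 P) w"
    "\<And>x y. x \<in> proj1 P \<Longrightarrow> y \<in> proj2 P \<Longrightarrow> conj_word L w (x \<cdot> y) = conj_word L u x \<cdot> conj_word L v y"
    "conj_word L u ` proj1 P = proj1 P" "conj_word L v ` proj2 P = proj2 P"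
    using fusion_chain_split[OF w(1,3,4), unfolded im]
    by (elim exE conjE, intro that) (assumption | drule (1) bspec)+
  have "conj_word L w ` (proj1 P \<star> proj2 P) \<subseteq> proj1 P \<star> proj2 P"
  proof
    fix z assume "z \<in> conj_word L w ` (proj1 P \<star> proj2 P)"
    then obtain c where c: "c \<in> proj1 P \<star> proj2 P" "z = conj_word L w c" by blast
    obtain x y where xy: "x \<in> proj1 P" "y \<in> proj2 P" "c = x \<cdot> y" using c(1) unfolding H.P_iff by blast
    have "conj_word L u x \<in> proj1 P" "conj_word L v y \<in> proj2 P" using uv(3,4) xy(1,2) by blast+
    then show "z \<in> proj1 P \<star> proj2 P" using H.P_I uv(2)[OF xy(1,2)] c(2) xy(3) by simp
  qed
  then have "restrict (conj_word L w) (proj1 P \<star> proj2 P) \<in> Fus (proj1 P \<star> proj2 P) (proj1 P \<star> proj2 P)"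
    using uv(1) H.psubgroup_P H.P_S by (intro chain_fusionI)
  moreover have "P \<subseteq> proj1 P \<star> proj2 P"
    using subset_proj_product w(4) S_subset by blast
  ultimately show ?thesis
    using that w(2) by (auto simp: subset_iff)
qed

text \<open>The automorphisms of \<open>P\<close> induced by its normalizer in \<open>H = proj1 P \<star> proj2 P\<close> form a normal
  \<open>p\<close>-subgroup of \<open>Aut(P)\<close>, since all automorphisms extend to \<open>H\<close>. Hence that normalizer is \<open>P\<close>.\<close>

lemma centric_radical_eq_projections:
  assumes P: "psubgroup L P" "P \<subseteq> S"
    and centric: "centric (group_on L S) Fus P" and radical: "radical p (group_on L S) Fus P"
  shows "P = proj1 P \<star> proj2 P"
proof (rule ccontr)
  let ?H = "proj1 P \<star> proj2 P"
  assume "P \<noteq> ?H"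
  moreover have PH: "P \<subseteq> ?H" using subset_proj_product P(2) S_subset by blast
  ultimately have "P \<subset> ?H" by blast
  interpret FS: fusion_system "group_on L S" Fus by (rule fusion_system_Fus)
  interpret H: split_subgroup p L \<Delta> S L1 \<Delta>1 S1 L2 \<Delta>2 S2 "proj1 P" "proj2 P"
    by (rule proj_split_subgroup[OF P])
  let ?G = "group_on L S"
  have Ps: "subgroup P ?G" and Hs: "subgroup ?H ?G"
    using P subgroup_S_iff H.subgroups by auto
  interpret Ps: subgroup P ?G by (rule Ps)
  interpret Hs: subgroup ?H ?G by (rule Hs)
  obtain i where i: "card ?H = p ^ i" using H.cards by blast
  obtain j where j: "card P = p ^ j"
    using FS.p_subgroup_mono[OF prime Ps Hs PH i] by blast
  \<comment> \<open>The normalizer of \<open>P\<close> in \<open>?H\<close>; both directions of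
    conjugation are demanded, which makes closure under inverses immediate.\<close>
  define X where "X = {x \<in> ?H. \<forall>a\<in>P. inv\<^bsub>?G\<^esub> x \<otimes>\<^bsub>?G\<^esub> a \<otimes>\<^bsub>?G\<^esub> x \<in> P \<and> x \<otimes>\<^bsub>?G\<^esub> a \<otimes>\<^bsub>?G\<^esub> inv\<^bsub>?G\<^esub> x \<in> P}"
  have XH: "X \<subseteq> ?H" by (auto simp: X_def)
  have norm: "inv\<^bsub>?G\<^esub> x \<otimes>\<^bsub>?G\<^esub> a \<otimes>\<^bsub>?G\<^esub> x \<in> P" "x \<otimes>\<^bsub>?G\<^esub> a \<otimes>\<^bsub>?G\<^esub> inv\<^bsub>?G\<^esub> x \<in> P" if "x \<in> X" "a \<in> P" for x a
    using that by (auto simp: X_def)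
  have X: "subgroup X ?G"
  proof (rule FS.subgroupI)
    show "X \<subseteq> carrier ?G" using XH Hs.subset by blast
    have "\<one>\<^bsub>?G\<^esub> \<in> X" unfolding X_def using Hs.one_closed Ps.mem_carrier by (simp del: group_on_simps)
    then show "X \<noteq> {}" by blast
    fix x assume x: "x \<in> X"
    then have xH: "x \<in> ?H" "x \<in> carrier ?G" using XH Hs.mem_carrier by blast+
    then show "inv\<^bsub>?G\<^esub> x \<in> X" unfolding X_def using norm[OF x] by (simp del: group_on_simps)
    fix y assume y: "y \<in> X"
    then have yH: "y \<in> ?H" "y \<in> carrier ?G" using XH Hs.mem_carrier by blast+
    have "inv\<^bsub>?G\<^esub> (x \<otimes>\<^bsub>?G\<^esub> y) \<otimes>\<^bsub>?G\<^esub> a \<otimes>\<^bsub>?G\<^esub> (x \<otimes>\<^bsub>?G\<^esub> y) \<in> P \<and> x \<otimes>\<^bsub>?G\<^esub> y \<otimes>\<^bsub>?G\<^esub> a \<otimes>\<^bsub>?G\<^esub> inv\<^bsub>?G\<^esub> (x \<otimes>\<^bsub>?G\<^esub> y) \<in> P"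
      if a: "a \<in> P" for a
      using norm(1)[OF y norm(1)[OF x a]] norm(2)[OF x norm(2)[OF y a]] xH(2) yH(2) Ps.mem_carrier[OF a]
      by (simp add: FS.inv_mult_group FS.m_assoc del: group_on_simps)
    then show "x \<otimes>\<^bsub>?G\<^esub> y \<in> X" unfolding X_def using Hs.m_closed[OF xH(1) yH(1)] by blast
  qed
  interpret X: subgroup X ?G by (rule X)
  obtain k where k: "card X = p ^ k"
    using FS.p_subgroup_mono[OF prime X Hs XH i] by blast
  have "normal_p_subgroup p (Aut_fus Fus P) (conj_map ?G P ` X)"
  proof (rule FS.normal_p_subgroup_conj_maps[OF prime Ps X k norm(1)])
    fix \<phi> x assume \<phi>: "\<phi> \<in> Fus P P" and x: "x \<in> X"
    obtain \<psi> where \<psi>: "\<psi> \<in> Fus ?H ?H" "\<And>a. a \<in> P \<Longrightarrow> \<psi> a = \<phi> a"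
      by (rule automorphism_extends_to_projections[OF \<phi>], rule that) blast+
    have xH: "x \<in> ?H" "inv\<^bsub>?G\<^esub> x \<in> X" "inv\<^bsub>?G\<^esub> x \<in> ?H" using x XH X.m_inv_closed[OF x] by blast+
    have yH: "\<psi> x \<in> ?H" using FS.morphismD(1)[OF \<psi>(1)] xH(1) by blast
    note act = FS.automorphism_conj_map[OF \<phi> \<psi>(1) PH \<psi>(2)]
    have "inv\<^bsub>?G\<^esub> (\<psi> x) \<otimes>\<^bsub>?G\<^esub> a \<otimes>\<^bsub>?G\<^esub> \<psi> x \<in> P" "\<psi> x \<otimes>\<^bsub>?G\<^esub> a \<otimes>\<^bsub>?G\<^esub> inv\<^bsub>?G\<^esub> (\<psi> x) \<in> P" if a: "a \<in> P" for a
    proof -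
      show "inv\<^bsub>?G\<^esub> (\<psi> x) \<otimes>\<^bsub>?G\<^esub> a \<otimes>\<^bsub>?G\<^esub> \<psi> x \<in> P" by (rule act(2)[OF _ xH(1) norm(1)[OF x] a])
      have "inv\<^bsub>?G\<^esub> (\<psi> (inv\<^bsub>?G\<^esub> x)) \<otimes>\<^bsub>?G\<^esub> a \<otimes>\<^bsub>?G\<^esub> \<psi> (inv\<^bsub>?G\<^esub> x) \<in> P"
        by (rule act(2)[OF _ xH(3) norm(1)[OF xH(2)] a])
      then show "\<psi> x \<otimes>\<^bsub>?G\<^esub> a \<otimes>\<^bsub>?G\<^esub> inv\<^bsub>?G\<^esub> (\<psi> x) \<in> P"
        using FS.morphism_inv(2)[OF \<psi>(1) xH(1)] FS.inv_inv[OF Hs.mem_carrier[OF yH]] by simp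
    qed
    then have "\<psi> x \<in> X" unfolding X_def using yH by blast
    then show "\<exists>y\<in>X. \<phi> \<otimes>\<^bsub>Aut_fus Fus P\<^esub> conj_map ?G P x = conj_map ?G P y \<otimes>\<^bsub>Aut_fus Fus P\<^esub> \<phi>"
      using act(3)[OF _ xH(1) norm(1)[OF x]] by blast
  qed
  then have inner: "conj_map ?G P ` X \<subseteq> conj_map ?G P ` P"
    using radical FS.radical_iff[OF prime Ps j] by blast
  have cent: "centralizer ?G P \<subseteq> P"
  proof -
    have "restrict (\<lambda>x. x) P \<in> Fus P P" using FS.identity_morphism[OF Ps Ps] by simp
    moreover have "restrict (\<lambda>x. x) P ` P = P" by simp
    ultimately show ?thesis using centric unfolding centric_def by blast
  qed
  \<comment> \<open>By radicality an element \<open>x\<close> of \<open>X\<close> acts on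
    \<open>P\<close> like some \<open>g\<close> in \<open>P\<close>. Then \<open>x g^-1\<close>
    centralizes \<open>P\<close>, and centricity puts it into \<open>P\<close>.\<close>
  have XP: "X \<subseteq> P"
  proof
    fix x assume x: "x \<in> X"
    then obtain g where g: "g \<in> P" "conj_map ?G P x = conj_map ?G P g" using inner by blast
    have xc: "x \<in> carrier ?G" "g \<in> carrier ?G" using X.mem_carrier[OF x] Ps.mem_carrier[OF g(1)] by auto
    have "x \<otimes>\<^bsub>?G\<^esub> inv\<^bsub>?G\<^esub> g \<otimes>\<^bsub>?G\<^esub> b = b \<otimes>\<^bsub>?G\<^esub> (x \<otimes>\<^bsub>?G\<^esub> inv\<^bsub>?G\<^esub> g)" if b: "b \<in> P" for b
    proof -
      have bc: "b \<in> carrier ?G" using Ps.mem_carrier[OF b] .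
      have eq: "inv\<^bsub>?G\<^esub> x \<otimes>\<^bsub>?G\<^esub> b \<otimes>\<^bsub>?G\<^esub> x = inv\<^bsub>?G\<^esub> g \<otimes>\<^bsub>?G\<^esub> b \<otimes>\<^bsub>?G\<^esub> g"
        using fun_cong[OF g(2), of b] b by (simp add: conj_map_def del: group_on_simps)
      have "x \<otimes>\<^bsub>?G\<^esub> inv\<^bsub>?G\<^esub> g \<otimes>\<^bsub>?G\<^esub> b = x \<otimes>\<^bsub>?G\<^esub> (inv\<^bsub>?G\<^esub> g \<otimes>\<^bsub>?G\<^esub> b \<otimes>\<^bsub>?G\<^esub> g) \<otimes>\<^bsub>?G\<^esub> inv\<^bsub>?G\<^esub> g"
        using xc bc by (simp add: FS.m_assoc del: group_on_simps)
      also have "\<dots> = b \<otimes>\<^bsub>?G\<^esub> (x \<otimes>\<^bsub>?G\<^esub> inv\<^bsub>?G\<^esub> g)"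
        unfolding eq[symmetric] using xc bc by (simp add: FS.m_assoc del: group_on_simps)
      finally show ?thesis .
    qed
    moreover have c: "x \<otimes>\<^bsub>?G\<^esub> inv\<^bsub>?G\<^esub> g \<in> carrier ?G" using xc by (simp del: group_on_simps)
    ultimately have "x \<otimes>\<^bsub>?G\<^esub> inv\<^bsub>?G\<^esub> g \<in> P"
      using cent unfolding centralizer_def by blast
    then have "x \<otimes>\<^bsub>?G\<^esub> inv\<^bsub>?G\<^esub> g \<otimes>\<^bsub>?G\<^esub> g \<in> P" using g(1) by (rule Ps.m_closed)
    then show "x \<in> P" using xc by (simp del: group_on_simps)
  qed
  obtain x where x: "x \<in> ?H" "x \<notin> P" "\<And>a. a \<in> P \<Longrightarrow> x \<otimes>\<^bsub>?G\<^esub> a \<otimes>\<^bsub>?G\<^esub> inv\<^bsub>?G\<^esub> x \<in> P"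
    using FS.normalizer_grows[OF prime Ps Hs \<open>P \<subset> ?H\<close> i] by blast
  have xc: "x \<in> carrier ?G" using Hs.mem_carrier[OF x(1)] .
  \<comment> \<open>\<open>normalizer_grows\<close> supplies one direction of conjugation only; by
    finiteness \<open>?f\<close> maps \<open>P\<close> onto \<open>P\<close>, which yields the other
    direction.\<close>
  let ?f = "\<lambda>a. x \<otimes>\<^bsub>?G\<^esub> a \<otimes>\<^bsub>?G\<^esub> inv\<^bsub>?G\<^esub> x"
  have "inj_on ?f P"
    using xc Ps.mem_carrier by (intro inj_onI) (simp del: group_on_simps)
  moreover have "?f ` P \<subseteq> P"
    by (rule image_subsetI) (rule x(3))
  ultimately have fP: "?f ` P = P"
    by (intro endo_inj_surj FS.finite_object[OF Ps])
  have "inv\<^bsub>?G\<^esub> x \<otimes>\<^bsub>?G\<^esub> a \<otimes>\<^bsub>?G\<^esub> x \<in> P" if a: "a \<in> P" for a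
  proof -
    have "a \<in> ?f ` P" using a fP by simp
    then obtain b where b: "b \<in> P" "a = ?f b" by blast
    have "inv\<^bsub>?G\<^esub> x \<otimes>\<^bsub>?G\<^esub> a \<otimes>\<^bsub>?G\<^esub> x = b"
      unfolding b(2) using xc Ps.mem_carrier[OF b(1)] by (simp add: FS.m_assoc del: group_on_simps)
    then show ?thesis using b(1) by simp
  qed
  then have "x \<in> X" unfolding X_def using x(1,3) by blast
  then show False using XP x(2) by blast
qed

lemma locality_fusion_eqs: "locality_fusion L \<Delta> S = Fus" "locality_fusion (prestrict L L1) \<Delta>1 S1 = Fus1"
  "locality_fusion (prestrict L L2) \<Delta>2 S2 = Fus2"
  using locality_fusion_eq_chain_fusion F1.locality_fusion_eq_chain_fusion
    locality.locality_fusion_eq_chain_fusion[OF sub2(3)] by auto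

lemma centric_radicals_product:
  assumes "centric_radicals p (group_on L S1) Fus1 \<subseteq> \<Delta>1" "centric_radicals p (group_on L S2) Fus2 \<subseteq> \<Delta>2"
  shows "centric_radicals p (group_on L S) Fus \<subseteq> \<Delta>"
proof
  fix P assume "P \<in> centric_radicals p (group_on L S) Fus"
  then have P: "psubgroup L P" "P \<subseteq> S" "centric (group_on L S) Fus P" "radical p (group_on L S) Fus P"
    by (auto simp: centric_radicals_def subgroup_S_iff)
  interpret H: split_subgroup p L \<Delta> S L1 \<Delta>1 S1 L2 \<Delta>2 S2 "proj1 P" "proj2 P"
    by (rule proj_split_subgroup[OF P(1,2)])
  have eq: "proj1 P \<star> proj2 P = P" "proj2 P \<star> proj1 P = P"
    using centric_radical_eq_projections[OF P] H.P_commute by auto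
  have "proj1 P \<in> \<Delta>1"
    using assms(1) H.centric_factor1 H.radical_factor1 H.subgroups(2) P(3,4) unfolding eq(1)
    by (auto simp: centric_radicals_def)
  moreover have "proj2 P \<in> \<Delta>2"
    using assms(2) split_subgroup.centric_factor1[OF H.split_swap] split_subgroup.radical_factor1[OF H.split_swap]
      H.subgroups(3) P(3,4) unfolding eq(2) by (auto simp: centric_radicals_def)
  ultimately show "P \<in> \<Delta>"
    using set_prod_object eq(1) by metis
qed

text \<open>The center of the product commutes with \<open>L1\<close>, so the centric subgroup
  \<open>P1\<close> contains it, and \<open>split_subgroup\<close> applies to \<open>P1\<close> and
  \<open>S2\<close>. Their product is centric radical, hence an object, and its projection
  \<open>P1\<close> is therefore an object of \<open>L1\<close>.\<close>

lemma centric_radicals_factor1: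
  assumes "centric_radicals p (group_on L S) Fus \<subseteq> \<Delta>"
    and char: "objective_characteristic_p p (prestrict L L2) \<Delta>2 S2"
  shows "centric_radicals p (group_on L S1) Fus1 \<subseteq> \<Delta>1"
proof
  interpret F2: locality p "prestrict L L2" \<Delta>2 S2 by (rule sub2)
  interpret FS1: fusion_system "group_on L S1" Fus1 by (rule fusion_system_Fus)
  fix P1 assume P1: "P1 \<in> centric_radicals p (group_on L S1) Fus1"
  then have sub: "subgroup P1 (group_on L S1)" and cr: "centric (group_on L S1) Fus1 P1" "radical p (group_on L S1) Fus1 P1"
    by (auto simp: centric_radicals_def)
  have P1': "psubgroup L P1" "P1 \<subseteq> S1" "P1 \<subseteq> L1"
    using sub F1.subgroup_S_iff psubgroup_prestrict[OF sub1(1)] S12_subset by auto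
  have "restrict (\<lambda>x. x) P1 \<in> Fus1 P1 P1" "restrict (\<lambda>x. x) P1 ` P1 = P1"
    using FS1.identity_morphism[OF sub sub] by auto
  then have cent: "centralizer (group_on L S1) P1 \<subseteq> P1"
    using cr(1) unfolding centric_def by blast
  have Z: "L1 \<inter> L2 \<subseteq> S1" "L1 \<inter> L2 \<subseteq> S2" using center_S sub1(2) sub2(2) by auto
  have "z \<cdot> a = a \<cdot> z" if "z \<in> L1 \<inter> L2" "a \<in> P1" for z a
    using center_mult(2) that P1'(3) by blast
  then have "L1 \<inter> L2 \<subseteq> centralizer (group_on L S1) P1"
    using Z(1) by (auto simp: centralizer_def)
  then have ZP: "L1 \<inter> L2 \<subseteq> P1"
    using cent by blast
  have S2: "psubgroup L S2" using F2.psubgroup_S psubgroup_prestrict[OF sub2(1)] by blast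
  interpret H: split_subgroup p L \<Delta> S L1 \<Delta>1 S1 L2 \<Delta>2 S2 P1 S2
    using P1' ZP S2 Z(2) locality_product_center_axioms by (simp add: split_subgroup_def split_subgroup_axioms_def)
  have "centric (group_on L S2) Fus2 S2" "radical p (group_on L S2) Fus2 S2"
    using F2.centric_S F2.radical_S[OF prime char] by simp_all
  then have "P1 \<star> S2 \<in> centric_radicals p (group_on L S) Fus"
    using H.centric_product[OF cr(1)] H.radical_product[OF cr(2)] H.subgroups(1) by (simp add: centric_radicals_def)
  then have "proj1 (P1 \<star> S2) \<in> \<Delta>1" using assms(1) proj1_object by blast
  then show "P1 \<in> \<Delta>1" using H.proj1_P by simp
qed

lemma linking_locality_product:
  assumes "linking_locality p (prestrict L L1) \<Delta>1 S1" "linking_locality p (prestrict L L2) \<Delta>2 S2"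
  shows "linking_locality p L \<Delta> S"
  using assms objective_characteristic_p_product centric_radicals_product
  by (auto simp: linking_locality_def locality_fusion_eqs)

text \<open>The characteristic of the second factor is settled before the centric radicals of the
  first, because radicality of \<open>S2\<close> depends on it.\<close>

lemma linking_locality_factor1:
  assumes "linking_locality p L \<Delta> S"
  shows "linking_locality p (prestrict L L1) \<Delta>1 S1"
proof -
  have char: "objective_characteristic_p p L \<Delta> S" using assms by (simp add: linking_locality_def)
  have "objective_characteristic_p p (prestrict L L2) \<Delta>2 S2"
    by (rule locality_product_center.objective_characteristic_p_factor1[OF center_swap char])
  then show ?thesis
    using assms objective_characteristic_p_factor1[OF char] centric_radicals_factor1
    by (auto simp: linking_locality_def locality_fusion_eqs)
qed

end

section \<open>The two equivalences\<close>

theorem lemma6p11: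
  fixes p :: nat
    and L :: "'a partial_structure"
    and \<Delta> \<Delta>\<^sub>1 \<Delta>\<^sub>2 :: "'a set set"
    and S L\<^sub>1 L\<^sub>2 S\<^sub>1 S\<^sub>2 :: "'a set"
  assumes "prime p"
    and "locality p L \<Delta> S"
    and "sublocality p L S L\<^sub>1 \<Delta>\<^sub>1 S\<^sub>1"
    and "sublocality p L S L\<^sub>2 \<Delta>\<^sub>2 S\<^sub>2"
    and "locality_central_product p L \<Delta> S L\<^sub>1 \<Delta>\<^sub>1 S\<^sub>1 L\<^sub>2 \<Delta>\<^sub>2 S\<^sub>2"
  shows "((objective_characteristic_p p (prestrict L L\<^sub>1) \<Delta>\<^sub>1 S\<^sub>1 \<and>
           objective_characteristic_p p (prestrict L L\<^sub>2) \<Delta>\<^sub>2 S\<^sub>2) \<longleftrightarrow>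
          (L\<^sub>1 \<inter> L\<^sub>2 \<subseteq> S\<^sub>1 \<inter> S\<^sub>2 \<and> objective_characteristic_p p L \<Delta> S)) \<and>
         ((linking_locality p (prestrict L L\<^sub>1) \<Delta>\<^sub>1 S\<^sub>1 \<and>
           linking_locality p (prestrict L L\<^sub>2) \<Delta>\<^sub>2 S\<^sub>2) \<longleftrightarrow>
          (L\<^sub>1 \<inter> L\<^sub>2 \<subseteq> S\<^sub>1 \<inter> S\<^sub>2 \<and> linking_locality p L \<Delta> S))"
proof -
  interpret locality_product p L \<Delta> S L\<^sub>1 \<Delta>\<^sub>1 S\<^sub>1 L\<^sub>2 \<Delta>\<^sub>2 S\<^sub>2
    using assms by (simp add: locality_product_def locality_product_axioms_def)
  let ?C = "locality_product_center p L \<Delta> S L\<^sub>1 \<Delta>\<^sub>1 S\<^sub>1 L\<^sub>2 \<Delta>\<^sub>2 S\<^sub>2"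
  let ?O1 = "objective_characteristic_p p (prestrict L L\<^sub>1) \<Delta>\<^sub>1 S\<^sub>1"
  let ?O2 = "objective_characteristic_p p (prestrict L L\<^sub>2) \<Delta>\<^sub>2 S\<^sub>2"
  let ?K1 = "linking_locality p (prestrict L L\<^sub>1) \<Delta>\<^sub>1 S\<^sub>1"
  let ?K2 = "linking_locality p (prestrict L L\<^sub>2) \<Delta>\<^sub>2 S\<^sub>2"
  have C_iff: "?C \<longleftrightarrow> L\<^sub>1 \<inter> L\<^sub>2 \<subseteq> S"
    using locality_product_axioms
    by (simp add: locality_product_center_def locality_product_center_axioms_def)
  \<comment> \<open>As \<open>S\<^sub>1\<close> and \<open>S\<^sub>2\<close> are the intersections
    of \<open>S\<close> with the factors, the center lies in both of them if and only if it lies in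
    \<open>S\<close>.\<close>
  then have center: "L\<^sub>1 \<inter> L\<^sub>2 \<subseteq> S\<^sub>1 \<inter> S\<^sub>2 \<longleftrightarrow> ?C"
    unfolding C_iff using sub1(2) sub2(2) by blast
  \<comment> \<open>Both left-hand sides imply this premise and both right-hand sides contain
    \<open>?C\<close> itself, so all implications may be proved within
    \<open>locality_product_center\<close>.\<close>
  have C: "?C" if "?O1"
    using center_subset_S_if_characteristic_p[OF that] C_iff by simp
  have "?O1 \<longrightarrow> ?O2 \<longrightarrow> objective_characteristic_p p L \<Delta> S"
    "objective_characteristic_p p L \<Delta> S \<longrightarrow> ?O1 \<and> ?O2"
    "?K1 \<longrightarrow> ?K2 \<longrightarrow> linking_locality p L \<Delta> S" "linking_locality p L \<Delta> S \<longrightarrow> ?K1 \<and> ?K2" if "?C"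
  proof -
    interpret locality_product_center p L \<Delta> S L\<^sub>1 \<Delta>\<^sub>1 S\<^sub>1 L\<^sub>2 \<Delta>\<^sub>2 S\<^sub>2 by (rule that)
    interpret flip: locality_product_center p L \<Delta> S L\<^sub>2 \<Delta>\<^sub>2 S\<^sub>2 L\<^sub>1 \<Delta>\<^sub>1 S\<^sub>1 by (rule center_swap)
    show "?O1 \<longrightarrow> ?O2 \<longrightarrow> objective_characteristic_p p L \<Delta> S"
      using objective_characteristic_p_product by blast
    show "objective_characteristic_p p L \<Delta> S \<longrightarrow> ?O1 \<and> ?O2"
      using objective_characteristic_p_factor1 flip.objective_characteristic_p_factor1 by blast
    show "?K1 \<longrightarrow> ?K2 \<longrightarrow> linking_locality p L \<Delta> S"
      using linking_locality_product by blast
    show "linking_locality p L \<Delta> S \<longrightarrow> ?K1 \<and> ?K2"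
      using linking_locality_factor1 flip.linking_locality_factor1 by blast
  qed
  moreover have "?K1 \<longrightarrow> ?O1"
    by (simp add: linking_locality_def)
  ultimately show ?thesis
    unfolding center using C by meson
qed

end
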